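(* Let $\mathbb{K}$ be a field and let $X \subset \mathbb{P}^{n_1} \times \dots \times \mathbb{P}^{n_q}$ be a zero-dimensional subscheme over $\mathbb{K}$. For each index $i \in \{1, \dots, q\}$, let $s_i$ be the length of the projection of $X$ onto $\mathbb{P}^{n_i}$. Then the rectangular domain $[0, s_1 - 1] \times \dots \times [0, s_q - 1]$ is relevant to $\mathcal{H}_X$.
   Context: Let $q, n_1, \dots, n_q$ be positive integers and let $\mathbb{V} = \mathbb{P}^{n_1} \times \dots \times \mathbb{P}^{n_q}$, with coordinate ring $\mathbb{S} = \mathbb{K}[x_{ij} \mid 1 \le i \le q,\ 0 \le j \le n_i]$, $\mathbb{Z}^q$-graded by $\deg(x_{ij}) = e_i$, the $i$-th standard basis element of $\mathbb{Z}^q$. For a zero-dimensional subscheme $X \subset \mathbb{V}$, $I(X) \subset \mathbb{S}$ is the ideal generated by the $\mathbb{Z}^q$-homogeneous forms vanishing on $X$, and the Hilbert function of $X$ is $\mathcal{H}_X(a) = \dim_{\mathbb{K}} (\mathbb{S}/I(X))_a$, $a \in \mathbb{Z}^q$. The projection $Z_i$ of $X$ onto $\mathbb{P}^{n_i}$ is the zero-dimensional subscheme of $\mathbb{P}^{n_i}$ defined by the ideal $I(Z_i) = I(X) \cap \mathbb{K}[x_{ij} \mid 0 \le j \le n_i]$; its length is $\dim_{\mathbb{K}} H^0(\mathcal{O}_{Z_i})$. Order on $\mathbb{Z}^q$: $a \le b$ iff $a_i \le b_i$ for all $i$; intervals are integer intervals. For $\mathcal{F}\colon \mathbb{Z}^q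 \to \mathbb{Z}$, the difference function is $$\Delta \mathcal{F}(a) = \mathcal{F}(a) + \sum_{1 \le p \le q} (-1)^p \sum_{1 \le i_1 < \dots < i_p \le q} \mathcal{F}(a - e_{i_1} - \dots - e_{i_p}).$$ A rectangular domain is a set $\{a \in \mathbb{Z}^q \mid 0 \le a \le r\}$ with $r \ge 0$. A rectangular domain $Q$ is relevant to $\mathcal{F}$ (where $\mathcal{F}$ vanishes outside $\{a \ge 0\}$) if $\Delta\mathcal{F}(a) = 0$ for all $a \in \mathbb{Z}^q \setminus Q$. *)

theory Defs
  imports "HOL-Algebra.Ideal" "HOL-Library.Poly_Mapping" "HOL-Library.Function_Algebras"
    "HOL-Library.FuncSet"
begin

section \<open>Dimension of a quotient space\<close>

text \<open>
  \<open>quotient_basis scale V W B\<close>: the cosets of the elements of \<open>B \<subseteq> V\<close> form a finite basis of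
  \<open>V / W\<close>. As with the library's \<open>dim\<close>, the dimension is \<open>0\<close> if there is no finite basis.
\<close>

definition quotient_basis ::
  "('k::field \<Rightarrow> 'v::ab_group_add \<Rightarrow> 'v) \<Rightarrow> 'v set \<Rightarrow> 'v set \<Rightarrow> 'v set \<Rightarrow> bool" where
  "quotient_basis scale V W B \<longleftrightarrow> finite B \<and> B \<subseteq> V \<and>
     (\<forall>u. (\<Sum>b\<in>B. scale (u b) b) \<in> W \<longrightarrow> (\<forall>b\<in>B. u b = 0)) \<and>
     (\<forall>v\<in>V. \<exists>u. v - (\<Sum>b\<in>B. scale (u b) b) \<in> W)"

definition quotient_dim ::
  "('k::field \<Rightarrow> 'v::ab_group_add \<Rightarrow> 'v) \<Rightarrow> 'v set \<Rightarrow> 'v set \<Rightarrow> nat" where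
  "quotient_dim scale V W =
     (if \<exists>B. quotient_basis scale V W B then card (SOME B. quotient_basis scale V W B) else 0)"


section \<open>Laurent polynomials and the multigraded coordinate ring\<close>

text \<open>
  The variable \<open>x\<^sub>i\<^sub>j\<close> is the pair \<open>(i, j)\<close>. The coordinate ring and all of its localizations at
  products of variables are realised as subrings of one Laurent polynomial ring. The parameter
  \<open>Q\<close> is a set of factors: the ambient space is the product of the projective spaces of
  dimension \<open>n i\<close> over \<open>i \<in> Q\<close>. The full product is \<open>Q = UNIV\<close>; its \<open>i\<close>-th factor is \<open>Q = {i}\<close>.
  Multidegrees are functions \<open>'q \<Rightarrow> int\<close>, ordered pointwise.
\<close>

type_synonym 'q expo = "('q \<times> nat) \<Rightarrow>\<^sub>0 int"
type_synonym ('q, 'k) laurent = "'q expo \<Rightarrow>\<^sub>0 'k"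

definition scalar :: "'k::field \<Rightarrow> ('q, 'k) laurent \<Rightarrow> ('q, 'k) laurent" where
  "scalar k f = Poly_Mapping.single 0 k * f"

definition vars :: "'q set \<Rightarrow> ('q \<Rightarrow> nat) \<Rightarrow> ('q \<times> nat) set" where
  "vars Q n = {(i, j). i \<in> Q \<and> j \<le> n i}"

definition multidegree :: "('q \<Rightarrow> nat) \<Rightarrow> 'q expo \<Rightarrow> ('q \<Rightarrow> int)" where
  "multidegree n m = (\<lambda>i. \<Sum>j\<le>n i. Poly_Mapping.lookup m (i, j))"

text \<open>\<open>localization Q n W\<close> is the coordinate ring with the variables in \<open>W\<close> inverted.\<close>

definition localization ::
  "'q set \<Rightarrow> ('q \<Rightarrow> nat) \<Rightarrow> ('q \<times> nat) set \<Rightarrow> ('q, 'k::field) laurent set" where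
  "localization Q n W = {f. \<forall>m\<in>Poly_Mapping.keys f.
     Poly_Mapping.keys m \<subseteq> vars Q n \<and> (\<forall>v. v \<notin> W \<longrightarrow> 0 \<le> Poly_Mapping.lookup m v)}"

definition graded_piece ::
  "'q set \<Rightarrow> ('q \<Rightarrow> nat) \<Rightarrow> ('q \<times> nat) set \<Rightarrow> ('q \<Rightarrow> int) \<Rightarrow> ('q, 'k::field) laurent set" where
  "graded_piece Q n W a =
     {f \<in> localization Q n W. \<forall>m\<in>Poly_Mapping.keys f. multidegree n m = a}"

abbreviation forms :: "'q set \<Rightarrow> ('q \<Rightarrow> nat) \<Rightarrow> ('q \<Rightarrow> int) \<Rightarrow> ('q, 'k::field) laurent set" where
  "forms Q n a \<equiv> graded_piece Q n {} a"

definition subring_of :: "'r::comm_ring_1 set \<Rightarrow> 'r ring" where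
  "subring_of C = \<lparr>carrier = C, monoid.mult = (*), one = 1, ring.zero = 0, add = (+)\<rparr>"

definition coordinate_ring :: "'q set \<Rightarrow> ('q \<Rightarrow> nat) \<Rightarrow> ('q, 'k::field) laurent ring" where
  "coordinate_ring Q n = subring_of (localization Q n {})"


section \<open>Closed subschemes\<close>

text \<open>
  The standard affine chart \<open>c\<close> is the open set on which \<open>x\<^sub>i\<^sub>,\<^sub>c\<^sub>(\<^sub>i\<^sub>) \<noteq> 0\<close> for all \<open>i \<in> Q\<close>. Its ring of
  functions is the degree \<open>0\<close> part of the localization at these variables, and the ring of
  functions on the overlap of two charts is obtained by inverting the variables of both.
\<close>

definition charts :: "'q set \<Rightarrow> ('q \<Rightarrow> nat) \<Rightarrow> ('q \<Rightarrow> nat) set" where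
  "charts Q n = (\<Pi>\<^sub>E i\<in>Q. {..n i})"

definition chart_vars :: "'q set \<Rightarrow> ('q \<Rightarrow> nat) \<Rightarrow> ('q \<times> nat) set" where
  "chart_vars Q c = (\<lambda>i. (i, c i)) ` Q"

definition chart_ring ::
  "'q set \<Rightarrow> ('q \<Rightarrow> nat) \<Rightarrow> ('q \<Rightarrow> nat) \<Rightarrow> ('q, 'k::field) laurent ring" where
  "chart_ring Q n c = subring_of (graded_piece Q n (chart_vars Q c) 0)"

definition overlap_ring ::
  "'q set \<Rightarrow> ('q \<Rightarrow> nat) \<Rightarrow> ('q \<Rightarrow> nat) \<Rightarrow> ('q \<Rightarrow> nat) \<Rightarrow> ('q, 'k::field) laurent ring" where
  "overlap_ring Q n c d = subring_of (graded_piece Q n (chart_vars Q c \<union> chart_vars Q d) 0)"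

text \<open>The monomial of multidegree \<open>a\<close> in the variables that are invertible on the chart \<open>c\<close>.\<close>

definition chart_monom ::
  "'q set \<Rightarrow> ('q \<Rightarrow> nat) \<Rightarrow> ('q \<Rightarrow> int) \<Rightarrow> ('q, 'k::field) laurent" where
  "chart_monom Q c a = Poly_Mapping.single (\<Sum>i\<in>Q. Poly_Mapping.single (i, c i) (a i)) 1"

text \<open>
  A closed subscheme is given by its quasi-coherent ideal sheaf, that is, by an ideal \<open>X c\<close> in the
  ring of each standard chart, such that any two of them generate the same ideal on the overlap.
  Values of \<open>X\<close> outside \<open>charts Q n\<close> are irrelevant.
\<close>

type_synonym ('q, 'k) ideal_sheaf = "('q \<Rightarrow> nat) \<Rightarrow> ('q, 'k) laurent set"

definition closed_subscheme ::
  "'q set \<Rightarrow> ('q \<Rightarrow> nat) \<Rightarrow> ('q, 'k::field) ideal_sheaf \<Rightarrow> bool" where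
  "closed_subscheme Q n X \<longleftrightarrow>
     (\<forall>c\<in>charts Q n. ideal (X c) (chart_ring Q n c)) \<and>
     (\<forall>c\<in>charts Q n. \<forall>d\<in>charts Q n.
        genideal (overlap_ring Q n c d) (X c) = genideal (overlap_ring Q n c d) (X d))"

text \<open>
  Dimension zero: the subscheme is nonempty, and on no chart is there a strict chain of two
  primes containing the ideal of the subscheme.
\<close>

definition zero_dimensional ::
  "'q set \<Rightarrow> ('q \<Rightarrow> nat) \<Rightarrow> ('q, 'k::field) ideal_sheaf \<Rightarrow> bool" where
  "zero_dimensional Q n X \<longleftrightarrow>
     (\<exists>c\<in>charts Q n. X c \<noteq> carrier (chart_ring Q n c)) \<and>
     (\<forall>c\<in>charts Q n. \<not> (\<exists>P P'. primeideal P (chart_ring Q n c) \<and>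
        primeideal P' (chart_ring Q n c) \<and> X c \<subseteq> P \<and> P \<subset> P'))"

text \<open>
  A form of degree \<open>a\<close> vanishes on \<open>X\<close> if on every chart its quotient by the invertible monomial
  of degree \<open>a\<close> lies in the ideal of \<open>X\<close>.
\<close>

definition vanishes_on ::
  "'q set \<Rightarrow> ('q \<Rightarrow> nat) \<Rightarrow> ('q \<Rightarrow> int) \<Rightarrow> ('q, 'k::field) laurent \<Rightarrow> ('q, 'k) ideal_sheaf \<Rightarrow> bool"
  where
  "vanishes_on Q n a f X \<longleftrightarrow> (\<forall>c\<in>charts Q n. f * chart_monom Q c (- a) \<in> X c)"

definition ideal_of ::
  "'q set \<Rightarrow> ('q \<Rightarrow> nat) \<Rightarrow> ('q, 'k::field) ideal_sheaf \<Rightarrow> ('q, 'k) laurent set" where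
  "ideal_of Q n X =
     genideal (coordinate_ring Q n) {f. \<exists>a. f \<in> forms Q n a \<and> vanishes_on Q n a f X}"

definition hilbert_function ::
  "('q \<Rightarrow> nat) \<Rightarrow> ('q, 'k::field) ideal_sheaf \<Rightarrow> ('q \<Rightarrow> int) \<Rightarrow> int" where
  "hilbert_function n X a =
     int (quotient_dim scalar (forms UNIV n a) (forms UNIV n a \<inter> ideal_of UNIV n X))"


section \<open>Projections and their length\<close>

text \<open>
  The subscheme defined by a homogeneous ideal \<open>J\<close>: on the chart \<open>c\<close> its ideal is the degree \<open>0\<close>
  part of the localization of \<open>J\<close> at the product of the variables of that chart.
\<close>

definition subscheme_of ::
  "'q set \<Rightarrow> ('q \<Rightarrow> nat) \<Rightarrow> ('q, 'k::field) laurent set \<Rightarrow> ('q, 'k) ideal_sheaf" where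
  "subscheme_of Q n J c =
     {f \<in> carrier (chart_ring Q n c). \<exists>k::nat. chart_monom Q c (\<lambda>_. int k) * f \<in> J}"

definition projection ::
  "('q \<Rightarrow> nat) \<Rightarrow> ('q, 'k::field) ideal_sheaf \<Rightarrow> 'q \<Rightarrow> ('q, 'k) ideal_sheaf" where
  "projection n X i =
     subscheme_of {i} n (ideal_of UNIV n X \<inter> carrier (coordinate_ring {i} n))"

text \<open>
  Global sections of the structure sheaf of a closed subscheme \<open>Z\<close> are families of functions on
  the charts of \<open>Z\<close> that agree on overlaps. They are represented by families of functions on the
  charts of the ambient space, so the space of global sections is the quotient of
  \<open>section_families\<close> by \<open>null_families\<close>.
\<close>

definition section_families ::
  "'q set \<Rightarrow> ('q \<Rightarrow> nat) \<Rightarrow> ('q, 'k::field) ideal_sheaf \<Rightarrow> (('q \<Rightarrow> nat) \<Rightarrow> ('q, 'k) laurent) set"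
  where
  "section_families Q n Z = {s. (\<forall>c. c \<notin> charts Q n \<longrightarrow> s c = 0) \<and>
     (\<forall>c\<in>charts Q n. s c \<in> carrier (chart_ring Q n c)) \<and>
     (\<forall>c\<in>charts Q n. \<forall>d\<in>charts Q n. s c - s d \<in> genideal (overlap_ring Q n c d) (Z c))}"

definition null_families ::
  "'q set \<Rightarrow> ('q \<Rightarrow> nat) \<Rightarrow> ('q, 'k::field) ideal_sheaf \<Rightarrow> (('q \<Rightarrow> nat) \<Rightarrow> ('q, 'k) laurent) set"
  where
  "null_families Q n Z =
     {s. (\<forall>c. c \<notin> charts Q n \<longrightarrow> s c = 0) \<and> (\<forall>c\<in>charts Q n. s c \<in> Z c)}"

definition scheme_length ::
  "'q set \<Rightarrow> ('q \<Rightarrow> nat) \<Rightarrow> ('q, 'k::field) ideal_sheaf \<Rightarrow> nat" where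
  "scheme_length Q n Z =
     quotient_dim (\<lambda>k s c. scalar k (s c)) (section_families Q n Z) (null_families Q n Z)"


section \<open>Difference functions and relevant domains\<close>

definition unit_degree :: "'q \<Rightarrow> ('q \<Rightarrow> int)" where
  "unit_degree i = (\<lambda>k. if k = i then 1 else 0)"

definition difference_function ::
  "(('q::finite \<Rightarrow> int) \<Rightarrow> int) \<Rightarrow> ('q \<Rightarrow> int) \<Rightarrow> int" where
  "difference_function F a = F a +
     (\<Sum>p = 1..card (UNIV :: 'q set). (- 1) ^ p *
        (\<Sum>T | card T = p. F (a - (\<Sum>i\<in>T. unit_degree i))))"

definition rectangular_domain :: "('q \<Rightarrow> int) set \<Rightarrow> bool" where
  "rectangular_domain D \<longleftrightarrow> (\<exists>r\<ge>0. D = {a. 0 \<le> a \<and> a \<le> r})"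

definition relevant :: "('q::finite \<Rightarrow> int) set \<Rightarrow> (('q \<Rightarrow> int) \<Rightarrow> int) \<Rightarrow> bool" where
  "relevant D F \<longleftrightarrow> rectangular_domain D \<and> (\<forall>a. \<not> 0 \<le> a \<longrightarrow> F a = 0) \<and>
     (\<forall>a. a \<notin> D \<longrightarrow> difference_function F a = 0)"

end

theory Submission
  imports Defs "HOL-Computational_Algebra.Polynomial"
begin

text \<open>
  Let \<open>H\<close> be the Hilbert function of \<open>X\<close>, let \<open>e\<^sub>i\<close> be the \<open>i\<close>-th unit degree and \<open>s\<^sub>i\<close> the length of the
  \<open>i\<close>-th projection \<open>Z\<^sub>i\<close>. In the difference function of \<open>H\<close> the terms for \<open>T\<close> and \<open>insert i T\<close> cancel if
  \<open>H b = H (b - e\<^sub>i)\<close> for all \<open>b\<close> with a given \<open>i\<close>-th entry. As \<open>H\<close> vanishes outside \<open>b \<ge> 0\<close>, it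
  suffices to show this equation for \<open>b \<ge> 0\<close> with \<open>b\<^sub>i \<ge> s\<^sub>i\<close>: the function \<open>H\<close> is stationary in
  direction \<open>i\<close> from \<open>s\<^sub>i - 1\<close> on.

  The coordinate ring of \<open>X\<close> is saturated, so over an infinite field a general linear form \<open>l\<close> of degree
  \<open>e\<^sub>i\<close> is a nonzerodivisor on it. The field may be finite; therefore a variable \<open>t\<close> is adjoined and
  \<open>l\<close> is the form \<open>\<Sum>j. t^j x\<^sub>i\<^sub>j\<close>. That it is a nonzerodivisor over \<open>K[t]\<close> is McCoy's theorem, applied to a
  saturated graded module (\<open>generic_form_nonzerodivisor\<close>). Dimensions over \<open>K\<close> are compared by means
  of linear independence over \<open>K[t]\<close> (\<open>poly_linear_dependence\<close>), so that no field has to be extended.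

  Now \<open>H\<close> is monotone. If \<open>H (a + e\<^sub>i) = H a\<close>, then multiplication by \<open>l\<close> from degree \<open>a\<close> to
  degree \<open>a + e\<^sub>i\<close> is surjective over \<open>K(t)\<close>. Surjectivity persists in all degrees \<open>b \<ge> a\<close>, since the
  forms of higher degree are generated by those of degree \<open>a + e\<^sub>i\<close>; hence \<open>H (b + e\<^sub>i) = H b\<close>
  (\<open>hilbert_function_stationary_above\<close>). This is applied with \<open>a = d e\<^sub>i\<close>. Such \<open>d < s\<^sub>i\<close> with
  \<open>H ((d + 1) e\<^sub>i) = H (d e\<^sub>i)\<close> exists because \<open>1 \<le> H 0\<close> and \<open>H (d e\<^sub>i) \<le> s\<^sub>i\<close> for all \<open>d\<close>
  (\<open>hilbert_function_le_length\<close>).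

  For the last inequality, forms of degree \<open>d\<close> on \<open>Z\<^sub>i\<close> are turned into global functions by division
  by \<open>l^d\<close>. The division is possible because the coordinate rings of \<open>Z\<^sub>i\<close> on the charts have finite
  dimension over \<open>K\<close>, so that \<open>l\<close> divides a nonzero polynomial in \<open>K[t]\<close> there. Finite dimension comes
  from the Krull dimension zero of \<open>X\<close>: a coordinate function that is transcendental modulo the ideal of \<open>X\<close>
  would remain transcendental modulo some prime ideal. By the dimension hypothesis the residue ring is
  a field, and it is finitely generated, in contradiction to Zariski's lemma
  (\<open>algebraic_if_no_prime_chain\<close>).
\<close>

section \<open>Ideals and linear dependence modulo a prime\<close>

text \<open>
  All rings below are subsets of one ambient commutative ring, and quotients are never formed: an
  equation \<open>x = y\<close> in \<open>C / P\<close> is the membership \<open>x - y \<in> P\<close>. So the many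
  quotients and localizations of a proof share one type.
\<close>

definition subring_set :: "'r::comm_ring_1 set \<Rightarrow> bool" where
  "subring_set A \<longleftrightarrow> 1 \<in> A \<and> (\<forall>a\<in>A. \<forall>b\<in>A. a - b \<in> A \<and> a * b \<in> A)"

definition ideal_set :: "'r::comm_ring_1 set \<Rightarrow> 'r set \<Rightarrow> bool" where
  "ideal_set C P \<longleftrightarrow> P \<subseteq> C \<and> 0 \<in> P \<and> (\<forall>a\<in>P. \<forall>b\<in>P. a + b \<in> P) \<and> (\<forall>c\<in>C. \<forall>a\<in>P. c * a \<in> P)"

definition prime_set :: "'r::comm_ring_1 set \<Rightarrow> 'r set \<Rightarrow> bool" where
  "prime_set C P \<longleftrightarrow> ideal_set C P \<and> 1 \<notin> P \<and> (\<forall>a\<in>C. \<forall>b\<in>C. a * b \<in> P \<longrightarrow> a \<in> P \<or> b \<in> P)"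

lemma subring_setD:
  assumes "subring_set A"
  shows subring_one: "1 \<in> A" and subring_zero: "0 \<in> A"
    and subring_diff: "a \<in> A \<Longrightarrow> b \<in> A \<Longrightarrow> a - b \<in> A"
    and subring_mult: "a \<in> A \<Longrightarrow> b \<in> A \<Longrightarrow> a * b \<in> A"
    and subring_uminus: "a \<in> A \<Longrightarrow> - a \<in> A"
    and subring_add: "a \<in> A \<Longrightarrow> b \<in> A \<Longrightarrow> a + b \<in> A"
proof -
  show 1: "1 \<in> A" and d: "a \<in> A \<Longrightarrow> b \<in> A \<Longrightarrow> a - b \<in> A" for a b
    using assms by (auto simp: subring_set_def)
  show "a \<in> A \<Longrightarrow> b \<in> A \<Longrightarrow> a * b \<in> A" using assms by (auto simp: subring_set_def)
  show 0: "0 \<in> A" using d[OF 1 1] by simp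
  show m: "a \<in> A \<Longrightarrow> - a \<in> A" for a using d[OF 0] by simp
  show "a \<in> A \<Longrightarrow> b \<in> A \<Longrightarrow> a + b \<in> A" using d[of a "- b"] m by simp
qed

lemma subring_sum: "subring_set A \<Longrightarrow> (\<And>i. i \<in> I \<Longrightarrow> f i \<in> A) \<Longrightarrow> sum f I \<in> A"
  by (induction I rule: infinite_finite_induct) (auto intro: subring_zero subring_add)

lemma subring_power: "subring_set A \<Longrightarrow> a \<in> A \<Longrightarrow> a ^ k \<in> A"
  by (induction k) (auto intro: subring_one subring_mult)

lemma ideal_setD:
  assumes "ideal_set C P" "subring_set C"
  shows ideal_zero: "0 \<in> P" and ideal_carrier: "a \<in> P \<Longrightarrow> a \<in> C"
    and ideal_add: "a \<in> P \<Longrightarrow> b \<in> P \<Longrightarrow> a + b \<in> P"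
    and ideal_mult_left: "c \<in> C \<Longrightarrow> a \<in> P \<Longrightarrow> c * a \<in> P"
    and ideal_mult_right: "c \<in> C \<Longrightarrow> a \<in> P \<Longrightarrow> a * c \<in> P"
    and ideal_uminus: "a \<in> P \<Longrightarrow> - a \<in> P"
    and ideal_diff: "a \<in> P \<Longrightarrow> b \<in> P \<Longrightarrow> a - b \<in> P"
proof -
  show "0 \<in> P" "a \<in> P \<Longrightarrow> a \<in> C" using assms by (auto simp: ideal_set_def)
  show p: "a \<in> P \<Longrightarrow> b \<in> P \<Longrightarrow> a + b \<in> P" for a b using assms by (auto simp: ideal_set_def)
  show m: "c \<in> C \<Longrightarrow> a \<in> P \<Longrightarrow> c * a \<in> P" for c a using assms by (auto simp: ideal_set_def)
  show "c \<in> C \<Longrightarrow> a \<in> P \<Longrightarrow> a * c \<in> P" using m[of c a] by (simp add: mult.commute)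
  show n: "a \<in> P \<Longrightarrow> - a \<in> P" for a
    using m[OF subring_uminus[OF assms(2) subring_one[OF assms(2)]]] by simp
  show "a \<in> P \<Longrightarrow> b \<in> P \<Longrightarrow> a - b \<in> P" using p[OF _ n] by force
qed

lemma ideal_sum:
  "ideal_set C P \<Longrightarrow> subring_set C \<Longrightarrow> (\<And>i. i \<in> I \<Longrightarrow> f i \<in> P) \<Longrightarrow> sum f I \<in> P"
  by (induction I rule: infinite_finite_induct) (auto intro: ideal_zero ideal_add)

lemma prime_setD:
  assumes "prime_set C P"
  shows prime_ideal: "ideal_set C P" and prime_one: "1 \<notin> P"
    and prime_mult: "a \<in> C \<Longrightarrow> b \<in> C \<Longrightarrow> a * b \<in> P \<Longrightarrow> a \<in> P \<or> b \<in> P"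
  using assms by (auto simp: prime_set_def)

lemma prime_power:
  "prime_set C P \<Longrightarrow> subring_set C \<Longrightarrow> a \<in> C \<Longrightarrow> a ^ k \<in> P \<Longrightarrow> a \<in> P"
  by (induction k) (auto dest: prime_one prime_mult subring_power)

text \<open>
  Over the domain \<open>A / P\<close>, more vectors than coordinates are linearly dependent. The proof is
  fraction-free Gaussian elimination: a coordinate in which some vector \<open>v j0\<close> does not vanish
  is cleared from the other vectors. It is used for two domains, namely a subring modulo a prime,
  and the polynomial ring over a field (with \<open>P = {0}\<close>).
\<close>

lemma linear_dependence_mod_prime:
  fixes v :: "'j \<Rightarrow> 'b \<Rightarrow> 'r::comm_ring_1"
  assumes "finite B" "finite J" "card B < card J"
    and C: "subring_set C" and P: "prime_set C P" and A: "subring_set A" "A \<subseteq> C"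
    and "\<And>j b. j \<in> J \<Longrightarrow> b \<in> B \<Longrightarrow> v j b \<in> A"
  shows "\<exists>p. (\<forall>j. p j \<in> A) \<and> (\<exists>j\<in>J. p j \<notin> P) \<and> (\<forall>b\<in>B. (\<Sum>j\<in>J. p j * v j b) \<in> P)"
  using assms(1,2,3,8)
proof (induction B arbitrary: J v rule: finite_induct)
  case empty
  then obtain j where "j \<in> J" by fastforce
  then show ?case
    using prime_one[OF P] subring_one[OF A(1)] by (intro exI[of _ "\<lambda>_. 1"]) auto
next
  case (insert b0 B)
  note I = prime_ideal[OF P] C
  show ?case
  proof (cases "\<forall>j\<in>J. v j b0 \<in> P")
    case True
    have "card B < card J" using insert by simp
    from insert.IH[OF insert.prems(1) this, of v] insert.prems(3)
    obtain p where p: "\<forall>j. p j \<in> A" "\<exists>j\<in>J. p j \<notin> P" "\<forall>b\<in>B. (\<Sum>j\<in>J. p j * v j b) \<in> P"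
      by auto
    have "(\<Sum>j\<in>J. p j * v j b0) \<in> P"
      using True p(1) A(2) by (auto intro!: ideal_sum[OF I] ideal_mult_left[OF I])
    with p show ?thesis by blast
  next
    case False
    then obtain j0 where j0: "j0 \<in> J" "v j0 b0 \<notin> P" by blast
    define K where "K = J - {j0}"
    have J: "J = insert j0 K" "j0 \<notin> K" "finite K" using j0 insert.prems(1) by (auto simp: K_def)
    define w where "w j b = v j0 b0 * v j b - v j b0 * v j0 b" for j b
    have "card B < card K" using insert J by simp
    moreover have "w j b \<in> A" if "j \<in> K" "b \<in> B" for j b
      unfolding w_def using that insert.prems(3) J by (intro subring_diff subring_mult A) auto
    ultimately obtain p where p: "\<forall>j. p j \<in> A" "\<exists>j\<in>K. p j \<notin> P"
        "\<forall>b\<in>B. (\<Sum>j\<in>K. p j * w j b) \<in> P"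
      using insert.IH[OF J(3), of w] by blast
    define r where "r j = (if j = j0 then - (\<Sum>i\<in>K. p i * v i b0)
      else if j \<in> K then p j * v j0 b0 else 0)" for j
    have vA: "v j b \<in> A" if "j \<in> J" "b \<in> insert b0 B" for j b using that insert.prems(3) by auto
    have rA: "r j \<in> A" for j
      using p(1) vA J by (auto simp: r_def intro!: subring_uminus subring_sum subring_mult A subring_zero)
    have sum_r: "(\<Sum>j\<in>J. r j * v j b) = (\<Sum>j\<in>K. p j * w j b)" for b
    proof -
      have "(\<Sum>j\<in>J. r j * v j b) = r j0 * v j0 b + (\<Sum>j\<in>K. r j * v j b)"
        using J by simp
      also have "(\<Sum>j\<in>K. r j * v j b) = (\<Sum>j\<in>K. p j * v j0 b0 * v j b)"
        using J by (intro sum.cong) (auto simp: r_def)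
      also have "r j0 * v j0 b = - (\<Sum>j\<in>K. p j * v j b0 * v j0 b)"
        by (simp add: r_def sum_distrib_right)
      finally show ?thesis
        by (simp add: w_def algebra_simps sum_subtractf)
    qed
    obtain j1 where j1: "j1 \<in> K" "p j1 \<notin> P" using p(2) by blast
    have "r j1 \<notin> P"
      using j1 J j0 p(1) vA[OF j0(1), of b0] A(2) prime_mult[OF P, of "p j1" "v j0 b0"]
      by (auto simp: r_def)
    moreover have "(\<Sum>j\<in>K. p j * w j b0) = 0" by (simp add: w_def)
    ultimately show ?thesis
      using sum_r rA p(3) j1 J ideal_zero[OF I] by (intro exI[of _ r]) auto
  qed
qed

section \<open>Generators of fields are algebraic\<close>

text \<open>
  The set of coefficients may be a subring, an ideal or just a subspace \<open>W\<close>; in the last two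
  cases membership of \<open>f\<close> says that \<open>f\<close> vanishes in the polynomials over the quotient.
\<close>

definition polys :: "'r::comm_ring_1 set \<Rightarrow> 'r poly set" where
  "polys A = {p. \<forall>i. coeff p i \<in> A}"

lemma polysI: "(\<And>i. coeff p i \<in> A) \<Longrightarrow> p \<in> polys A"
  and polysD: "p \<in> polys A \<Longrightarrow> coeff p i \<in> A"
  by (auto simp: polys_def)

lemma subring_polys:
  assumes "subring_set A"
  shows "subring_set (polys A)"
  unfolding subring_set_def
proof (intro conjI ballI)
  note A = assms
  show "1 \<in> polys A"
    by (intro polysI) (auto simp: coeff_1 subring_one[OF A] subring_zero[OF A])
  fix p q assume "p \<in> polys A" "q \<in> polys A"
  then show "p - q \<in> polys A" "p * q \<in> polys A"
    by (auto intro!: polysI subring_diff subring_mult subring_sum A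
        simp: polysD coeff_mult)
qed

lemma polys_monom: "subring_set A \<Longrightarrow> a \<in> A \<Longrightarrow> monom a k \<in> polys A"
  by (intro polysI) (auto simp: subring_zero)

lemma polys_const: "subring_set A \<Longrightarrow> a \<in> A \<Longrightarrow> [:a:] \<in> polys A"
  using polys_monom[of A a 0] by (simp add: monom_0)

lemma polys_pCons:
  "subring_set A \<Longrightarrow> a \<in> A \<Longrightarrow> p \<in> polys A \<Longrightarrow> pCons a p \<in> polys A"
  by (intro polysI) (auto simp: coeff_pCons polysD split: nat.splits)

lemma polys_smult:
  "subring_set A \<Longrightarrow> a \<in> A \<Longrightarrow> p \<in> polys A \<Longrightarrow> smult a p \<in> polys A"
  by (intro polysI) (auto simp: polysD subring_mult)

lemma poly_in_subring:
  "subring_set A \<Longrightarrow> p \<in> polys A \<Longrightarrow> y \<in> A \<Longrightarrow> poly p y \<in> A"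
  unfolding poly_altdef by (auto intro!: subring_sum subring_mult subring_power polysD)

lemma poly_in_ideal:
  assumes "subring_set C" "ideal_set C P" "p \<in> polys P" "y \<in> C"
  shows "poly p y \<in> P"
  unfolding poly_altdef
  by (intro ideal_sum[OF assms(2,1)] ideal_mult_right[OF assms(2,1)] subring_power
      polysD[OF assms(3)] assms)

definition adjoin :: "'r::comm_ring_1 set \<Rightarrow> 'r \<Rightarrow> 'r set" where
  "adjoin A y = (\<lambda>p. poly p y) ` polys A"

lemma adjoinI: "p \<in> polys A \<Longrightarrow> poly p y \<in> adjoin A y"
  by (auto simp: adjoin_def)

lemma subring_adjoin:
  assumes "subring_set A"
  shows "subring_set (adjoin A y)"
  unfolding subring_set_def
proof (intro conjI ballI)
  note A = subring_polys[OF assms]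
  show "1 \<in> adjoin A y" using adjoinI[OF subring_one[OF A], of y] by simp
  fix a b assume "a \<in> adjoin A y" "b \<in> adjoin A y"
  then obtain p q where "a = poly p y" "b = poly q y" "p \<in> polys A" "q \<in> polys A"
    by (auto simp: adjoin_def)
  then show "a - b \<in> adjoin A y" "a * b \<in> adjoin A y"
    using adjoinI[OF subring_diff[OF A, of p q], of y] adjoinI[OF subring_mult[OF A, of p q], of y]
    by auto
qed

lemma adjoin_base: "subring_set A \<Longrightarrow> A \<subseteq> adjoin A y"
  using adjoinI[OF polys_const, of A _ y] by auto

lemma adjoin_generator: "subring_set A \<Longrightarrow> y \<in> adjoin A y"
  using adjoinI[OF polys_monom[of A 1 1], of y] by (simp add: poly_monom subring_one)

lemma adjoin_subset: "subring_set C \<Longrightarrow> A \<subseteq> C \<Longrightarrow> y \<in> C \<Longrightarrow> adjoin A y \<subseteq> C"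
  unfolding adjoin_def by (intro image_subsetI poly_in_subring polysI) (auto dest: polysD)

text \<open>
  The relation has to be nonzero over \<open>A / P\<close>: some coefficient lies outside \<open>P\<close>.
\<close>

definition algebraic_mod :: "'r::comm_ring_1 set \<Rightarrow> 'r set \<Rightarrow> 'r \<Rightarrow> bool" where
  "algebraic_mod A P y \<longleftrightarrow> (\<exists>p\<in>polys A. p \<notin> polys P \<and> poly p y \<in> P)"

text \<open>
  The domain \<open>A / P\<close> becomes a field when one suitable element \<open>g\<close> is inverted; such
  domains are known as Goldman domains. Fields are the case \<open>g = 1\<close>. Unlike the property of
  being a field, this one descends from \<open>A[y]\<close> to \<open>A\<close>.
\<close>

definition almost_field_mod :: "'r::comm_ring_1 set \<Rightarrow> 'r set \<Rightarrow> bool" where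
  "almost_field_mod A P \<longleftrightarrow> (\<exists>g\<in>A - P. \<forall>a\<in>A - P. \<exists>c\<in>A. \<exists>k. a * c - g ^ k \<in> P)"

lemma top_coeff_mod:
  fixes p :: "'r::comm_ring_1 poly"
  assumes "p \<notin> polys P" "0 \<in> P"
  obtains m where "coeff p m \<notin> P" "\<And>i. m < i \<Longrightarrow> coeff p i \<in> P"
proof -
  have sub: "{i. coeff p i \<notin> P} \<subseteq> {..degree p}"
    using assms(2) by (auto intro!: le_degree)
  have ne: "{i. coeff p i \<notin> P} \<noteq> {}" using assms(1) by (auto simp: polys_def)
  have fin: "finite {i. coeff p i \<notin> P}" using sub finite_subset by blast
  show ?thesis
  proof (rule that)
    show "coeff p (Max {i. coeff p i \<notin> P}) \<notin> P" using Max_in[OF fin ne] by simp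
    show "coeff p i \<in> P" if "Max {i. coeff p i \<notin> P} < i" for i
      using Max_ge[OF fin, of i] that by fastforce
  qed
qed

lemma coeff_mult_top_mod:
  assumes C: "subring_set C" and P: "prime_set C P"
    and pC: "p \<in> polys C" and qC: "q \<in> polys C"
    and p: "coeff p m \<notin> P" "\<And>i. m < i \<Longrightarrow> coeff p i \<in> P"
    and q: "coeff q l \<notin> P" "\<And>i. l < i \<Longrightarrow> coeff q i \<in> P"
  shows "coeff (p * q) (m + l) \<notin> P"
proof
  note I = prime_ideal[OF P] C
  assume *: "coeff (p * q) (m + l) \<in> P"
  have "coeff (p * q) (m + l) = coeff p m * coeff q l
      + (\<Sum>i\<in>{..m + l} - {m}. coeff p i * coeff q (m + l - i))"
    unfolding coeff_mult by (subst sum.remove[of _ m]) auto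
  moreover have "(\<Sum>i\<in>{..m + l} - {m}. coeff p i * coeff q (m + l - i)) \<in> P"
  proof (intro ideal_sum[OF I])
    fix i assume "i \<in> {..m + l} - {m}"
    then consider "m < i" | "l < m + l - i" by fastforce
    then show "coeff p i * coeff q (m + l - i) \<in> P"
      by cases (auto intro: ideal_mult_left[OF I] ideal_mult_right[OF I] p q
          polysD[OF pC] polysD[OF qC])
  qed
  ultimately have "coeff p m * coeff q l \<in> P"
    using ideal_diff[OF I *, of "\<Sum>i\<in>{..m + l} - {m}. coeff p i * coeff q (m + l - i)"] by simp
  then show False
    using prime_mult[OF P] p(1) q(1) polysD[OF pC] polysD[OF qC] by blast
qed

text \<open>
  If \<open>y\<close> were transcendental over \<open>A / P\<close>, then \<open>1 + y g\<close> would be a nonzero polynomial of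
  positive degree dividing a power of \<open>g\<close>. Modulo \<open>1 + y g\<close> the element \<open>y g\<close> is \<open>-1\<close>, so
  \<open>1 + y g\<close> would divide \<open>1\<close>; this contradicts the additivity of degrees.
\<close>

lemma algebraic_if_almost_field_adjoin:
  assumes C: "subring_set C" and P: "prime_set C P" and A: "subring_set A" "A \<subseteq> C" and y: "y \<in> C"
    and G: "almost_field_mod (adjoin A y) P"
  shows "algebraic_mod A P y"
proof (rule ccontr)
  assume trans: "\<not> algebraic_mod A P y"
  note I = prime_ideal[OF P] C
  define D where "D = adjoin A y"
  have D: "subring_set D" "D \<subseteq> C" "A \<subseteq> D" "y \<in> D"
    using subring_adjoin[OF A(1)] adjoin_subset[OF C A(2) y] adjoin_base[OF A(1)]
      adjoin_generator[OF A(1)] by (auto simp: D_def)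
  have polyP: "p \<in> polys P" if "p \<in> polys A" "poly p y \<in> P" for p
    using trans that by (auto simp: algebraic_mod_def)
  obtain g where g: "g \<in> D" "g \<notin> P" and inv: "\<And>a. a \<in> D \<Longrightarrow> a \<notin> P \<Longrightarrow> \<exists>c\<in>D. \<exists>k. a * c - g ^ k \<in> P"
    using G by (auto simp: almost_field_mod_def D_def)
  obtain f where f: "f \<in> polys A" "g = poly f y" using g(1) by (auto simp: D_def adjoin_def)
  \<comment> \<open>This is the polynomial \<open>1 + y g\<close>.\<close>
  define q where "q = pCons 1 f"
  have qA: "q \<in> polys A" unfolding q_def by (intro polys_pCons A f subring_one)
  have AC: "polys A \<subseteq> polys C" using A(2) by (auto simp: polys_def)
  define a where "a = poly q y"
  have a: "a = 1 + y * g" by (simp add: a_def q_def f)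
  have aD: "a \<in> D" unfolding a by (intro subring_add subring_mult D g subring_one)
  have "a \<notin> P"
    using polyP[OF qA] polysD[of q P 0] prime_one[OF P] by (auto simp: a_def q_def)
  then obtain c k where c: "c \<in> D" "a * c - g ^ k \<in> P" using inv[OF aD] by blast
  have "\<exists>s\<in>D. (a - 1) ^ k = a * s + (- 1) ^ k"
  proof (induction k)
    case 0
    show ?case using subring_zero[OF D(1)] by (intro bexI[of _ 0]) auto
  next
    case (Suc k)
    then obtain s where s: "s \<in> D" "(a - 1) ^ k = a * s + (- 1) ^ k" by blast
    have "(a - 1) ^ Suc k = a * ((a - 1) * s + (- 1) ^ k) + (- 1) ^ Suc k"
      by (simp add: s(2) algebra_simps)
    moreover have "(a - 1) * s + (- 1) ^ k \<in> D"
      by (intro subring_add subring_mult subring_diff subring_power subring_uminus D aD s subring_one)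
    ultimately show ?case by blast
  qed
  then obtain s where s: "s \<in> D" "(a - 1) ^ k = a * s + (- 1) ^ k" by blast
  define u where "u = (- 1) ^ k * (y ^ k * c - s)"
  have uD: "u \<in> D" unfolding u_def
    by (intro subring_mult subring_diff subring_power subring_uminus D c s subring_one)
  have "y ^ k * g ^ k = a * s + (- 1) ^ k"
    using s(2) by (simp add: a power_mult_distrib)
  moreover have "(- 1) ^ k * (- 1) ^ k = (1 :: 'a)"
    by (simp flip: power_mult_distrib)
  ultimately have "(- 1) ^ k * (y ^ k * g ^ k) = a * ((- 1) ^ k * s) + 1"
    by (simp add: distrib_left mult.left_commute)
  then have "a * u - 1 = ((- 1) ^ k * y ^ k) * (a * c - g ^ k)"
    unfolding u_def by (simp add: algebra_simps)
  \<comment> \<open>Multiplying \<open>a c = g^k\<close> by \<open>y^k\<close> makes \<open>a\<close> a unit modulo \<open>P\<close>.\<close>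
  moreover have "(- 1) ^ k * y ^ k \<in> C"
    by (intro subring_mult subring_power subring_uminus C y subring_one)
  ultimately have au: "a * u - 1 \<in> P" using ideal_mult_left[OF I _ c(2)] by simp
  obtain r where r: "r \<in> polys A" "u = poly r y" using uD by (auto simp: D_def adjoin_def)
  have "q * r - 1 \<in> polys P"
    by (intro polyP subring_diff subring_mult subring_one subring_polys A qA r(1))
      (use au in \<open>simp add: a_def r(2)\<close>)
  then have qr: "coeff (q * r) i - coeff 1 i \<in> P" for i
    using polysD[of "q * r - 1" P i] by simp
  have "f \<notin> polys P" using poly_in_ideal[OF C I(1) _ y, of f] g(2) f(2) by auto
  then obtain m where m: "coeff f m \<notin> P" "\<And>i. m < i \<Longrightarrow> coeff f i \<in> P"
    using top_coeff_mod ideal_zero[OF I] by blast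
  have "coeff q (Suc m) \<notin> P" "\<And>i. Suc m < i \<Longrightarrow> coeff q i \<in> P"
    using m by (auto simp: q_def coeff_pCons split: nat.splits)
  moreover have "r \<notin> polys P"
  proof
    assume "r \<in> polys P"
    then have "coeff (q * r) 0 \<in> P"
      by (simp add: coeff_mult_0 q_def polysD)
    then show False using ideal_diff[OF I _ qr[of 0]] prime_one[OF P] by fastforce
  qed
  then obtain l where "coeff r l \<notin> P" "\<And>i. l < i \<Longrightarrow> coeff r i \<in> P"
    using top_coeff_mod ideal_zero[OF I] by blast
  ultimately have "coeff (q * r) (Suc m + l) \<notin> P"
    using AC qA r(1) by (intro coeff_mult_top_mod[OF C P]) auto
  then show False using qr[of "Suc m + l"] by simp
qed

lemma ideal_power_diff:
  assumes "ideal_set C P" "subring_set C" "x \<in> C" "y \<in> C" "x - y \<in> P"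
  shows "x ^ k - y ^ k \<in> P"
proof -
  have "x ^ k - y ^ k = (x - y) * (\<Sum>i<k. y ^ (k - Suc i) * x ^ i)" by (rule power_diff_sumr2)
  then show ?thesis
    by (auto intro!: ideal_mult_right[OF assms(1,2)] subring_sum subring_mult subring_power assms)
qed

text \<open>
  A nonzero algebraic element divides a nonzero element of the base: cancel powers of \<open>g\<close> from
  its relation until the constant term survives.
\<close>

lemma multiple_in_base_mod:
  assumes C: "subring_set C" and P: "prime_set C P" and A: "subring_set A" "A \<subseteq> C"
    and g: "g \<in> C" "g \<notin> P" and p: "p \<in> polys A" "p \<notin> polys P" "poly p g \<in> P"
  shows "\<exists>w\<in>A - P. \<exists>h\<in>adjoin A g. w - g * h \<in> P"
  using p
proof (induction p)
  case 0
  then show ?case using ideal_zero[OF prime_ideal[OF P] C] by (auto simp: polys_def)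
next
  case (pCons a p)
  note I = prime_ideal[OF P] C
  have a: "a \<in> A" using polysD[OF pCons.prems(1), of 0] by simp
  have p: "p \<in> polys A"
    using polysD[OF pCons.prems(1), of "Suc _"] by (intro polysI) simp
  show ?case
  proof (cases "a \<in> P")
    case True
    have "p \<notin> polys P"
    proof
      assume "p \<in> polys P"
      then have "coeff (pCons a p) i \<in> P" for i
        using True by (cases i) (auto simp: polysD)
      then show False using pCons.prems(2) by (auto simp: polys_def)
    qed
    moreover have "g * poly p g \<in> P" using ideal_diff[OF I pCons.prems(3) True] by simp
    then have "poly p g \<in> P"
      using prime_mult[OF P g(1)] g(2) adjoinI[OF p, of g] adjoin_subset[OF C A(2) g(1)] by blast
    ultimately show ?thesis using pCons.IH p by blast
  next
    case False
    have "a - g * (- poly p g) \<in> P" using pCons.prems(3) by simp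
    moreover have "- poly p g \<in> adjoin A g"
      by (intro subring_uminus subring_adjoin A adjoinI p)
    ultimately show ?thesis using a False by blast
  qed
qed

text \<open>
  Let \<open>p\<close> be a relation of \<open>y\<close> of minimal degree \<open>d\<close> with leading coefficient \<open>u\<close>. After
  multiplication by a power of \<open>u\<close> every element of \<open>A[y]\<close> is a combination of the powers
  \<open>y^k\<close> with \<open>k < d\<close>, and by minimality such combinations are unique. If \<open>a c = g^k\<close>, with
  \<open>a \<in> A\<close> but \<open>c\<close> and \<open>g\<close> in \<open>A[y]\<close>, then first \<open>g\<close> is replaced by its multiple \<open>w \<in> A\<close>,
  and then the coefficients of \<open>y^0\<close> are compared: this is a divisibility in \<open>A\<close>. Comparing
  coefficients replaces the usual argument with integral elements.
\<close>

lemma almost_field_if_almost_field_adjoin: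
  assumes C: "subring_set C" and P: "prime_set C P" and A: "subring_set A" "A \<subseteq> C" and y: "y \<in> C"
    and G: "almost_field_mod (adjoin A y) P"
  shows "almost_field_mod A P"
proof -
  note I = prime_ideal[OF P] C
  note RA = subring_polys[OF A(1)]
  define D where "D = adjoin A y"
  have D: "subring_set D" "D \<subseteq> C" "A \<subseteq> D"
    using subring_adjoin[OF A(1)] adjoin_subset[OF C A(2) y] adjoin_base[OF A(1)]
    by (auto simp: D_def)
  define R where "R p \<longleftrightarrow> p \<in> polys A \<and> p \<notin> polys P \<and> poly p y \<in> P" for p
  have "\<exists>p. R p"
    using algebraic_if_almost_field_adjoin[OF assms] by (auto simp: algebraic_mod_def R_def)
  then obtain p where p: "R p" and p_min: "\<And>q. R q \<Longrightarrow> degree p \<le> degree q"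
    using ex_has_least_nat[of R _ degree] by blast
  define d where "d = degree p"
  define u where "u = coeff p d"
  have uA: "u \<in> A" using p by (auto simp: u_def R_def polysD)
  have small: "q \<in> polys P" if "q \<in> polys A" "degree q < d" "poly q y \<in> P" for q
    using p_min[of q] that by (auto simp: R_def d_def)
  \<comment> \<open>Otherwise the leading term could be dropped, against minimality.\<close>
  have uP: "u \<notin> P"
  proof
    assume u: "u \<in> P"
    let ?q = "p - monom u d"
    have qA: "?q \<in> polys A"
      using p by (intro subring_diff[OF RA] polys_monom A uA) (auto simp: R_def)
    have "p \<in> polys P" if "?q \<in> polys P"
      using ideal_add[OF I polysD[OF that] u] polysD[OF that]
      by (intro polysI) (metis coeff_diff coeff_monom diff_zero u u_def)
    moreover have "poly ?q y \<in> P"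
      using p u unfolding poly_diff poly_monom
      by (intro ideal_diff[OF I] ideal_mult_right[OF I] subring_power C y) (auto simp: R_def)
    ultimately have R: "R ?q" using p qA by (auto simp: R_def)
    have "degree ?q < d \<or> ?q = 0"
      using p_min[OF R] eq_zero_or_degree_less[of ?q d]
      by (auto simp: d_def u_def degree_diff_le degree_monom_le)
    then show False
      using R p_min[OF R] ideal_zero[OF I] by (auto simp: R_def d_def polys_def)
  qed
  have d: "0 < d"
  proof (rule ccontr)
    assume "\<not> 0 < d"
    then have "p = [:u:]" unfolding d_def u_def using degree_0_id[of p] by simp
    then show False using p uP by (auto simp: R_def)
  qed
  \<comment> \<open>Pseudo-division by \<open>p\<close>.\<close>
  have reduce: "\<exists>K r. r \<in> polys A \<and> degree r < d \<and> u ^ K * poly f y - poly r y \<in> P"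
    if "f \<in> polys A" for f
    using that
  proof (induction "degree f" arbitrary: f rule: less_induct)
    case less
    show ?case
    proof (cases "degree f < d")
      case True
      then show ?thesis
        using less.prems ideal_zero[OF I] by (intro exI[of _ 0] exI[of _ f]) simp
    next
      case False
      define h where "h = monom (lead_coeff f) (degree f - d)"
      have hA: "h \<in> polys A"
        unfolding h_def by (intro polys_monom A polysD[OF less.prems])
      define f' where "f' = smult u f - h * p"
      have f'A: "f' \<in> polys A"
        unfolding f'_def using p
        by (intro subring_diff[OF RA] subring_mult[OF RA] polys_smult A uA less.prems hA)
          (auto simp: R_def)
      have "degree (h * p) \<le> degree f"
        using degree_mult_le[of h p] degree_monom_le[of "lead_coeff f" "degree f - d"] False
        by (simp add: h_def d_def)
      then have le: "degree f' \<le> degree f"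
        unfolding f'_def by (intro degree_diff_le degree_smult_le)
      have "coeff (h * p) (degree f) = lead_coeff f * u"
        using False by (simp add: h_def coeff_monom_mult u_def)
      then have "coeff f' (degree f) = 0" by (simp add: f'_def mult.commute)
      then have "degree f' < degree f"
        using le False d eq_zero_or_degree_less[of f' "degree f"] by auto
      from less.hyps[OF this f'A] obtain K r where
        r: "r \<in> polys A" "degree r < d" "u ^ K * poly f' y - poly r y \<in> P" by blast
      have "u ^ Suc K * poly f y - poly r y
          = (u ^ K * poly f' y - poly r y) + (u ^ K * poly h y) * poly p y"
        by (simp add: f'_def algebra_simps)
      moreover have "(u ^ K * poly h y) * poly p y \<in> P"
        using p uA A(2) hA adjoinI[OF hA, of y] D
        by (intro ideal_mult_left[OF I] subring_mult subring_power C) (auto simp: R_def D_def)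
      ultimately show ?thesis using ideal_add[OF I r(3)] r by metis
    qed
  qed
  obtain g where g: "g \<in> D" "g \<notin> P" and inv: "\<And>a. a \<in> D \<Longrightarrow> a \<notin> P \<Longrightarrow> \<exists>c\<in>D. \<exists>k. a * c - g ^ k \<in> P"
    using G by (auto simp: almost_field_mod_def D_def)
  obtain G where Gp: "G \<in> polys A" "g = poly G y" using g(1) by (auto simp: D_def adjoin_def)
  have "\<forall>k. \<exists>K r. r \<in> polys A \<and> degree r < d \<and> u ^ K * g ^ k - poly r y \<in> P"
    using reduce[OF subring_power[OF RA Gp(1)]] by (simp add: Gp(2))
  then obtain K r where r: "\<And>k. r k \<in> polys A" "\<And>k. degree (r k) < d"
      "\<And>k. u ^ K k * g ^ k - poly (r k) y \<in> P"
    by metis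
  \<comment> \<open>The \<open>d + 1\<close> powers of \<open>g\<close> have only \<open>d\<close> coordinates, so \<open>g\<close> is algebraic over \<open>A\<close>.\<close>
  have "\<exists>q. (\<forall>j. q j \<in> A) \<and> (\<exists>j\<in>{..d}. q j \<notin> P) \<and> (\<forall>b\<in>{..<d}. (\<Sum>j\<in>{..d}. q j * coeff (r j) b) \<in> P)"
    by (rule linear_dependence_mod_prime[OF _ _ _ C P A]) (use r(1) polysD in auto)
  then obtain q where q: "\<And>j. q j \<in> A" "\<exists>j\<le>d. q j \<notin> P"
      "\<And>b. b < d \<Longrightarrow> (\<Sum>j\<le>d. q j * coeff (r j) b) \<in> P" by auto
  define W where "W = (\<Sum>k\<le>d. monom (q k * u ^ K k) k)"
  have coeffW: "coeff W k = (if k \<le> d then q k * u ^ K k else 0)" for k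
    by (simp add: W_def coeff_sum)
  have WA: "W \<in> polys A"
    by (intro polysI) (auto simp: coeffW intro!: subring_mult subring_power A q uA subring_zero)
  have "W \<notin> polys P"
  proof -
    obtain j where j: "j \<le> d" "q j \<notin> P" using q(2) by blast
    have "q j * u ^ K j \<notin> P"
      using prime_mult[OF P, of "q j" "u ^ K j"] prime_power[OF P C, of u "K j"] j uP q(1) uA A
        subring_power[OF A(1) uA] by blast
    then show ?thesis using j polysD[of W P j] by (auto simp: coeffW)
  qed
  moreover have "poly W g \<in> P"
  proof -
    let ?S = "\<Sum>j\<le>d. smult (q j) (r j)"
    have "coeff ?S b \<in> P" for b
    proof (cases "b < d")
      case True
      then show ?thesis using q(3) by (simp add: coeff_sum)
    next
      case False
      then have "coeff (r j) b = 0" for j using r(2)[of j] by (intro coeff_eq_0) auto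
      then show ?thesis using ideal_zero[OF I] by (simp add: coeff_sum)
    qed
    then have "poly ?S y \<in> P" by (intro poly_in_ideal[OF C I(1) _ y] polysI)
    moreover have "(\<Sum>j\<le>d. q j * (u ^ K j * g ^ j - poly (r j) y)) \<in> P"
      using q(1) A(2) r(3) by (auto intro!: ideal_sum[OF I] ideal_mult_left[OF I])
    ultimately have "poly ?S y + (\<Sum>j\<le>d. q j * (u ^ K j * g ^ j - poly (r j) y)) \<in> P"
      by (rule ideal_add[OF I])
    also have "poly ?S y + (\<Sum>j\<le>d. q j * (u ^ K j * g ^ j - poly (r j) y)) = poly W g"
      by (simp add: W_def poly_sum poly_monom sum_subtractf algebra_simps)
    finally show ?thesis .
  qed
  ultimately obtain w h where w: "w \<in> A" "w \<notin> P" "h \<in> adjoin A g" "w - g * h \<in> P"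
    using multiple_in_base_mod[OF C P A _ g(2) WA] g(1) D(2) by blast
  have h: "h \<in> D" using w(3) adjoin_subset[OF D(1,3) g(1)] by blast
  have "\<exists>c\<in>A. \<exists>k. a * c - (u * w) ^ k \<in> P" if a: "a \<in> A" "a \<notin> P" for a
  proof -
    obtain c k where c: "c \<in> D" "a * c - g ^ k \<in> P" using inv[of a] a D(3) by blast
    have "c * h ^ k \<in> D" by (intro subring_mult subring_power D c h)
    then obtain f where f: "f \<in> polys A" "c * h ^ k = poly f y"
      by (auto simp: D_def adjoin_def)
    obtain K r where r: "r \<in> polys A" "degree r < d" "u ^ K * (c * h ^ k) - poly r y \<in> P"
      using reduce[OF f(1)] f(2) by auto
    have in_C: "u \<in> C" "a \<in> C" "w \<in> C" "g \<in> C" "h \<in> C"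
      using uA a(1) w(1) A(2) g(1) h D(2) by auto
    have 1: "w ^ k - (g * h) ^ k \<in> P"
      by (intro ideal_power_diff[OF I] w subring_mult C in_C)
    have "u ^ K * w ^ k - a * poly r y =
        u ^ K * (w ^ k - (g * h) ^ k) - (u ^ K * h ^ k) * (a * c - g ^ k)
        + a * (u ^ K * (c * h ^ k) - poly r y)"
      by (simp add: algebra_simps power_mult_distrib)
    also have "\<dots> \<in> P"
      by (intro ideal_add[OF I] ideal_diff[OF I] ideal_mult_left[OF I] 1 c r subring_mult
          subring_power C in_C)
    finally have 2: "u ^ K * w ^ k - a * poly r y \<in> P" .
    \<comment> \<open>Uniqueness of the coordinates with respect to the powers of \<open>y\<close> below \<open>d\<close>.\<close>
    have "[:u ^ K * w ^ k:] - smult a r \<in> polys P"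
    proof (rule small)
      show "[:u ^ K * w ^ k:] - smult a r \<in> polys A"
        by (intro subring_diff[OF RA] polys_const polys_smult A a r subring_mult
            subring_power uA w)
      show "degree ([:u ^ K * w ^ k:] - smult a r) < d"
        using d r(2) degree_smult_le[of a r] by (intro degree_diff_less) auto
    qed (use 2 in simp)
    then have "u ^ K * w ^ k - a * coeff r 0 \<in> P"
      using polysD[of _ P 0] by fastforce
    then have "- ((u ^ k * w ^ K) * (u ^ K * w ^ k - a * coeff r 0)) \<in> P"
      by (intro ideal_uminus[OF I] ideal_mult_left[OF I] subring_mult subring_power C in_C)
    also have "- ((u ^ k * w ^ K) * (u ^ K * w ^ k - a * coeff r 0))
        = a * (coeff r 0 * u ^ k * w ^ K) - (u * w) ^ (K + k)"
      by (simp add: algebra_simps power_mult_distrib power_add)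
    finally show ?thesis
      using r(1) by (intro bexI[of _ "coeff r 0 * u ^ k * w ^ K"])
        (auto intro!: subring_mult subring_power A uA w polysD)
  qed
  moreover have "u * w \<in> A - P"
    using uA uP w A prime_mult[OF P, of u w] subring_mult[OF A(1), of u w] by blast
  ultimately show ?thesis unfolding almost_field_mod_def by blast
qed

text \<open>
  The head of the list is adjoined last, so that an induction on the list removes generators while
  the last element of the list stays next to the base ring.
\<close>

primrec adjoin_list :: "'r::comm_ring_1 set \<Rightarrow> 'r list \<Rightarrow> 'r set" where
  "adjoin_list A [] = A"
| "adjoin_list A (y # ys) = adjoin (adjoin_list A ys) y"

lemma subring_adjoin_list: "subring_set A \<Longrightarrow> subring_set (adjoin_list A ys)"
  by (induction ys) (auto intro: subring_adjoin)

lemma adjoin_list_base: "subring_set A \<Longrightarrow> A \<subseteq> adjoin_list A ys"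
proof (induction ys)
  case (Cons y ys)
  then show ?case using adjoin_base[OF subring_adjoin_list, of A ys y] by auto
qed simp

lemma adjoin_list_generators: "subring_set A \<Longrightarrow> set ys \<subseteq> adjoin_list A ys"
proof (induction ys)
  case (Cons y ys)
  then show ?case
    using adjoin_base[OF subring_adjoin_list, of A ys y]
      adjoin_generator[OF subring_adjoin_list, of A y ys] by auto
qed simp

lemma adjoin_list_subset:
  "subring_set C \<Longrightarrow> A \<subseteq> C \<Longrightarrow> set ys \<subseteq> C \<Longrightarrow> adjoin_list A ys \<subseteq> C"
  by (induction ys) (auto dest: adjoin_subset)

lemma adjoin_list_append: "adjoin_list A (xs @ ys) = adjoin_list (adjoin_list A ys) xs"
  by (induction xs) auto

lemma almost_field_if_almost_field_adjoin_list:
  assumes C: "subring_set C" and P: "prime_set C P" and A: "subring_set A" "A \<subseteq> C"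
    and ys: "set ys \<subseteq> C" and G: "almost_field_mod (adjoin_list A ys) P"
  shows "almost_field_mod A P"
  using ys G
proof (induction ys)
  case (Cons y ys)
  then have "adjoin_list A ys \<subseteq> C" by (intro adjoin_list_subset C A) auto
  from almost_field_if_almost_field_adjoin[OF C P subring_adjoin_list[OF A(1)] this, of y]
  show ?case using Cons by simp
qed simp

section \<open>Finitely generated algebras of dimension zero\<close>

lemma ideal_adjoin_element:
  assumes C: "subring_set C" and P: "ideal_set C P" and a: "a \<in> C"
  defines "X \<equiv> {p + c * a | p c. p \<in> P \<and> c \<in> C}"
  shows "ideal_set C X" "P \<subseteq> X" "a \<in> X"
proof -
  note I = P C
  have mem: "p + c * a \<in> X" if "p \<in> P" "c \<in> C" for p c using that by (auto simp: X_def)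
  show PX: "P \<subseteq> X" using mem[OF _ subring_zero[OF C]] by auto
  show "a \<in> X" using mem[OF ideal_zero[OF I] subring_one[OF C]] by simp
  show "ideal_set C X"
    unfolding ideal_set_def
  proof (intro conjI ballI)
    show "X \<subseteq> C" unfolding X_def
      using a C ideal_carrier[OF I] by (auto intro!: subring_add subring_mult)
    show "0 \<in> X" using PX ideal_zero[OF I] by blast
    fix x y assume "x \<in> X" "y \<in> X"
    then obtain p c q d where "x = p + c * a" "y = q + d * a" "p \<in> P" "q \<in> P" "c \<in> C" "d \<in> C"
      by (auto simp: X_def)
    then show "x + y \<in> X"
      using mem[OF ideal_add[OF I, of p q] subring_add[OF C, of c d]] by (simp add: algebra_simps)
  next
    fix e x assume "e \<in> C" "x \<in> X"
    then obtain p c where "x = p + c * a" "p \<in> P" "c \<in> C" by (auto simp: X_def)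
    then show "e * x \<in> X"
      using mem[OF ideal_mult_left[OF I, of e p] subring_mult[OF C, of e c]] \<open>e \<in> C\<close>
      by (simp add: algebra_simps)
  qed
qed

text \<open>
  Krull's theorem: an ideal that is maximal among those avoiding a multiplicative set is prime.
\<close>

lemma prime_avoiding_exists:
  assumes C: "subring_set C" and J: "ideal_set C J"
    and M: "M \<subseteq> C" "1 \<in> M" "\<And>a b. a \<in> M \<Longrightarrow> b \<in> M \<Longrightarrow> a * b \<in> M" and JM: "J \<inter> M = {}"
  shows "\<exists>P. prime_set C P \<and> J \<subseteq> P \<and> P \<inter> M = {}"
proof -
  define F where "F = {I. ideal_set C I \<and> J \<subseteq> I \<and> I \<inter> M = {}}"
  have "J \<in> F" using J JM by (simp add: F_def)
  then have "F \<noteq> {}" by blast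
  then have "\<exists>P\<in>F. \<forall>X\<in>F. P \<subseteq> X \<longrightarrow> X = P"
  proof (rule subset_Zorn_nonempty)
    fix \<C> assume ne: "\<C> \<noteq> {}" and ch: "subset.chain F \<C>"
    then have sub: "\<C> \<subseteq> F" by (simp add: subset.chain_def)
    have "ideal_set C (\<Union>\<C>)"
      unfolding ideal_set_def
    proof (intro conjI ballI)
      show "\<Union>\<C> \<subseteq> C" "0 \<in> \<Union>\<C>" using sub ne by (auto simp: F_def ideal_set_def)
      fix c a assume "c \<in> C" "a \<in> \<Union>\<C>"
      then obtain A where A: "A \<in> \<C>" "a \<in> A" by blast
      then have "c * a \<in> A" using sub \<open>c \<in> C\<close> by (auto simp: F_def ideal_set_def)
      then show "c * a \<in> \<Union>\<C>" using A by blast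
    next
      fix a b assume "a \<in> \<Union>\<C>" "b \<in> \<Union>\<C>"
      then obtain A B where AB: "A \<in> \<C>" "B \<in> \<C>" "a \<in> A" "b \<in> B" by blast
      then have "A \<subseteq> B \<or> B \<subseteq> A" using ch by (auto simp: subset.chain_def)
      then obtain D where D: "D \<in> \<C>" "a \<in> D" "b \<in> D" using AB by blast
      then have "a + b \<in> D" using sub by (auto simp: F_def ideal_set_def)
      then show "a + b \<in> \<Union>\<C>" using D by blast
    qed
    then show "\<Union>\<C> \<in> F" using sub ne by (auto simp: F_def)
  qed
  then obtain P where P: "P \<in> F" and max: "\<And>X. X \<in> F \<Longrightarrow> P \<subseteq> X \<Longrightarrow> X = P" by blast
  have I: "ideal_set C P" "J \<subseteq> P" "P \<inter> M = {}" using P by (auto simp: F_def)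
  note I' = I(1) C
  have meets: "\<exists>p\<in>P. \<exists>c\<in>C. p + c * a \<in> M" if a: "a \<in> C" "a \<notin> P" for a
  proof (rule ccontr)
    assume no: "\<not> ?thesis"
    define X where "X = {p + c * a | p c. p \<in> P \<and> c \<in> C}"
    note X = ideal_adjoin_element[OF C I(1) a(1), folded X_def]
    have "X \<inter> M = {}" using no by (auto simp: X_def)
    then have "X \<in> F" using X I by (auto simp: F_def)
    then show False using max X a by blast
  qed
  have "prime_set C P"
    unfolding prime_set_def
  proof (intro conjI ballI impI)
    show "ideal_set C P" by fact
    show "1 \<notin> P" using I(3) M(2) by blast
    fix a b assume ab: "a \<in> C" "b \<in> C" "a * b \<in> P"
    show "a \<in> P \<or> b \<in> P"
    proof (rule ccontr)
      assume "\<not> (a \<in> P \<or> b \<in> P)"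
      then obtain p c q d where m: "p \<in> P" "c \<in> C" "p + c * a \<in> M" "q \<in> P" "d \<in> C" "q + d * b \<in> M"
        using meets ab by meson
      \<comment> \<open>The product lies in the multiplicative set and in the ideal.\<close>
      have "(p + c * a) * (q + d * b) = p * (q + d * b) + (c * a) * q + (c * d) * (a * b)"
        by (simp add: algebra_simps)
      also have "\<dots> \<in> P"
      proof (intro ideal_add[OF I'])
        show "p * (q + d * b) \<in> P" using m M(1) by (intro ideal_mult_right[OF I']) auto
        show "c * a * q \<in> P" using m ab by (intro ideal_mult_left[OF I'] subring_mult C) auto
        show "c * d * (a * b) \<in> P" using m ab ideal_mult_left[OF I' subring_mult[OF C]] by blast
      qed
      finally show False using M(3)[OF m(3,6)] I(3) by blast
    qed
  qed
  with I show ?thesis by blast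
qed

text \<open>
  The part of Noether normalization that is needed: a finitely generated algebra of Krull
  dimension zero over a field \<open>K\<close> is algebraic over \<open>K\<close>. If \<open>y\<close> were transcendental modulo
  \<open>J\<close>, some prime \<open>P\<close> above \<open>J\<close> would avoid all nonzero polynomials in \<open>y\<close>. No prime lies
  strictly above \<open>P\<close>, so \<open>C / P\<close> is a field, generated by finitely many elements with \<open>y\<close> as
  the first one adjoined. Removing the other generators shows that \<open>K[y] / P\<close> is almost a field,
  hence that \<open>y\<close> is algebraic modulo \<open>P\<close> (Zariski's lemma).
\<close>

lemma algebraic_if_no_prime_chain:
  fixes K :: "'r::comm_ring_1 set"
  assumes C: "subring_set C" and K: "subring_set K" "K \<subseteq> C" "\<And>a. a \<in> K \<Longrightarrow> a \<noteq> 0 \<Longrightarrow> \<exists>b\<in>K. a * b = 1"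
    and gens: "set ys \<subseteq> C" "C \<subseteq> adjoin_list K ys" and J: "ideal_set C J"
    and no_chain: "\<And>P P'. prime_set C P \<Longrightarrow> prime_set C P' \<Longrightarrow> J \<subseteq> P \<Longrightarrow> \<not> P \<subset> P'"
    and y: "y \<in> C"
  shows "\<exists>p\<in>polys K. p \<noteq> 0 \<and> poly p y \<in> J"
proof (rule ccontr)
  assume not_alg: "\<not> ?thesis"
  have RK: "subring_set (polys K)" by (intro subring_polys K)
  \<comment> \<open>The nonzero polynomials in \<open>y\<close>, which \<open>J\<close> avoids if \<open>y\<close> is not algebraic.\<close>
  define M where "M = {poly p y | p. p \<in> polys K \<and> p \<noteq> 0}"
  have K_nz: "a * b \<noteq> 0" if nz: "a \<in> K" "a \<noteq> 0" "b \<noteq> 0" for a b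
  proof
    assume 0: "a * b = 0"
    obtain c where "a * c = 1" using K(3)[OF nz(1,2)] by blast
    then have "b = c * (a * b)" by (simp add: mult.assoc[symmetric] mult.commute)
    then show False using 0 nz by simp
  qed
  have "\<exists>P. prime_set C P \<and> J \<subseteq> P \<and> P \<inter> M = {}"
  proof (rule prime_avoiding_exists[OF C J])
    show "M \<subseteq> C" using adjoin_subset[OF C K(2) y] adjoinI[of _ K y] by (auto simp: M_def)
    show "J \<inter> M = {}" using not_alg by (auto simp: M_def)
    show "1 \<in> M"
      using subring_one[OF RK] unfolding M_def by (intro CollectI exI[of _ 1]) simp
    fix a b assume "a \<in> M" "b \<in> M"
    then obtain p q where pq: "p \<in> polys K" "p \<noteq> 0" "a = poly p y"
        "q \<in> polys K" "q \<noteq> 0" "b = poly q y"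
      by (auto simp: M_def)
    have "coeff (p * q) (degree p + degree q) \<noteq> 0"
      unfolding coeff_mult_degree_sum using pq by (intro K_nz) (auto simp: polysD)
    then have "p * q \<noteq> 0" by auto
    then show "a * b \<in> M"
      using pq subring_mult[OF RK, of p q] unfolding M_def by (intro CollectI exI[of _ "p * q"]) simp
  qed
  then obtain P where P: "prime_set C P" "J \<subseteq> P" "P \<inter> M = {}" by blast
  note I = prime_ideal[OF P(1)] C
  have field: "\<exists>b\<in>C. a * b - 1 \<in> P" if a: "a \<in> C" "a \<notin> P" for a
  proof (rule ccontr)
    assume no: "\<not> ?thesis"
    define X where "X = {p + c * a | p c. p \<in> P \<and> c \<in> C}"
    note X = ideal_adjoin_element[OF C I(1) a(1), folded X_def]
    have "X \<inter> {1} = {}"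
    proof -
      have "p + c * a \<noteq> 1" if "p \<in> P" "c \<in> C" for p c
      proof
        assume "p + c * a = 1"
        then have "a * c - 1 = - p" by (simp add: algebra_simps)
        then show False using no that ideal_uminus[OF I, of p] by metis
      qed
      then show ?thesis by (auto simp: X_def)
    qed
    then obtain P' where "prime_set C P'" "X \<subseteq> P'"
      using prime_avoiding_exists[OF C X(1), of "{1}"] subring_one[OF C] by auto
    then show False using no_chain[OF P(1), of P'] P(2) X a by blast
  qed
  have eq: "adjoin_list K (ys @ [y]) = C"
  proof
    show "adjoin_list K (ys @ [y]) \<subseteq> C" using gens y by (intro adjoin_list_subset C K) auto
    have "adjoin_list K ys \<subseteq> adjoin_list K (ys @ [y])"
      using subring_adjoin_list[OF K(1), of "ys @ [y]"] adjoin_list_base[OF K(1), of "ys @ [y]"]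
        adjoin_list_generators[OF K(1), of "ys @ [y]"]
      by (intro adjoin_list_subset) auto
    then show "C \<subseteq> adjoin_list K (ys @ [y])" using gens by blast
  qed
  have "almost_field_mod C P"
    unfolding almost_field_mod_def
    using field subring_one[OF C] prime_one[OF P(1)]
    by (intro bexI[of _ 1]) (auto intro: exI[of _ 0])
  then have "almost_field_mod (adjoin_list (adjoin K y) ys) P"
    by (simp flip: eq add: adjoin_list_append)
  then have "almost_field_mod (adjoin K y) P"
    by (rule almost_field_if_almost_field_adjoin_list[OF C P(1) subring_adjoin[OF K(1)]
          adjoin_subset[OF C K(2) y] gens(1)])
  then have "algebraic_mod K P y" by (intro algebraic_if_almost_field_adjoin[OF C P(1)] K y)
  then obtain p where "p \<in> polys K" "p \<notin> polys P" "poly p y \<in> P"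
    by (auto simp: algebraic_mod_def)
  moreover from this have "p \<noteq> 0" using ideal_zero[OF I] by (auto simp: polys_def)
  ultimately show False using P(3) by (auto simp: M_def)
qed

section \<open>Linear algebra over the polynomials in one variable\<close>

text \<open>
  An algebra over a field, given by its structure map. It will be used for the Laurent polynomials
  and for families of Laurent polynomials indexed by charts.
\<close>

locale field_algebra =
  fixes \<iota> :: "'k::field \<Rightarrow> 'v::comm_ring_1"
  assumes hom_add: "\<iota> (a + b) = \<iota> a + \<iota> b"
    and hom_mult: "\<iota> (a * b) = \<iota> a * \<iota> b"
    and hom_one: "\<iota> 1 = 1"
begin

lemma hom_zero [simp]: "\<iota> 0 = 0"
  using hom_add[of 0 0] by simp

lemma hom_uminus: "\<iota> (- a) = - \<iota> a"
  using hom_add[of a "- a"] by (simp add: eq_neg_iff_add_eq_0 add.commute)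

lemma hom_sum: "\<iota> (sum f I) = (\<Sum>i\<in>I. \<iota> (f i))"
  by (induction I rule: infinite_finite_induct) (auto simp: hom_add)

abbreviation lift :: "'k poly \<Rightarrow> 'v poly" where "lift \<equiv> map_poly \<iota>"

lemma coeff_lift [simp]: "coeff (lift p) k = \<iota> (coeff p k)"
  by (simp add: coeff_map_poly)

lemma lift_add: "lift (p + q) = lift p + lift q"
  by (intro poly_eqI) (simp add: hom_add)

lemma lift_mult: "lift (p * q) = lift p * lift q"
  by (intro poly_eqI) (simp add: coeff_mult hom_sum hom_mult)

lemma lift_one: "lift 1 = 1"
  by (simp add: hom_one)

lemma lift_sum: "lift (sum f I) = (\<Sum>i\<in>I. lift (f i))"
  by (induction I rule: infinite_finite_induct) (auto simp: lift_add)

lemma lift_power: "lift (p ^ k) = lift p ^ k"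
  by (induction k) (auto simp: lift_mult lift_one)

lemma coeff_lift_mult_const [simp]: "coeff (lift p * [:g:]) k = \<iota> (coeff p k) * g"
  by (simp add: mult.commute)

definition subspace :: "'v set \<Rightarrow> bool" where
  "subspace W \<longleftrightarrow> 0 \<in> W \<and> (\<forall>v\<in>W. \<forall>w\<in>W. v + w \<in> W) \<and> (\<forall>k. \<forall>w\<in>W. \<iota> k * w \<in> W)"

lemma subspaceD:
  assumes "subspace W"
  shows subspace_zero: "0 \<in> W"
    and subspace_add: "v \<in> W \<Longrightarrow> w \<in> W \<Longrightarrow> v + w \<in> W"
    and subspace_scale: "w \<in> W \<Longrightarrow> \<iota> k * w \<in> W"
    and subspace_uminus: "w \<in> W \<Longrightarrow> - w \<in> W"
    and subspace_diff: "v \<in> W \<Longrightarrow> w \<in> W \<Longrightarrow> v - w \<in> W"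
proof -
  show "0 \<in> W" using assms by (auto simp: subspace_def)
  show a: "v \<in> W \<Longrightarrow> w \<in> W \<Longrightarrow> v + w \<in> W" for v w using assms by (auto simp: subspace_def)
  show s: "w \<in> W \<Longrightarrow> \<iota> k * w \<in> W" for k w using assms by (auto simp: subspace_def)
  show m: "w \<in> W \<Longrightarrow> - w \<in> W" for w using s[of w "- 1"] by (simp add: hom_uminus hom_one)
  show "v \<in> W \<Longrightarrow> w \<in> W \<Longrightarrow> v - w \<in> W" using a[of v "- w"] m by simp
qed

lemma subspace_sum: "subspace W \<Longrightarrow> (\<And>i. i \<in> I \<Longrightarrow> f i \<in> W) \<Longrightarrow> sum f I \<in> W"
  by (induction I rule: infinite_finite_induct) (auto intro: subspace_zero subspace_add)

lemma polys_add:
  "subspace W \<Longrightarrow> f \<in> polys W \<Longrightarrow> g \<in> polys W \<Longrightarrow> f + g \<in> polys W"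
  by (auto simp: polys_def subspace_add)

lemma polys_uminus: "subspace W \<Longrightarrow> f \<in> polys W \<Longrightarrow> - f \<in> polys W"
  by (auto simp: polys_def subspace_uminus)

lemma polys_sum:
  "subspace W \<Longrightarrow> (\<And>i. i \<in> I \<Longrightarrow> f i \<in> polys W) \<Longrightarrow> sum f I \<in> polys W"
  by (intro polysI) (auto simp: coeff_sum polysD intro!: subspace_sum)

lemma polys_lift_mult:
  assumes "subspace W" "f \<in> polys W"
  shows "lift p * f \<in> polys W"
  by (intro polysI) (auto simp: coeff_mult intro!: subspace_sum subspace_scale assms polysD)

lemma polys_const_subspace: "subspace W \<Longrightarrow> v \<in> W \<Longrightarrow> [:v:] \<in> polys W"
  by (intro polysI) (auto simp: coeff_pCons subspace_zero split: nat.splits)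

text \<open>
  The module of polynomials over a vector space (here a quotient by \<open>W\<close>) is torsion-free over
  the polynomials with coefficients in the field: look at the top coefficient outside \<open>W\<close>.
\<close>

lemma polys_torsion_free:
  assumes W: "subspace W" and p: "p \<noteq> 0" and f: "lift p * f \<in> polys W"
  shows "f \<in> polys W"
proof (rule ccontr)
  assume "f \<notin> polys W"
  then obtain m where m: "coeff f m \<notin> W" "\<And>i. m < i \<Longrightarrow> coeff f i \<in> W"
    using top_coeff_mod subspace_zero[OF W] by blast
  define c where "c = lead_coeff p"
  define d where "d = degree p"
  let ?r = "\<Sum>i\<in>{..d + m} - {d}. \<iota> (coeff p i) * coeff f (d + m - i)"
  have "?r \<in> W"
  proof (intro subspace_sum[OF W])
    fix i assume "i \<in> {..d + m} - {d}"
    then consider "d < i" | "m < d + m - i" by fastforce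
    then show "\<iota> (coeff p i) * coeff f (d + m - i) \<in> W"
    proof cases
      case 1
      then have "coeff p i = 0" by (simp add: d_def coeff_eq_0)
      then show ?thesis by (simp add: subspace_zero[OF W])
    qed (intro subspace_scale W m)
  qed
  moreover have "coeff (lift p * f) (d + m) = \<iota> c * coeff f m + ?r"
    unfolding coeff_mult coeff_lift by (subst sum.remove[of _ d]) (auto simp: c_def d_def)
  ultimately have "\<iota> c * coeff f m \<in> W"
    using subspace_diff[OF W polysD[OF f, of "d + m"], of ?r] by simp
  then have "\<iota> (inverse c) * (\<iota> c * coeff f m) \<in> W" by (rule subspace_scale[OF W])
  then show False
    using m(1) p by (simp add: mult.assoc[symmetric] c_def hom_one flip: hom_mult)
qed

abbreviation scale :: "'k \<Rightarrow> 'v \<Rightarrow> 'v" where "scale \<equiv> (\<lambda>k v. \<iota> k * v)"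

definition span_mod :: "'v set \<Rightarrow> 'v set \<Rightarrow> 'v set" where
  "span_mod G W = {v. \<exists>u. v - (\<Sum>g\<in>G. \<iota> (u g) * g) \<in> W}"

text \<open>
  The spanning set need not lie in the space that it spans. This makes finite dimension easy to
  establish by closure properties of spans, and subspaces inherit it.
\<close>

definition spans_mod :: "'v set \<Rightarrow> 'v set \<Rightarrow> 'v set \<Rightarrow> bool" where
  "spans_mod G W V \<longleftrightarrow> finite G \<and> V \<subseteq> span_mod G W"

lemma span_modI: "v - (\<Sum>g\<in>G. \<iota> (u g) * g) \<in> W \<Longrightarrow> v \<in> span_mod G W"
  by (auto simp: span_mod_def)

lemma span_mod_base: "W \<subseteq> span_mod G W"
  using span_modI[where G = G and u = "\<lambda>_. 0"] by auto

lemma subspace_span_mod: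
  assumes W: "subspace W"
  shows "subspace (span_mod G W)"
  unfolding subspace_def
proof (intro conjI ballI allI)
  show "0 \<in> span_mod G W" using span_mod_base subspace_zero[OF W] by blast
  fix v w k assume "v \<in> span_mod G W" "w \<in> span_mod G W"
  then obtain a b where ab: "v - (\<Sum>g\<in>G. \<iota> (a g) * g) \<in> W" "w - (\<Sum>g\<in>G. \<iota> (b g) * g) \<in> W"
    by (auto simp: span_mod_def)
  show "v + w \<in> span_mod G W"
    using subspace_add[OF W ab]
    by (intro span_modI[where G = G and u = "\<lambda>g. a g + b g"]) (simp add: hom_add algebra_simps sum.distrib)
next
  fix k w assume "w \<in> span_mod G W"
  then obtain b where b: "w - (\<Sum>g\<in>G. \<iota> (b g) * g) \<in> W"
    by (auto simp: span_mod_def)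
  show "\<iota> k * w \<in> span_mod G W"
    using subspace_scale[OF W b, of k]
    by (intro span_modI[where G = G and u = "\<lambda>g. k * b g"])
      (simp add: hom_mult right_diff_distrib sum_distrib_left mult.assoc)
qed

lemma span_mod_generators:
  assumes W: "subspace W" and G: "finite G"
  shows "G \<subseteq> span_mod G W"
proof
  fix h assume h: "h \<in> G"
  have "(\<Sum>g\<in>G. \<iota> (if g = h then 1 else 0) * g) = (\<Sum>g\<in>G. if g = h then g else 0)"
    by (intro sum.cong) (auto simp: hom_one)
  also have "\<dots> = h" using h G by simp
  finally show "h \<in> span_mod G W"
    using subspace_zero[OF W] by (intro span_modI[where G = G and u = "\<lambda>g. if g = h then 1 else 0"]) simp
qed

lemma span_mod_minimal:
  assumes U: "subspace U" and "W \<subseteq> U" "G \<subseteq> U"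
  shows "span_mod G W \<subseteq> U"
proof
  fix v assume "v \<in> span_mod G W"
  then obtain u where "v - (\<Sum>g\<in>G. \<iota> (u g) * g) \<in> U" using assms(2) by (auto simp: span_mod_def)
  moreover have "(\<Sum>g\<in>G. \<iota> (u g) * g) \<in> U"
    using assms(3) by (auto intro!: subspace_sum[OF U] subspace_scale[OF U])
  ultimately show "v \<in> U" using subspace_add[OF U] by fastforce
qed

lemma quotient_basis_spans: "quotient_basis scale V W B \<Longrightarrow> spans_mod B W V"
  by (auto simp: quotient_basis_def spans_mod_def span_mod_def)

lemma poly_coordinates:
  assumes W: "subspace W" and G: "spans_mod G W V" and f: "f \<in> polys V"
  shows "\<exists>P. f - (\<Sum>g\<in>G. lift (P g) * [:g:]) \<in> polys W"
proof -
  have "\<forall>k. \<exists>u. coeff f k - (\<Sum>g\<in>G. \<iota> (u g) * g) \<in> W"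
    using G polysD[OF f] by (auto simp: spans_mod_def span_mod_def)
  then obtain u where u: "\<And>k. coeff f k - (\<Sum>g\<in>G. \<iota> (u k g) * g) \<in> W" by metis
  define P where "P g = (\<Sum>k\<le>degree f. monom (u k g) k)" for g
  have coeffP: "coeff (P g) k = (if k \<le> degree f then u k g else 0)" for g k
    by (simp add: P_def coeff_sum)
  have "f - (\<Sum>g\<in>G. lift (P g) * [:g:]) \<in> polys W"
  proof (rule polysI)
    fix k
    show "coeff (f - (\<Sum>g\<in>G. lift (P g) * [:g:])) k \<in> W"
      using u[of k] subspace_zero[OF W]
      by (cases "k \<le> degree f") (simp_all add: coeff_sum coeffP coeff_eq_0 del: mult_pCons_right)
  qed
  then show ?thesis by blast
qed

text \<open>
  If \<open>V / W\<close> has dimension at most \<open>h\<close>, then any \<open>h + 1\<close> elements of \<open>(V / W)[t]\<close> are linearly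
  dependent over \<open>K[t]\<close>. All comparisons of dimensions below are instances of this lemma.
\<close>

lemma poly_linear_dependence:
  assumes W: "subspace W" and G: "spans_mod G W V"
    and J: "finite J" "card G < card J" and f: "\<And>j. j \<in> J \<Longrightarrow> f j \<in> polys V"
  shows "\<exists>p. (\<exists>j\<in>J. p j \<noteq> 0) \<and> (\<Sum>j\<in>J. lift (p j) * f j) \<in> polys W"
proof -
  have "\<forall>j\<in>J. \<exists>P. f j - (\<Sum>g\<in>G. lift (P g) * [:g:]) \<in> polys W"
    using poly_coordinates[OF W G f] by blast
  then obtain P where P: "\<And>j. j \<in> J \<Longrightarrow> f j - (\<Sum>g\<in>G. lift (P j g) * [:g:]) \<in> polys W"
    by metis
  have "\<exists>p. (\<forall>j. p j \<in> UNIV) \<and> (\<exists>j\<in>J. p j \<notin> {0}) \<and> (\<forall>g\<in>G. (\<Sum>j\<in>J. p j * P j g) \<in> {0 :: 'k poly})"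
    by (rule linear_dependence_mod_prime[where C = UNIV])
      (use G J in \<open>auto simp: spans_mod_def subring_set_def prime_set_def ideal_set_def\<close>)
  then obtain p where p: "\<exists>j\<in>J. p j \<noteq> 0" "\<And>g. g \<in> G \<Longrightarrow> (\<Sum>j\<in>J. p j * P j g) = 0" by auto
  have "(\<Sum>j\<in>J. lift (p j) * (\<Sum>g\<in>G. lift (P j g) * [:g:])) =
      (\<Sum>g\<in>G. lift (\<Sum>j\<in>J. p j * P j g) * [:g:])"
    unfolding sum_distrib_left lift_sum lift_mult sum_distrib_right
    by (subst sum.swap) (simp only: mult.assoc)
  also have "\<dots> = 0" by (simp add: p(2))
  finally have "(\<Sum>j\<in>J. lift (p j) * f j) =
      (\<Sum>j\<in>J. lift (p j) * (f j - (\<Sum>g\<in>G. lift (P j g) * [:g:])))"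
    by (simp add: right_diff_distrib sum_subtractf del: mult_pCons_right)
  also have "\<dots> \<in> polys W"
    by (intro polys_sum[OF W] polys_lift_mult[OF W] P)
  finally show ?thesis using p(1) by blast
qed

lemma card_le_if_independent:
  assumes W: "subspace W" and B: "quotient_basis scale V W B"
    and J: "finite J" and f: "\<And>j. j \<in> J \<Longrightarrow> f j \<in> polys V"
    and indep: "\<And>p. (\<Sum>j\<in>J. lift (p j) * f j) \<in> polys W \<Longrightarrow> \<forall>j\<in>J. p j = 0"
  shows "card J \<le> card B"
proof (rule ccontr)
  assume "\<not> card J \<le> card B"
  then have "card B < card J" by simp
  from poly_linear_dependence[where f = f, OF W quotient_basis_spans[OF B] J this f]
  show False using indep by blast
qed

lemma poly_independent_if_independent:
  assumes indep: "\<And>u. (\<Sum>b\<in>B. \<iota> (u b) * b) \<in> W \<Longrightarrow> \<forall>b\<in>B. u b = 0"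
    and sum: "(\<Sum>b\<in>B. lift (p b) * [:b:]) \<in> polys W"
  shows "\<forall>b\<in>B. p b = 0"
proof -
  have "(\<Sum>b\<in>B. \<iota> (coeff (p b) k) * b) \<in> W" for k
    using polysD[OF sum, of k] by (simp add: coeff_sum del: mult_pCons_right)
  then have "\<forall>b\<in>B. coeff (p b) k = 0" for k using indep[of "\<lambda>b. coeff (p b) k"] by simp
  then show ?thesis by (auto intro: poly_eqI)
qed

lemma quotient_basis_independent:
  "quotient_basis scale V W B \<Longrightarrow> (\<Sum>b\<in>B. \<iota> (u b) * b) \<in> W \<Longrightarrow> \<forall>b\<in>B. u b = 0"
  unfolding quotient_basis_def by blast

lemma quotient_basis_poly_independent:
  "quotient_basis scale V W B \<Longrightarrow> (\<Sum>b\<in>B. lift (p b) * [:b:]) \<in> polys W \<Longrightarrow> \<forall>b\<in>B. p b = 0"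
  by (rule poly_independent_if_independent[OF quotient_basis_independent])

text \<open>
  A maximal independent family is a basis; families are bounded in size by linear dependence.
\<close>

lemma quotient_basis_exists:
  assumes W: "subspace W" and G: "spans_mod G W V" and V: "subspace V"
  shows "\<exists>B. quotient_basis scale V W B"
proof -
  define indep where "indep B \<longleftrightarrow> finite B \<and> B \<subseteq> V \<and>
    (\<forall>u. (\<Sum>b\<in>B. \<iota> (u b) * b) \<in> W \<longrightarrow> (\<forall>b\<in>B. u b = 0))" for B
  have bound: "card B \<le> card G" if B: "indep B" for B
  proof (rule ccontr)
    assume "\<not> card B \<le> card G"
    then have "card G < card B" by simp
    moreover have "\<And>b. b \<in> B \<Longrightarrow> [:b:] \<in> polys V"
      using B by (auto simp: indep_def intro!: polys_const_subspace V)
    ultimately obtain p where p: "\<exists>b\<in>B. p b \<noteq> 0" "(\<Sum>b\<in>B. lift (p b) * [:b:]) \<in> polys W"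
      using poly_linear_dependence[OF W G, of B "\<lambda>b. [:b:]"] B by (auto simp: indep_def)
    have "(\<Sum>b\<in>B. \<iota> (u b) * b) \<in> W \<Longrightarrow> \<forall>b\<in>B. u b = 0" for u
      using B unfolding indep_def by blast
    from poly_independent_if_independent[OF this p(2)] show False using p(1) by blast
  qed
  have "indep {}" by (simp add: indep_def)
  then have "\<exists>B. indep B \<and> (\<forall>B'. indep B' \<longrightarrow> card B' \<le> card B)"
    using bound by (intro ex_has_greatest_nat[of _ _ _ "card G + 1"]) (auto simp: le_imp_less_Suc)
  then obtain B where B: "indep B" and max: "\<And>B'. indep B' \<Longrightarrow> card B' \<le> card B" by blast
  have fin: "finite B" using B by (simp add: indep_def)
  have "\<exists>u. v - (\<Sum>b\<in>B. \<iota> (u b) * b) \<in> W" if v: "v \<in> V" for v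
  proof (cases "v \<in> B")
    case True
    then have "v \<in> span_mod B W" using span_mod_generators[OF W fin] by blast
    then show ?thesis by (auto simp: span_mod_def)
  next
    case False
    then have "\<not> indep (insert v B)" using max[of "insert v B"] fin by auto
    then obtain u where u: "(\<Sum>b\<in>insert v B. \<iota> (u b) * b) \<in> W" "\<exists>b\<in>insert v B. u b \<noteq> 0"
      using B v by (auto simp: indep_def)
    have s: "\<iota> (u v) * v + (\<Sum>b\<in>B. \<iota> (u b) * b) \<in> W" using u(1) False fin by simp
    have nz: "u v \<noteq> 0" using s u(2) B by (auto simp: indep_def)
    have "\<iota> (inverse (u v)) * (\<iota> (u v) * v + (\<Sum>b\<in>B. \<iota> (u b) * b)) \<in> W"
      by (rule subspace_scale[OF W s])
    also have "\<iota> (inverse (u v)) * (\<iota> (u v) * v + (\<Sum>b\<in>B. \<iota> (u b) * b)) =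
        v - (\<Sum>b\<in>B. \<iota> (- (inverse (u v) * u b)) * b)"
      using nz by (simp add: distrib_left sum_distrib_left mult.assoc[symmetric] hom_uminus
          hom_one sum_negf flip: hom_mult)
    finally show ?thesis by (intro exI[of _ "\<lambda>b. - (inverse (u v) * u b)"])
  qed
  then have "quotient_basis scale V W B" using B by (auto simp: quotient_basis_def indep_def)
  then show ?thesis by blast
qed

lemma quotient_dim_eq_card:
  assumes "\<exists>B. quotient_basis sc V W B"
  obtains B where "quotient_basis sc V W B" "quotient_dim sc V W = card B"
  using that[OF someI_ex[OF assms]] assms by (simp add: quotient_dim_def)

lemma lift_of_polys_range:
  assumes "q \<in> polys (range \<iota>)"
  obtains p where "q = lift p"
proof -
  have "\<forall>k. \<exists>a. coeff q k = \<iota> a" using polysD[OF assms] by blast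
  then obtain a where a: "\<And>k. coeff q k = \<iota> (a k)" by metis
  have "q = lift (\<Sum>k\<le>degree q. monom (a k) k)"
  proof (rule poly_eqI)
    fix k
    show "coeff q k = coeff (lift (\<Sum>k\<le>degree q. monom (a k) k)) k"
    proof (cases "k \<le> degree q")
      case True
      then show ?thesis using a[of k] by (simp add: coeff_sum)
    next
      case False
      then show ?thesis by (simp add: coeff_sum coeff_eq_0)
    qed
  qed
  then show ?thesis by (rule that)
qed

lemma subspace_if_ideal: "ideal_set C P \<Longrightarrow> range \<iota> \<subseteq> C \<Longrightarrow> subspace P"
  unfolding ideal_set_def subspace_def by (blast intro: rangeI)

lemma subring_range: "subring_set (range \<iota>)"
  unfolding subring_set_def
proof (intro conjI ballI)
  show "1 \<in> range \<iota>" using hom_one by (metis rangeI)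
  fix a b assume "a \<in> range \<iota>" "b \<in> range \<iota>"
  then obtain x y where xy: "a = \<iota> x" "b = \<iota> y" by blast
  show "a - b \<in> range \<iota>" unfolding xy using hom_add[of x "- y"] by (metis diff_conv_add_uminus hom_uminus rangeI)
  show "a * b \<in> range \<iota>" unfolding xy by (simp flip: hom_mult)
qed

lemma range_inverse: "a \<in> range \<iota> \<Longrightarrow> a \<noteq> 0 \<Longrightarrow> \<exists>b\<in>range \<iota>. a * b = 1"
proof -
  assume "a \<in> range \<iota>" "a \<noteq> 0"
  then obtain x where x: "a = \<iota> x" "x \<noteq> 0" using hom_zero by blast
  then have "a * \<iota> (inverse x) = 1" by (simp add: hom_one flip: hom_mult)
  then show ?thesis by blast
qed

text \<open>
  Algebraic generators give a finite-dimensional algebra: high powers of \<open>y\<close> are reduced by the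
  monic multiple of its relation.
\<close>

lemma adjoin_spanned_mod:
  assumes C: "subring_set C" and K: "range \<iota> \<subseteq> C" and Z: "ideal_set C Z"
    and A: "A \<subseteq> C" "spans_mod G Z A" and y: "y \<in> C" and p: "p \<noteq> 0" "poly (lift p) y \<in> Z"
  shows "\<exists>G'. spans_mod G' Z (adjoin A y)"
proof -
  note I = Z C
  have W: "subspace Z" by (rule subspace_if_ideal[OF Z K])
  define m where "m = degree p"
  define G' where "G' = (\<lambda>(g, k). g * y ^ k) ` (G \<times> {..<m})"
  have fin: "finite G'" using A(2) by (auto simp: G'_def spans_mod_def)
  let ?U = "span_mod G' Z"
  have U: "subspace ?U" by (rule subspace_span_mod[OF W])
  define c where "c k = coeff p k / lead_coeff p" for k
  have monic: "y ^ m + (\<Sum>k<m. \<iota> (c k) * y ^ k) \<in> Z"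
  proof -
    have "poly (lift p) y = (\<Sum>k\<le>m. \<iota> (coeff p k) * y ^ k)"
      unfolding poly_altdef m_def
      by (intro sum.mono_neutral_cong_left) (auto simp: map_poly_degree_leq intro!: le_degree)
    also have "\<dots> = (\<Sum>k<m. \<iota> (coeff p k) * y ^ k) + \<iota> (lead_coeff p) * y ^ m"
      by (simp add: lessThan_Suc_atMost[symmetric] m_def)
    finally have eq: "poly (lift p) y = \<dots>" .
    have inv: "\<iota> (inverse (lead_coeff p)) * \<iota> (lead_coeff p) = 1"
      using p(1) by (simp add: hom_one flip: hom_mult)
    have coeffs: "\<iota> (inverse (lead_coeff p)) * \<iota> (coeff p k) = \<iota> (c k)" for k
      by (simp add: c_def divide_inverse mult.commute[of "inverse _"] flip: hom_mult)
    have "\<iota> (inverse (lead_coeff p)) * poly (lift p) y = y ^ m + (\<Sum>k<m. \<iota> (c k) * y ^ k)"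
      unfolding eq distrib_left sum_distrib_left mult.assoc[symmetric] inv
      unfolding coeffs by simp
    then show ?thesis using subspace_scale[OF W p(2)] by metis
  qed
  have step: "a * y ^ i \<in> ?U" if a: "a \<in> A" for a i
  proof (induction i rule: less_induct)
    case (less i)
    show ?case
    proof (cases "i < m")
      case True
      define T where "T = {b. b * y ^ i \<in> ?U}"
      have "subspace T"
        unfolding subspace_def T_def
        using subspace_zero[OF U] subspace_add[OF U] subspace_scale[OF U]
        by (auto simp: distrib_right mult.assoc)
      moreover have "Z \<subseteq> T"
        using ideal_mult_right[OF I subring_power[OF C y]] span_mod_base[of Z G'] by (auto simp: T_def)
      moreover have "G \<subseteq> T"
        using True span_mod_generators[OF W fin] by (force simp: T_def G'_def)
      ultimately have "span_mod G Z \<subseteq> T" by (rule span_mod_minimal)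
      then show ?thesis using a A(2) by (auto simp: T_def spans_mod_def)
    next
      case False
      then obtain l where i: "i = l + m" by (metis add.commute le_add_diff_inverse not_less)
      have "a * y ^ l * (y ^ m + (\<Sum>k<m. \<iota> (c k) * y ^ k)) \<in> Z"
        using a A(1) by (intro ideal_mult_left[OF I] monic subring_mult subring_power C y) auto
      also have "a * y ^ l * (y ^ m + (\<Sum>k<m. \<iota> (c k) * y ^ k)) =
          a * y ^ i + (\<Sum>k<m. \<iota> (c k) * (a * y ^ (l + k)))"
        by (simp add: i distrib_left sum_distrib_left power_add mult_ac)
      finally have "a * y ^ i + (\<Sum>k<m. \<iota> (c k) * (a * y ^ (l + k))) \<in> ?U"
        using span_mod_base by blast
      moreover have "(\<Sum>k<m. \<iota> (c k) * (a * y ^ (l + k))) \<in> ?U"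
        by (intro subspace_sum[OF U] subspace_scale[OF U] less) (auto simp: i)
      ultimately show ?thesis using subspace_diff[OF U] by (metis add_diff_cancel_right')
    qed
  qed
  have "adjoin A y \<subseteq> ?U"
    unfolding adjoin_def poly_altdef by (auto intro!: subspace_sum[OF U] step polysD)
  then show ?thesis using fin by (auto simp: spans_mod_def)
qed

lemma adjoin_list_spanned_mod:
  assumes C: "subring_set C" and K: "range \<iota> \<subseteq> C" and Z: "ideal_set C Z"
    and ys: "\<And>y. y \<in> set ys \<Longrightarrow> y \<in> C \<and> (\<exists>p. p \<noteq> 0 \<and> poly (lift p) y \<in> Z)"
  shows "\<exists>G. spans_mod G Z (adjoin_list (range \<iota>) ys)"
  using ys
proof (induction ys)
  case Nil
  have W: "subspace Z" by (rule subspace_if_ideal[OF Z K])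
  have "\<iota> k * 1 \<in> span_mod {1} Z" for k
    using span_mod_generators[OF W, of "{1}"] by (intro subspace_scale subspace_span_mod W) auto
  then have "spans_mod {1} Z (range \<iota>)" by (auto simp: spans_mod_def)
  then show ?case by auto
next
  case (Cons y ys)
  then obtain G where "spans_mod G Z (adjoin_list (range \<iota>) ys)" by auto
  moreover obtain p where "p \<noteq> 0" "poly (lift p) y \<in> Z" using Cons.prems by auto
  moreover have "adjoin_list (range \<iota>) ys \<subseteq> C"
    using Cons.prems by (intro adjoin_list_subset C K) auto
  ultimately show ?case
    using adjoin_spanned_mod[OF C K Z, of "adjoin_list (range \<iota>) ys" G y p] Cons.prems by simp
qed

text \<open>
  An injective map between spaces of the same finite dimension over \<open>K(t)\<close> is surjective. Without
  denominators: each \<open>g\<close> has a nonzero multiple in the image, since \<open>g\<close> together with the images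
  of a basis is one element too many to be independent, and the images of the basis alone are
  independent.
\<close>

lemma torsion_cokernel_of_injective:
  assumes F: "subspace F" and F': "subspace F'" and V': "subspace V'"
    and B: "quotient_basis scale F V B" and B': "quotient_basis scale F' V' B'" and le: "card B' \<le> card B"
    and l: "\<And>f. f \<in> polys F \<Longrightarrow> l * f \<in> polys F'"
    and inj: "\<And>f. f \<in> polys F \<Longrightarrow> l * f \<in> polys V' \<Longrightarrow> f \<in> polys V"
    and g: "g \<in> F'"
  shows "\<exists>p w. p \<noteq> 0 \<and> w \<in> polys F \<and> lift p * [:g:] - l * w \<in> polys V'"
proof -
  have BF: "B \<subseteq> F" "finite B" using B by (auto simp: quotient_basis_def)
  let ?J = "insert None (Some ` B)"
  let ?f = "\<lambda>j. case j of None \<Rightarrow> [:g:] | Some b \<Rightarrow> l * [:b:]"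
  have "card B' < card ?J" using le BF(2) by (simp add: card_image)
  moreover have "?f j \<in> polys F'" if "j \<in> ?J" for j
    using that BF polys_const_subspace[OF F' g] l[OF polys_const_subspace[OF F]]
    by (auto simp del: mult_pCons_right)
  ultimately obtain p where p: "\<exists>j\<in>?J. p j \<noteq> 0" "(\<Sum>j\<in>?J. lift (p j) * ?f j) \<in> polys V'"
    using poly_linear_dependence[OF V' quotient_basis_spans[OF B'], of ?J ?f] BF(2) by blast
  let ?s = "\<Sum>b\<in>B. lift (p (Some b)) * [:b:]"
  have "(\<Sum>j\<in>?J. lift (p j) * ?f j) = lift (p None) * [:g:] + (\<Sum>j\<in>Some ` B. lift (p j) * ?f j)"
    using BF(2) by (subst sum.insert) auto
  also have "(\<Sum>j\<in>Some ` B. lift (p j) * ?f j) = l * ?s"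
    by (subst sum.reindex) (simp_all add: sum_distrib_left mult.left_commute del: mult_pCons_right)
  finally have s: "lift (p None) * [:g:] + l * ?s \<in> polys V'"
    using p(2) by simp
  have sF: "?s \<in> polys F"
    using BF by (intro polys_sum polys_lift_mult polys_const_subspace F) auto
  have "p None \<noteq> 0"
  proof
    assume 0: "p None = 0"
    have "?s \<in> polys V" by (rule inj[OF sF]) (use s 0 in simp)
    then have "\<forall>b\<in>B. p (Some b) = 0" by (rule quotient_basis_poly_independent[OF B])
    then show False using p(1) 0 by auto
  qed
  moreover have "- ?s \<in> polys F" by (rule polys_uminus[OF F sF])
  ultimately show ?thesis
    using s by (intro exI[of _ "p None"] exI[of _ "- ?s"]) simp
qed

section \<open>The generic linear form\<close>

text \<open>
  The linear form with coefficient vector \<open>(1, t, t^2, ..)\<close>. Over a finite field every linear form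
  may vanish at some point of a given finite set; this one, over \<open>K[t]\<close>, does not.
\<close>

definition generic_form :: "nat \<Rightarrow> (nat \<Rightarrow> 'v) \<Rightarrow> 'v poly" where
  "generic_form n x = (\<Sum>j\<le>n. monom (x j) j)"

lemma coeff_generic_form_mult:
  "coeff (generic_form n x * f) k = (\<Sum>j\<le>n. if k < j then 0 else x j * coeff f (k - j))"
  by (simp add: generic_form_def sum_distrib_right coeff_sum coeff_monom_mult)

text \<open>
  McCoy's argument. Here \<open>d \<mapsto> F d / V d\<close> is a graded module in which no nonzero element is killed by
  all \<open>x j\<close>. If the generic form kills \<open>f\<close>, the coefficients of the product are inspected from
  the top: \<open>x n\<close> kills the leading coefficient of \<open>f\<close>, so \<open>x n * f\<close> is again killed by the form
  but has smaller degree, hence vanishes by induction; then the same holds for \<open>x (n - 1)\<close>, and so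
  on. So every coefficient of \<open>f\<close> is killed by all \<open>x j\<close>. The degree of \<open>f\<close> is measured modulo
  \<open>V d\<close>.
\<close>

lemma generic_form_nonzerodivisor:
  assumes V: "\<And>d. subspace (V d)"
    and xF: "\<And>d j f. j \<le> n \<Longrightarrow> f \<in> F d \<Longrightarrow> x j * f \<in> F (Suc d)"
    and xV: "\<And>d j f. j \<le> n \<Longrightarrow> f \<in> V d \<Longrightarrow> x j * f \<in> V (Suc d)"
    and sat: "\<And>d f. f \<in> F d \<Longrightarrow> (\<And>j. j \<le> n \<Longrightarrow> x j * f \<in> V (Suc d)) \<Longrightarrow> f \<in> V d"
    and f: "f \<in> polys (F d)" and lf: "generic_form n x * f \<in> polys (V (Suc d))"
  shows "f \<in> polys (V d)"
proof -
  have "f \<in> polys (V d)"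
    if "f \<in> polys (F d)" "\<And>k. m \<le> k \<Longrightarrow> coeff f k \<in> V d"
      "generic_form n x * f \<in> polys (V (Suc d))" for m d f
    using that
  proof (induction m arbitrary: d f)
    case 0
    then show ?case by (intro polysI) auto
  next
    case (Suc m)
    have x: "smult (x j) f \<in> polys (V (Suc d))" if "j \<le> n" for j
      using that
    proof (induction "n - j" arbitrary: j rule: less_induct)
      case less
      have IHj: "x i * coeff f k \<in> V (Suc d)" if "j < i" "i \<le> n" for i k
        using polysD[OF less.hyps[of i], of k] that by simp
      let ?t = "\<lambda>i. if m + j < i then 0 else x i * coeff f (m + j - i)"
      have "?t i \<in> V (Suc d)" if "i \<in> {..n} - {j}" for i
      proof (cases "j < i")
        case True
        then show ?thesis using IHj[of i] that subspace_zero[OF V] by auto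
      next
        case False
        then have "i < j" using that by auto
        then show ?thesis using that Suc.prems(2)[of "m + j - i"] by (auto intro!: xV)
      qed
      then have "(\<Sum>i\<in>{..n} - {j}. ?t i) \<in> V (Suc d)" by (intro subspace_sum V)
      moreover have "coeff (generic_form n x * f) (m + j) = x j * coeff f m + (\<Sum>i\<in>{..n} - {j}. ?t i)"
        using less.prems unfolding coeff_generic_form_mult by (subst sum.remove[of _ j]) auto
      \<comment> \<open>All other contributions to the coefficient of degree \<open>m + j\<close> vanish.\<close>
      ultimately have top: "x j * coeff f m \<in> V (Suc d)"
        using subspace_diff[OF V polysD[OF Suc.prems(3), of "m + j"],
            of "\<Sum>i\<in>{..n} - {j}. ?t i"] by simp
      show ?case
      proof (rule Suc.IH)
        show "smult (x j) f \<in> polys (F (Suc d))"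
          using less.prems by (intro polysI) (auto intro!: xF polysD[OF Suc.prems(1)])
        show "coeff (smult (x j) f) k \<in> V (Suc d)" if "m \<le> k" for k
          using top less.prems Suc.prems(2)[of k] that by (cases "k = m") (auto intro!: xV)
        show "generic_form n x * smult (x j) f \<in> polys (V (Suc (Suc d)))"
          using less.prems Suc.prems(3) by (intro polysI) (auto intro!: xV polysD)
      qed
    qed
    show ?case
    proof (rule polysI, rule sat)
      show "coeff f k \<in> F d" for k using Suc.prems(1) by (rule polysD)
      show "x j * coeff f k \<in> V (Suc d)" if "j \<le> n" for k j using polysD[OF x[OF that], of k] by simp
    qed
  qed
  moreover have "coeff f k \<in> V d" if "Suc (degree f) \<le> k" for k
    using that subspace_zero[OF V] by (simp add: coeff_eq_0)
  ultimately show ?thesis using f lf by blast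
qed

end

section \<open>Subrings as structures\<close>

lemma cring_subring_of:
  assumes C: "subring_set C"
  shows "cring (subring_of C)"
proof (rule cringI)
  show "abelian_group (subring_of C)"
  proof (rule abelian_groupI)
    fix x assume "x \<in> carrier (subring_of C)"
    then show "\<exists>y\<in>carrier (subring_of C). y \<oplus>\<^bsub>subring_of C\<^esub> x = \<zero>\<^bsub>subring_of C\<^esub>"
      using subring_uminus[OF C] by (intro bexI[of _ "- x"]) (auto simp: subring_of_def)
  qed (auto simp: subring_of_def subring_add[OF C] subring_zero[OF C] add_ac)
  show "comm_monoid (subring_of C)"
    by (rule comm_monoidI) (auto simp: subring_of_def subring_mult[OF C] subring_one[OF C] mult_ac)
qed (auto simp: subring_of_def distrib_right)

lemma ideal_subring_of_iff:
  assumes C: "subring_set C"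
  shows "ideal P (subring_of C) \<longleftrightarrow> ideal_set C P"
proof
  interpret R: cring "subring_of C" by (rule cring_subring_of[OF C])
  {
    assume "ideal P (subring_of C)"
    then interpret ideal P "subring_of C" .
    show "ideal_set C P"
      using a_subset zero_closed a_closed I_l_closed by (auto simp: ideal_set_def subring_of_def)
  next
    assume P: "ideal_set C P"
    have "subgroup P (add_monoid (subring_of C))"
    proof (rule R.add.subgroupI)
      fix a assume a: "a \<in> P"
      then have "a \<in> carrier (subring_of C)"
        using ideal_carrier[OF P C] by (simp add: subring_of_def)
      then have "\<ominus>\<^bsub>subring_of C\<^esub> a = - a"
        using subring_uminus[OF C, of a] by (intro R.minus_equality) (auto simp: subring_of_def)
      then show "\<ominus>\<^bsub>subring_of C\<^esub> a \<in> P" using ideal_uminus[OF P C a] by simp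
    qed (use ideal_zero[OF P C] ideal_carrier[OF P C] ideal_add[OF P C] in \<open>auto simp: subring_of_def\<close>)
    then show "ideal P (subring_of C)"
      using ideal_mult_left[OF P C] ideal_mult_right[OF P C]
      by (intro idealI R.ring_axioms) (auto simp: subring_of_def)
  }
qed

lemma primeideal_subring_of:
  assumes C: "subring_set C" and P: "prime_set C P"
  shows "primeideal P (subring_of C)"
proof (rule primeidealI)
  show "ideal P (subring_of C)" using prime_ideal[OF P] ideal_subring_of_iff[OF C] by simp
  show "cring (subring_of C)" by (rule cring_subring_of[OF C])
  show "carrier (subring_of C) \<noteq> P"
    using prime_one[OF P] subring_one[OF C] by (auto simp: subring_of_def)
qed (use prime_mult[OF P] in \<open>auto simp: subring_of_def\<close>)

lemma genideal_subring_of: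
  assumes C: "subring_set C" and S: "S \<subseteq> C"
  shows "ideal_set C (genideal (subring_of C) S)" "S \<subseteq> genideal (subring_of C) S"
    "\<And>P. ideal_set C P \<Longrightarrow> S \<subseteq> P \<Longrightarrow> genideal (subring_of C) S \<subseteq> P"
proof -
  interpret R: cring "subring_of C" by (rule cring_subring_of[OF C])
  have S: "S \<subseteq> carrier (subring_of C)" using S by (simp add: subring_of_def)
  show "ideal_set C (genideal (subring_of C) S)"
    using R.genideal_ideal[OF S] ideal_subring_of_iff[OF C] by simp
  show "S \<subseteq> genideal (subring_of C) S" by (rule R.genideal_self[OF S])
  show "\<And>P. ideal_set C P \<Longrightarrow> S \<subseteq> P \<Longrightarrow> genideal (subring_of C) S \<subseteq> P"
    using R.genideal_minimal ideal_subring_of_iff[OF C] by blast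
qed

section \<open>Laurent monomials and graded pieces\<close>

abbreviation (input) single where "single \<equiv> Poly_Mapping.single"
abbreviation (input) lookup where "lookup \<equiv> Poly_Mapping.lookup"
abbreviation (input) keys where "keys \<equiv> Poly_Mapping.keys"

interpretation laurent: field_algebra "single 0 :: 'k::field \<Rightarrow> ('q, 'k) laurent"
  by standard (auto simp: single_add mult_single)

abbreviation const :: "'k::field \<Rightarrow> ('q, 'k) laurent" where "const \<equiv> single 0"

lemma scalar_eq: "scalar = (\<lambda>k f. const k * f)"
  by (intro ext) (simp add: scalar_def)

text \<open>
  The integer powers of a variable: negative exponents occur in the rings of the charts.
\<close>

definition xpow :: "'q \<times> nat \<Rightarrow> int \<Rightarrow> ('q, 'k::field) laurent" where
  "xpow v k = single (single v k) 1"

lemma xpow_add: "xpow v (k + l) = xpow v k * xpow v l"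
  by (simp add: xpow_def mult_single single_add)

lemma xpow_0 [simp]: "xpow v 0 = 1"
  by (simp add: xpow_def)

lemma xpow_inverse [simp]: "xpow v k * xpow v (- k) = 1" "xpow v (- k) * xpow v k = 1"
  using xpow_add[of v k "- k"] xpow_add[of v "- k" k] by simp_all

lemma xpow_power: "xpow v k ^ m = xpow v (int m * k)"
  by (induction m) (simp_all add: xpow_add[symmetric] algebra_simps)

definition admissible :: "'q set \<Rightarrow> ('q \<Rightarrow> nat) \<Rightarrow> ('q \<times> nat) set \<Rightarrow> 'q expo \<Rightarrow> bool" where
  "admissible Q n W m \<longleftrightarrow>
     keys m \<subseteq> vars Q n \<and> (\<forall>v. v \<notin> W \<longrightarrow> 0 \<le> lookup m v)"

lemma graded_iff:
  "f \<in> graded_piece Q n W a \<longleftrightarrow> (\<forall>m\<in>keys f. admissible Q n W m \<and> multidegree n m = a)"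
  by (auto simp: graded_piece_def localization_def admissible_def)

lemma admissible_nonneg: "admissible Q n W m \<Longrightarrow> v \<notin> W \<Longrightarrow> 0 \<le> lookup m v"
  unfolding admissible_def by blast

lemma localization_iff: "f \<in> localization Q n W \<longleftrightarrow> (\<forall>m\<in>keys f. admissible Q n W m)"
  by (auto simp: localization_def admissible_def)

lemma multidegree_add: "multidegree n (l + m) = multidegree n l + multidegree n m"
  by (rule ext) (simp add: multidegree_def lookup_add sum.distrib)

lemma multidegree_zero [simp]: "multidegree n 0 = 0"
  by (rule ext) (simp add: multidegree_def)

lemma multidegree_single:
  "multidegree n (single (i, j) k) = (\<lambda>l. if l = i \<and> j \<le> n i then k else 0)"
proof (rule ext)
  fix l
  have "multidegree n (single (i, j) k) l = (\<Sum>m\<le>n l. if j = m then (if i = l then k else 0) else 0)"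
    unfolding multidegree_def by (intro sum.cong) (auto simp: lookup_single when_def)
  also have "\<dots> = (if l = i \<and> j \<le> n i then k else 0)" by auto
  finally show "multidegree n (single (i, j) k) l = (if l = i \<and> j \<le> n i then k else 0)" .
qed

lemma admissible_zero: "admissible Q n W 0"
  by (simp add: admissible_def)

lemma admissible_add:
  assumes "admissible Q n W l" "admissible Q' n W' m" "Q \<subseteq> R" "Q' \<subseteq> R" "W \<subseteq> U" "W' \<subseteq> U"
  shows "admissible R n U (l + m)"
proof -
  have "vars Q n \<union> vars Q' n \<subseteq> vars R n" using assms(3,4) by (auto simp: vars_def)
  then have "keys (l + m) \<subseteq> vars R n"
    using assms(1,2) keys_add[of l m] unfolding admissible_def by blast
  moreover have "0 \<le> lookup (l + m) v" if "v \<notin> U" for v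
  proof -
    have "0 \<le> lookup l v" "0 \<le> lookup m v"
      using assms(1,2,5,6) that unfolding admissible_def by blast+
    then show ?thesis by (simp add: lookup_add)
  qed
  ultimately show ?thesis by (simp add: admissible_def)
qed

lemma admissible_single:
  "v \<in> vars Q n \<Longrightarrow> v \<in> W \<or> 0 \<le> k \<Longrightarrow> admissible Q n W (single v k)"
  by (auto simp: admissible_def lookup_single when_def)

lemma graded_mult:
  assumes "f \<in> graded_piece Q n W a" "g \<in> graded_piece Q' n W' b"
    and "Q \<subseteq> R" "Q' \<subseteq> R" "W \<subseteq> U" "W' \<subseteq> U" "c = a + b"
  shows "f * g \<in> graded_piece R n U c"
  unfolding graded_iff
proof
  fix m assume "m \<in> keys (f * g)"
  then obtain k l where "m = k + l" "k \<in> keys f" "l \<in> keys g"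
    using keys_mult[of f g] by auto
  then show "admissible R n U m \<and> multidegree n m = c"
    using assms by (auto simp: graded_iff multidegree_add intro: admissible_add)
qed

lemma graded_add:
  "f \<in> graded_piece Q n W a \<Longrightarrow> g \<in> graded_piece Q n W a \<Longrightarrow> f + g \<in> graded_piece Q n W a"
  using keys_add[of f g] by (auto simp: graded_iff)

lemma graded_const: "const k \<in> graded_piece Q n W 0"
  by (auto simp: graded_iff admissible_zero)

lemma graded_scale: "f \<in> graded_piece Q n W a \<Longrightarrow> const k * f \<in> graded_piece Q n W a"
  by (rule graded_mult[OF graded_const]) auto

lemma subspace_graded: "laurent.subspace (graded_piece Q n W a)"
  unfolding laurent.subspace_def using graded_add graded_scale
  by (auto simp: graded_iff[of 0])

lemma graded_mono:
  "f \<in> graded_piece Q n W a \<Longrightarrow> Q \<subseteq> R \<Longrightarrow> W \<subseteq> U \<Longrightarrow> f \<in> graded_piece R n U a"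
  by (fastforce simp: graded_iff admissible_def vars_def)

lemma graded_single:
  "admissible Q n W m \<Longrightarrow> multidegree n m = a \<Longrightarrow> single m k \<in> graded_piece Q n W a"
  by (auto simp: graded_iff)

lemma subring_graded: "subring_set (graded_piece Q n W 0)"
  unfolding subring_set_def
  using laurent.subspace_diff[OF subspace_graded] graded_const[of 1 Q n W]
  by (auto intro: graded_mult)

lemma range_const_subset: "range const \<subseteq> graded_piece Q n W 0"
  using graded_const by blast

definition deg_at :: "'q \<Rightarrow> int \<Rightarrow> 'q \<Rightarrow> int" where
  "deg_at i k = (\<lambda>l. if l = i then k else 0)"

lemma deg_at_add: "deg_at i k + deg_at i l = deg_at i (k + l)"
  by (auto simp: deg_at_def fun_eq_iff)

lemma deg_at_0 [simp]: "deg_at i 0 = 0"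
  by (auto simp: deg_at_def fun_eq_iff)

lemma xpow_graded:
  assumes "i \<in> Q" "j \<le> n i" "(i, j) \<in> W \<or> 0 \<le> k"
  shows "xpow (i, j) k \<in> graded_piece Q n W (deg_at i k)"
  unfolding xpow_def using assms
  by (intro graded_single admissible_single) (auto simp: multidegree_single deg_at_def vars_def)

lemma laurent_sum_of_monomials:
  "f = (\<Sum>m\<in>keys f. single m (lookup f m))"
  by (intro poly_mapping_eqI)
    (simp add: lookup_sum lookup_single when_def in_keys_iff sum.If_cases if_distrib)

lemma subspace_contains_if_monomials:
  assumes U: "laurent.subspace U" and m: "\<And>m. m \<in> keys f \<Longrightarrow> single m 1 \<in> U"
  shows "f \<in> U"
proof -
  have "(\<Sum>m\<in>keys f. const (lookup f m) * single m 1) \<in> U"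
    by (intro laurent.subspace_sum[OF U] laurent.subspace_scale[OF U] m)
  then show ?thesis
    by (subst laurent_sum_of_monomials) (simp add: mult_single)
qed

lemma finite_vars: "finite Q \<Longrightarrow> finite (vars Q n)"
proof -
  assume "finite Q"
  moreover have "vars Q n = Sigma Q (\<lambda>i. {..n i})" by (auto simp: vars_def)
  ultimately show ?thesis by simp
qed

lemma finite_forms_monomials:
  assumes Q: "finite Q"
  shows "finite {m. admissible Q n {} m \<and> multidegree n m = a}" (is "finite ?M")
proof -
  let ?V = "vars Q n"
  let ?r = "\<lambda>m. restrict (lookup m) ?V"
  have bound: "lookup m (i, j) \<in> {0..a i}" if "m \<in> ?M" "(i, j) \<in> ?V" for m i j
  proof -
    have nn: "0 \<le> lookup m v" for v using that admissible_nonneg by blast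
    have "lookup m (i, j) \<le> (\<Sum>j\<le>n i. lookup m (i, j))"
      using that nn by (intro member_le_sum) (auto simp: vars_def)
    also have "\<dots> = a i" using that by (auto simp: multidegree_def)
    finally show ?thesis using nn by simp
  qed
  have "?r ` ?M \<subseteq> (\<Pi>\<^sub>E v\<in>?V. {0..a (fst v)})"
    using bound by (fastforce simp: PiE_def extensional_def)
  then have "finite (?r ` ?M)"
    by (rule finite_subset) (intro finite_PiE finite_vars Q, simp)
  moreover have "inj_on ?r ?M"
  proof (rule inj_onI)
    fix l m assume lm: "l \<in> ?M" "m \<in> ?M" "?r l = ?r m"
    show "l = m"
    proof (rule poly_mapping_eqI)
      fix v
      show "lookup l v = lookup m v"
      proof (cases "v \<in> ?V")
        case True
        then show ?thesis using fun_cong[OF lm(3), of v] by simp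
      next
        case False
        then have "v \<notin> keys l" "v \<notin> keys m"
          using lm by (auto simp: admissible_def)
        then show ?thesis by (simp add: in_keys_iff)
      qed
    qed
  qed
  ultimately show ?thesis by (rule finite_imageD)
qed

lemma forms_spanned:
  assumes Q: "finite Q" and W: "laurent.subspace W"
  shows "\<exists>G. laurent.spans_mod G W (forms Q n a)"
proof -
  let ?G = "(\<lambda>m. single m 1) ` {m. admissible Q n {} m \<and> multidegree n m = a}"
  have fin: "finite ?G" by (intro finite_imageI finite_forms_monomials Q)
  have "forms Q n a \<subseteq> laurent.span_mod ?G W"
  proof
    fix f :: "('a, 'b) laurent" assume f: "f \<in> forms Q n a"
    show "f \<in> laurent.span_mod ?G W"
    proof (rule subspace_contains_if_monomials[OF laurent.subspace_span_mod[OF W]])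
      fix m assume "m \<in> keys f"
      then have "single m 1 \<in> ?G" using f by (auto simp: graded_iff)
      then show "single m 1 \<in> laurent.span_mod ?G W"
        using laurent.span_mod_generators[OF W fin] by blast
    qed
  qed
  then show ?thesis using fin unfolding laurent.spans_mod_def by blast
qed

lemma forms_single_factor:
  assumes f: "f \<in> forms UNIV n (deg_at i k)"
  shows "f \<in> forms {i} n (deg_at i k)"
  unfolding graded_iff
proof
  fix m assume "m \<in> keys f"
  then have m: "admissible UNIV n {} m" "multidegree n m = deg_at i k"
    using f by (auto simp: graded_iff)
  have nn: "0 \<le> lookup m v" for v using m admissible_nonneg by blast
  have "keys m \<subseteq> vars {i} n"
  proof
    fix v assume v: "v \<in> keys m"
    obtain l j where lj: "v = (l, j)" by (cases v)
    then have j: "j \<le> n l" using v m(1) by (auto simp: admissible_def vars_def)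
    have "l = i"
    proof (rule ccontr)
      assume "l \<noteq> i"
      then have "(\<Sum>j\<le>n l. lookup m (l, j)) = 0"
        using fun_cong[OF m(2), of l] by (simp add: multidegree_def deg_at_def)
      then have "lookup m (l, j) = 0"
        using j nn by (subst (asm) sum_nonneg_eq_0_iff) auto
      then show False using v lj by (simp add: in_keys_iff)
    qed
    then show "v \<in> vars {i} n" using lj j by (simp add: vars_def)
  qed
  then show "admissible {i} n {} m \<and> multidegree n m = deg_at i k"
    using m nn by (auto simp: admissible_def)
qed

text \<open>
  If only \<open>(i, j)\<close> is inverted in addition to \<open>W\<close>, a high power of that variable removes its
  denominators.
\<close>

lemma clear_denominators:
  assumes f: "f \<in> graded_piece Q n (insert (i, j) W) a" and ij: "i \<in> Q" "j \<le> n i"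
  shows "\<exists>k0. \<forall>k\<ge>k0. xpow (i, j) (int k) * f \<in> graded_piece Q n W (deg_at i (int k) + a)"
proof -
  define k0 where "k0 = (\<Sum>m\<in>keys f. nat (- lookup m (i, j)))"
  have "xpow (i, j) (int k) * f \<in> graded_piece Q n W (deg_at i (int k) + a)" if k: "k0 \<le> k" for k
    unfolding graded_iff
  proof
    fix m assume "m \<in> keys (xpow (i, j) (int k) * f)"
    then obtain l where l: "m = single (i, j) (int k) + l" "l \<in> keys f"
      using keys_mult[of "xpow (i, j) (int k)" f] by (auto simp: xpow_def)
    have a: "admissible Q n (insert (i, j) W) l" "multidegree n l = a"
      using f l by (auto simp: graded_iff)
    have "nat (- lookup l (i, j)) \<le> k0"
      unfolding k0_def using l(2) by (intro member_le_sum) auto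
    then have "0 \<le> lookup m (i, j)"
      using k by (simp add: l(1) lookup_add)
    moreover have "admissible Q n (insert (i, j) W) m"
      unfolding l(1) by (rule admissible_add[OF admissible_single a(1)]) (use ij in \<open>auto simp: vars_def\<close>)
    moreover have "multidegree n m = deg_at i (int k) + a"
      using ij by (simp add: l(1) multidegree_add a multidegree_single deg_at_def)
    ultimately show "admissible Q n W m \<and> multidegree n m = deg_at i (int k) + a"
      by (auto simp: admissible_def)
  qed
  then show ?thesis by blast
qed

section \<open>Rings of functions on the charts\<close>

abbreviation chart_functions :: "'q set \<Rightarrow> ('q \<Rightarrow> nat) \<Rightarrow> ('q \<Rightarrow> nat) \<Rightarrow> ('q, 'k::field) laurent set" where
  "chart_functions Q n c \<equiv> graded_piece Q n (chart_vars Q c) 0"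

definition chart_coord :: "('q \<Rightarrow> nat) \<Rightarrow> 'q \<times> nat \<Rightarrow> ('q, 'k::field) laurent" where
  "chart_coord c v = xpow v 1 * xpow (fst v, c (fst v)) (- 1)"

lemma chartsD: "c \<in> charts Q n \<Longrightarrow> i \<in> Q \<Longrightarrow> c i \<le> n i"
  by (auto simp: charts_def)

lemma chart_coord_in_chart:
  assumes c: "c \<in> charts Q n" and v: "v \<in> vars Q n"
  shows "chart_coord c v \<in> chart_functions Q n c"
proof -
  obtain i j where ij: "v = (i, j)" "i \<in> Q" "j \<le> n i" using v by (auto simp: vars_def)
  show ?thesis
    unfolding chart_coord_def ij(1) fst_conv
    by (rule graded_mult[OF xpow_graded xpow_graded])
      (use ij chartsD[OF c] in \<open>auto simp: chart_vars_def deg_at_add\<close>)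
qed

text \<open>
  On the chart \<open>c\<close> a monomial of multidegree zero is the product of the quotients \<open>x\<^sub>v / x\<^sub>i\<^sub>,\<^sub>c\<^sub>(\<^sub>i\<^sub>)\<close> of its
  variables with positive exponent outside the chart variables. They are split off one by one; if
  none is left, the degrees force the exponents of the chart variables to be zero too.
\<close>

lemma chart_ring_generated:
  fixes n :: "'q \<Rightarrow> nat"
  assumes c: "c \<in> charts Q n" and Q: "finite Q" and vs: "set vs = vars Q n"
  shows "chart_functions Q n c \<subseteq> adjoin_list (range const) (map (chart_coord c) vs :: ('q, 'k::field) laurent list)"
    (is "_ \<subseteq> ?A")
proof -
  have A: "subring_set ?A" by (intro subring_adjoin_list laurent.subring_range)
  have gen: "chart_coord c v \<in> ?A" if "v \<in> vars Q n" for v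
    using adjoin_list_generators[OF laurent.subring_range, of "map (chart_coord c) vs"] that vs by auto
  have mono: "single m 1 \<in> ?A"
    if "admissible Q n (chart_vars Q c) m" "multidegree n m = 0" for m
    using that
  proof (induction "\<Sum>v\<in>vars Q n - chart_vars Q c. nat (lookup m v)" arbitrary: m rule: less_induct)
    case less
    show ?case
    proof (cases "\<exists>v\<in>vars Q n - chart_vars Q c. lookup m v > 0")
      case True
      then obtain v where v: "v \<in> vars Q n" "v \<notin> chart_vars Q c" "lookup m v > 0" by blast
      then obtain i j where ij: "v = (i, j)" "i \<in> Q" "j \<le> n i" by (auto simp: vars_def)
      have ic: "(i, c i) \<in> chart_vars Q c" "(i, c i) \<in> vars Q n" "(i, c i) \<noteq> v"
        using ij v chartsD[OF c] by (auto simp: chart_vars_def vars_def)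
      define l where "l = m + (single (i, c i) 1 + single v (- 1))"
      have lookup_l: "lookup l w = lookup m w
          + (if w = (i, c i) then 1 else 0) - (if w = v then 1 else 0)" for w
        by (simp add: l_def lookup_add lookup_single when_def)
      have "keys l \<subseteq> vars Q n"
      proof
        fix w assume "w \<in> keys l"
        then have "w \<in> keys m \<or> w = (i, c i) \<or> w = v"
          by (auto simp: in_keys_iff lookup_l split: if_splits)
        then show "w \<in> vars Q n" using less.prems v ic by (auto simp: admissible_def)
      qed
      moreover have "0 \<le> lookup l w" if "w \<notin> chart_vars Q c" for w
        using admissible_nonneg[OF less.prems(1) that] that ic v by (auto simp: lookup_l)
      ultimately have adm: "admissible Q n (chart_vars Q c) l" by (auto simp: admissible_def)
      have deg: "multidegree n l = 0"
        using ij chartsD[OF c ij(2)] less.prems(2)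
        by (simp add: l_def multidegree_add multidegree_single fun_eq_iff)
      have "(\<Sum>w\<in>vars Q n - chart_vars Q c. nat (lookup l w)) <
          (\<Sum>w\<in>vars Q n - chart_vars Q c. nat (lookup m w))"
      proof (rule sum_strict_mono_ex1)
        show "finite (vars Q n - chart_vars Q c)" using finite_vars[OF Q] by simp
        show "\<forall>w\<in>vars Q n - chart_vars Q c. nat (lookup l w) \<le> nat (lookup m w)"
          using ic by (auto simp: lookup_l)
        show "\<exists>w\<in>vars Q n - chart_vars Q c. nat (lookup l w) < nat (lookup m w)"
          using v ic by (intro bexI[of _ v]) (auto simp: lookup_l)
      qed
      then have "single l 1 \<in> ?A" using less.hyps adm deg by blast
      then have "single l 1 * chart_coord c v \<in> ?A" using gen v by (intro subring_mult[OF A])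
      moreover have "single l 1 * chart_coord c v = single m (1::'k)"
      proof -
        have "l + (single v 1 + single (i, c i) (- 1)) = m"
          by (rule poly_mapping_eqI) (auto simp: lookup_l lookup_add lookup_single when_def)
        then show ?thesis by (simp add: chart_coord_def xpow_def mult_single ij(1))
      qed
      ultimately show ?thesis by simp
    next
      case False
      have zero: "lookup m w = 0" if "w \<notin> chart_vars Q c" for w
      proof (cases "w \<in> vars Q n")
        case True
        then have "\<not> 0 < lookup m w" using False that by blast
        then show ?thesis using admissible_nonneg[OF less.prems(1) that] by simp
      next
        case nv: False
        then show ?thesis using less.prems(1) by (auto simp: admissible_def in_keys_iff)
      qed
      have "lookup m (i, c i) = 0" if i: "i \<in> Q" for i
      proof -
        have "0 = (\<Sum>j\<le>n i. lookup m (i, j))"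
          using fun_cong[OF less.prems(2), of i] by (simp add: multidegree_def)
        also have "\<dots> = (\<Sum>j\<in>{c i}. lookup m (i, j))"
          using chartsD[OF c i] by (intro sum.mono_neutral_right) (auto intro!: zero simp: chart_vars_def)
        finally show ?thesis by simp
      qed
      then have "lookup m w = 0" if "w \<in> chart_vars Q c" for w
        using that by (auto simp: chart_vars_def)
      then have "m = 0" using zero by (intro poly_mapping_eqI) (metis lookup_zero)
      then show ?thesis using subring_one[OF A] by simp
    qed
  qed
  have "laurent.subspace ?A"
    using subring_zero[OF A] subring_add[OF A] subring_mult[OF A] adjoin_list_base[OF laurent.subring_range]
    unfolding laurent.subspace_def by blast
  then have "f \<in> ?A" if "f \<in> chart_functions Q n c" for f
    by (rule subspace_contains_if_monomials) (rule mono, use that in \<open>auto simp: graded_iff\<close>)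
  then show ?thesis by blast
qed

lemma chart_coords_in_chart:
  "c \<in> charts Q n \<Longrightarrow> set vs = vars Q n \<Longrightarrow> set (map (chart_coord c) vs) \<subseteq> chart_functions Q n c"
  using chart_coord_in_chart by fastforce

lemma zero_dimensional_algebraic:
  assumes X: "closed_subscheme UNIV n X" "zero_dimensional UNIV n X"
    and c: "c \<in> charts UNIV n" and y: "y \<in> chart_functions UNIV n c"
  shows "\<exists>p. p \<noteq> 0 \<and> poly (laurent.lift p) y \<in> X (c :: 'q::finite \<Rightarrow> nat)"
proof -
  let ?C = "chart_functions UNIV n c"
  have C: "subring_set ?C" by (rule subring_graded)
  have ring: "chart_ring UNIV n c = subring_of ?C" by (simp add: chart_ring_def)
  have J: "ideal_set ?C (X c)"
    using X(1) c ring unfolding closed_subscheme_def ideal_subring_of_iff[OF C, symmetric] by metis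
  obtain vs where vs: "set vs = vars UNIV n" using finite_list[OF finite_vars[of UNIV n]] by auto
  have "\<exists>p\<in>polys (range const). p \<noteq> 0 \<and> poly p y \<in> X c"
  proof (rule algebraic_if_no_prime_chain[OF C laurent.subring_range range_const_subset _ _ _ J _ y])
    show "\<And>a. a \<in> range const \<Longrightarrow> a \<noteq> 0 \<Longrightarrow> \<exists>b\<in>range const. a * b = 1"
      by (rule laurent.range_inverse)
    show "set (map (chart_coord c) vs) \<subseteq> ?C" by (rule chart_coords_in_chart[OF c vs])
    show "?C \<subseteq> adjoin_list (range const) (map (chart_coord c) vs)"
      by (rule chart_ring_generated[OF c _ vs]) simp
    show "\<not> P \<subset> P'" if "prime_set ?C P" "prime_set ?C P'" "X c \<subseteq> P" for P P'
    proof -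
      have "primeideal P (chart_ring UNIV n c)" "primeideal P' (chart_ring UNIV n c)"
        unfolding ring using that by (auto intro: primeideal_subring_of[OF C])
      then show ?thesis using that(3) X(2) c unfolding zero_dimensional_def by blast
    qed
  qed
  then show ?thesis by (metis laurent.lift_of_polys_range map_poly_0)
qed

section \<open>Forms vanishing on a subscheme\<close>

lemma chart_monom_add: "chart_monom Q c a * chart_monom Q c b = chart_monom Q c (a + b)"
  by (simp add: chart_monom_def mult_single single_add sum.distrib)

lemma chart_monom_0 [simp]: "chart_monom Q c 0 = 1"
  by (simp add: chart_monom_def)

lemma chart_monom_deg_at: "chart_monom UNIV c (deg_at i k) = xpow (i, c (i :: 'q::finite)) k"
proof -
  have "(\<Sum>l\<in>UNIV. single (l, c l) (deg_at i k l)) =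
      (\<Sum>l\<in>UNIV. if l = i then single (i, c i) k else 0)"
    by (intro sum.cong) (auto simp: deg_at_def)
  then show ?thesis by (simp add: chart_monom_def xpow_def)
qed

lemma chart_monom_graded:
  assumes c: "c \<in> charts UNIV n"
  shows "chart_monom UNIV c a \<in> graded_piece UNIV n (chart_vars UNIV c) (a :: 'q::finite \<Rightarrow> int)"
proof -
  let ?m = "\<Sum>i\<in>UNIV. single (i, c i) (a i)"
  have lookup: "lookup ?m (i, j) = (if j = c i then a i else 0)" for i j
  proof -
    have "lookup ?m (i, j) = (\<Sum>l\<in>UNIV. if l = i then (if j = c i then a i else 0) else 0)"
      unfolding lookup_sum by (intro sum.cong) (auto simp: lookup_single when_def)
    then show ?thesis by simp
  qed
  have "multidegree n ?m = a"
    using chartsD[OF c] by (auto simp: multidegree_def lookup fun_eq_iff)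
  moreover have "admissible UNIV n (chart_vars UNIV c) ?m"
    using chartsD[OF c] unfolding admissible_def
    by (auto simp: in_keys_iff lookup vars_def chart_vars_def split: if_splits)
  ultimately show ?thesis
    unfolding chart_monom_def by (intro graded_single)
qed

text \<open>
  The part of multidegree \<open>a\<close>. It serves to show that the ideal generated by the vanishing forms
  contains no further forms.
\<close>

definition component :: "('q \<Rightarrow> nat) \<Rightarrow> ('q \<Rightarrow> int) \<Rightarrow> ('q, 'k::field) laurent \<Rightarrow> ('q, 'k) laurent" where
  "component n a f = (\<Sum>m\<in>keys f.
     if multidegree n m = a then single m (lookup f m) else 0)"

lemma lookup_component:
  "lookup (component n a f) m = (if multidegree n m = a then lookup f m else 0)"
proof -
  have "lookup (component n a f) m = (\<Sum>l\<in>keys f.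
      if l = m then (if multidegree n m = a then lookup f m else 0) else 0)"
    unfolding component_def lookup_sum by (intro sum.cong) (auto simp: lookup_single when_def)
  then show ?thesis by (simp add: in_keys_iff)
qed

lemma component_add: "component n a (f + g) = component n a f + component n a g"
  by (rule poly_mapping_eqI) (simp add: lookup_component lookup_add)

lemma component_0 [simp]: "component n a 0 = 0"
  by (simp add: component_def)

lemma component_homogeneous:
  assumes "f \<in> graded_piece Q n W b"
  shows "component n a f = (if a = b then f else 0)"
  using assms by (intro poly_mapping_eqI) (auto simp: lookup_component graded_iff in_keys_iff)

inductive_set additive_span :: "'v::monoid_add set \<Rightarrow> 'v set" for S where
  zero: "0 \<in> additive_span S"
| add: "f \<in> S \<Longrightarrow> g \<in> additive_span S \<Longrightarrow> f + g \<in> additive_span S"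

lemma additive_span_add:
  "f \<in> additive_span S \<Longrightarrow> g \<in> additive_span S \<Longrightarrow> f + g \<in> additive_span (S :: 'v::monoid_add set)"
  by (induction f rule: additive_span.induct) (auto simp: add.assoc intro: additive_span.add)

lemma additive_span_base: "f \<in> S \<Longrightarrow> f \<in> additive_span S"
  using additive_span.add[OF _ additive_span.zero] by fastforce

definition vanishing_forms ::
  "('q \<Rightarrow> nat) \<Rightarrow> ('q, 'k::field) ideal_sheaf \<Rightarrow> ('q \<Rightarrow> int) \<Rightarrow> ('q, 'k) laurent set" where
  "vanishing_forms n X a = {f \<in> forms UNIV n a. vanishes_on UNIV n a f X}"

definition linear_form :: "('q \<Rightarrow> nat) \<Rightarrow> 'q \<Rightarrow> ('q, 'k::field) laurent poly" where
  "linear_form n i = laurent.generic_form (n i) (\<lambda>j. xpow (i, j) 1)"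

lemma variable_form: "j \<le> n i \<Longrightarrow> xpow (i, j) 1 \<in> forms UNIV n (deg_at i 1)"
  by (rule xpow_graded) auto

lemma polys_smult_forms:
  "f \<in> polys (forms UNIV n a) \<Longrightarrow> g \<in> forms UNIV n b \<Longrightarrow> smult g f \<in> polys (forms UNIV n (b + a))"
  by (intro polysI) (auto intro: graded_mult polysD)

lemma linear_form_mult:
  assumes "f \<in> polys (forms UNIV n a)"
  shows "linear_form n i * f \<in> polys (forms UNIV n (deg_at i 1 + a))"
proof -
  have "xpow (i, j) 1 * coeff f k \<in> forms UNIV n (deg_at i 1 + a)" if "j \<le> n i" for j k
    by (rule graded_mult[OF variable_form[where n = n and i = i, OF that] polysD[OF assms]]) auto
  then show ?thesis
    unfolding linear_form_def
    by (intro polysI, unfold laurent.coeff_generic_form_mult)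
      (auto intro!: laurent.subspace_sum laurent.subspace_zero subspace_graded)
qed

locale subscheme =
  fixes n :: "'q::finite \<Rightarrow> nat" and X :: "('q, 'k::field) ideal_sheaf"
  assumes closed: "closed_subscheme UNIV n X"
begin

abbreviation R :: "('q \<Rightarrow> int) \<Rightarrow> ('q, 'k) laurent set" where "R a \<equiv> forms UNIV n a"
abbreviation V :: "('q \<Rightarrow> int) \<Rightarrow> ('q, 'k) laurent set" where "V a \<equiv> vanishing_forms n X a"
abbreviation lform :: "'q \<Rightarrow> ('q, 'k) laurent poly" where "lform \<equiv> linear_form n"
abbreviation H :: "('q \<Rightarrow> int) \<Rightarrow> int" where "H \<equiv> hilbert_function n X"
abbreviation basis :: "('q \<Rightarrow> int) \<Rightarrow> ('q, 'k) laurent set \<Rightarrow> bool" where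
  "basis a \<equiv> quotient_basis laurent.scale (R a) (V a)"

lemma ideal_chart: "c \<in> charts UNIV n \<Longrightarrow> ideal_set (chart_functions UNIV n c) (X c)"
  using closed unfolding closed_subscheme_def
  by (metis chart_ring_def ideal_subring_of_iff subring_graded)

lemma V_iff: "f \<in> V a \<longleftrightarrow> f \<in> R a \<and> (\<forall>c\<in>charts UNIV n. f * chart_monom UNIV c (- a) \<in> X c)"
  by (auto simp: vanishing_forms_def vanishes_on_def)

lemma V_subset: "V a \<subseteq> R a"
  by (auto simp: V_iff)

lemma subspace_V: "laurent.subspace (V a)"
proof -
  have X: "laurent.subspace (X c)" if "c \<in> charts UNIV n" for c
    using laurent.subspace_if_ideal[OF ideal_chart[OF that] range_const_subset] .
  show ?thesis
    unfolding laurent.subspace_def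
  proof (intro conjI ballI allI)
    show "0 \<in> V a"
      using laurent.subspace_zero[OF X] laurent.subspace_zero[OF subspace_graded] by (simp add: V_iff)
    show "f + g \<in> V a" if "f \<in> V a" "g \<in> V a" for f g
      using that by (auto simp: V_iff distrib_right graded_add laurent.subspace_add[OF X])
    show "const k * f \<in> V a" if "f \<in> V a" for f k
      using that by (auto simp: V_iff mult.assoc graded_scale laurent.subspace_scale[OF X])
  qed
qed

lemma V_mult:
  assumes f: "f \<in> V a" and g: "g \<in> R b"
  shows "g * f \<in> V (b + a)"
  unfolding V_iff
proof (intro conjI ballI)
  show "g * f \<in> R (b + a)" using f g by (intro graded_mult) (auto simp: V_iff)
  fix c :: "'q \<Rightarrow> nat" assume c: "c \<in> charts UNIV n"
  have "g * chart_monom UNIV c (- b) \<in> chart_functions UNIV n c"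
    by (rule graded_mult[OF g chart_monom_graded[OF c]]) auto
  then have "(g * chart_monom UNIV c (- b)) * (f * chart_monom UNIV c (- a)) \<in> X c"
    by (rule ideal_mult_left[OF ideal_chart[OF c] subring_graded]) (use f c in \<open>auto simp: V_iff\<close>)
  also have "(g * chart_monom UNIV c (- b)) * (f * chart_monom UNIV c (- a)) =
      (g * f) * (chart_monom UNIV c (- b) * chart_monom UNIV c (- a))"
    by (simp add: mult_ac)
  finally show "g * f * chart_monom UNIV c (- (b + a)) \<in> X c"
    by (simp add: chart_monom_add algebra_simps)
qed

text \<open>
  The vanishing ideal is saturated with respect to the variables of each factor, because on each
  chart vanishing can be tested after multiplication by the variable that is invertible there.
\<close>

lemma V_saturated:
  assumes f: "f \<in> R a" and x: "\<And>j. j \<le> n i \<Longrightarrow> xpow (i, j) 1 * f \<in> V (deg_at i 1 + a)"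
  shows "f \<in> V a"
  unfolding V_iff
proof (intro conjI ballI f)
  fix c assume c: "c \<in> charts UNIV n"
  have "xpow (i, c i) 1 * f * chart_monom UNIV c (- (deg_at i 1 + a)) \<in> X c"
    using x[OF chartsD[OF c]] c by (auto simp: V_iff)
  also have "xpow (i, c i) 1 * f * chart_monom UNIV c (- (deg_at i 1 + a)) =
      f * (chart_monom UNIV c (deg_at i 1) * chart_monom UNIV c (- (deg_at i 1 + a)))"
    by (simp add: chart_monom_deg_at mult_ac)
  finally show "f * chart_monom UNIV c (- a) \<in> X c"
    by (simp add: chart_monom_add)
qed

text \<open>
  The sums of vanishing forms already are an ideal of the coordinate ring, so the generated ideal
  is not larger, and the homogeneous components of such a sum vanish on \<open>X\<close> again.
\<close>

lemma forms_inter_ideal_of: "R a \<inter> ideal_of UNIV n X = V a"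
proof -
  let ?S = "localization UNIV n {} :: ('q, 'k) laurent set"
  let ?G = "{f. \<exists>a. f \<in> R a \<and> vanishes_on UNIV n a f X}"
  let ?I = "additive_span ?G"
  have S: "subring_set ?S"
    unfolding subring_set_def
  proof (intro conjI ballI)
    show "1 \<in> ?S" by (auto simp: localization_iff admissible_zero)
    fix f g :: "('q, 'k) laurent" assume fg: "f \<in> ?S" "g \<in> ?S"
    show "f - g \<in> ?S"
    proof -
      have "m \<in> keys f \<or> m \<in> keys g" if "m \<in> keys (f - g)" for m
        using that by (auto simp: in_keys_iff lookup_minus)
      then show ?thesis using fg unfolding localization_iff by blast
    qed
    show "f * g \<in> ?S"
      using fg subsetD[OF keys_mult[of f g]] by (force simp: localization_iff intro: admissible_add)
  qed
  have G: "?G = (\<Union>a. V a)" by (auto simp: vanishing_forms_def)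
  have GS: "?G \<subseteq> ?S" by (auto simp: graded_piece_def)
  have IS: "?I \<subseteq> ?S"
  proof
    fix f assume "f \<in> ?I"
    then show "f \<in> ?S"
      using GS by (induction rule: additive_span.induct) (auto intro: subring_zero[OF S] subring_add[OF S])
  qed
  have "ideal_set ?S ?I"
    unfolding ideal_set_def
  proof (intro conjI ballI IS additive_span.zero additive_span_add)
    fix r f assume r: "r \<in> ?S" and f: "f \<in> ?I"
    have mono: "single m k * f \<in> ?I" if "admissible UNIV n {} m" for m k
      using f
    proof (induction rule: additive_span.induct)
      case (add f g)
      then obtain a where "f \<in> V a" by (auto simp: G)
      then have "single m k * f \<in> V (multidegree n m + a)"
        by (intro V_mult graded_single that refl)
      then have "single m k * f \<in> ?I" by (intro additive_span_base) (auto simp: G)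
      then show ?case using add.IH by (simp add: distrib_left additive_span_add)
    qed (simp add: additive_span.zero)
    have sum_I: "sum h A \<in> ?I" if "\<And>x. x \<in> A \<Longrightarrow> h x \<in> ?I" for A :: "'q expo set" and h
      using that by (induction A rule: infinite_finite_induct) (auto intro: additive_span.zero additive_span_add)
    have "(\<Sum>m\<in>keys r. single m (lookup r m) * f) \<in> ?I"
      using r by (intro sum_I mono) (auto simp: localization_iff)
    also have "(\<Sum>m\<in>keys r. single m (lookup r m) * f) =
        (\<Sum>m\<in>keys r. single m (lookup r m)) * f"
      by (rule sum_distrib_right[symmetric])
    also have "(\<Sum>m\<in>keys r. single m (lookup r m)) = r"
      by (rule laurent_sum_of_monomials[symmetric])
    finally show "r * f \<in> ?I" .
  qed
  moreover have "?G \<subseteq> ?I" by (intro subsetI additive_span_base)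
  ultimately have sub: "ideal_of UNIV n X \<subseteq> ?I"
    unfolding ideal_of_def coordinate_ring_def by (rule genideal_subring_of(3)[OF S GS])
  have comp: "component n a f \<in> V a" if "f \<in> ?I" for f
    using that
  proof (induction rule: additive_span.induct)
    case zero
    show ?case using laurent.subspace_zero[OF subspace_V] by simp
  next
    case (add f g)
    then obtain b where "f \<in> V b" by (auto simp: G)
    then have "component n a f \<in> V a"
      using component_homogeneous[of f UNIV n "{}" b a] laurent.subspace_zero[OF subspace_V]
      by (auto simp: V_iff)
    then show ?case using add.IH by (simp add: component_add laurent.subspace_add[OF subspace_V])
  qed
  show ?thesis
  proof
    show "V a \<subseteq> R a \<inter> ideal_of UNIV n X"
      using genideal_subring_of(2)[OF S GS] V_subset unfolding ideal_of_def coordinate_ring_def G by blast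
    show "R a \<inter> ideal_of UNIV n X \<subseteq> V a"
    proof
      fix f assume "f \<in> R a \<inter> ideal_of UNIV n X"
      then have "f \<in> R a" "f \<in> ?I" using sub by auto
      then show "f \<in> V a" using comp component_homogeneous[of f UNIV n "{}" a a] by fastforce
    qed
  qed
qed

lemma hilbert_basis:
  obtains B where "basis a B" "H a = int (card B)"
proof -
  obtain G where "laurent.spans_mod G (V a) (R a)"
    using forms_spanned[OF finite subspace_V] by blast
  from laurent.quotient_basis_exists[OF subspace_V this subspace_graded]
  obtain B where "basis a B"
      "quotient_dim laurent.scale (R a) (V a) = card B"
    by (rule laurent.quotient_dim_eq_card)
  then show ?thesis
    using that by (simp add: hilbert_function_def forms_inter_ideal_of scalar_eq)
qed

lemma linear_form_nonzerodivisor: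
  assumes f: "f \<in> polys (R a)" and lf: "lform i * f \<in> polys (V (deg_at i 1 + a))"
  shows "f \<in> polys (V a)"
proof -
  \<comment> \<open>The graded module is the part of the coordinate ring on the ray from \<open>a\<close> in direction \<open>i\<close>.\<close>
  let ?d = "\<lambda>d. deg_at i (int d) + a"
  have deg: "?d (Suc d) = deg_at i 1 + ?d d" for d
    by (simp add: add.assoc[symmetric] deg_at_add)
  have "f \<in> polys (V (?d 0))"
  proof (rule laurent.generic_form_nonzerodivisor[where F = "\<lambda>d. R (?d d)" and V = "\<lambda>d. V (?d d)"])
    show "laurent.subspace (V (?d d))" for d by (rule subspace_V)
    show "xpow (i, j) 1 * f \<in> R (?d (Suc d))" if "j \<le> n i" "f \<in> R (?d d)" for d j f
      unfolding deg using that by (intro graded_mult[OF variable_form]) auto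
    show "xpow (i, j) 1 * f \<in> V (?d (Suc d))" if "j \<le> n i" "f \<in> V (?d d)" for d j f
      unfolding deg using that by (intro V_mult variable_form)
    show "f \<in> V (?d d)" if "f \<in> R (?d d)" "\<And>j. j \<le> n i \<Longrightarrow> xpow (i, j) 1 * f \<in> V (?d (Suc d))" for d f
      using that unfolding deg by (rule V_saturated)
    show "f \<in> polys (R (?d 0))" using f by simp
    show "laurent.generic_form (n i) (\<lambda>j. xpow (i, j) 1) * f \<in> polys (V (?d (Suc 0)))"
      using lf by (simp add: linear_form_def)
  qed
  then show ?thesis by simp
qed

lemma poly_span_of_basis:
  assumes "B \<subseteq> R a"
  shows "(\<Sum>b\<in>B. laurent.lift (p b) * [:b:]) \<in> polys (R a)"
  using assms
  by (intro laurent.polys_sum laurent.polys_lift_mult laurent.polys_const_subspace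
      subspace_graded) auto

section \<open>Growth of the Hilbert function in one direction\<close>

text \<open>
  Multiplication by the generic form is injective on the coordinate ring of \<open>X\<close> (with \<open>t\<close>
  adjoined), so it maps a basis to independent elements.
\<close>

lemma hilbert_function_mono: "H a \<le> H (deg_at i 1 + a)"
proof -
  obtain B where B: "basis a B" "H a = int (card B)"
    by (rule hilbert_basis)
  obtain B' where B': "basis (deg_at i 1 + a) B'"
      "H (deg_at i 1 + a) = int (card B')"
    by (rule hilbert_basis)
  have BR: "B \<subseteq> R a" "finite B" using B by (auto simp: quotient_basis_def)
  have "card B \<le> card B'"
  proof (rule laurent.card_le_if_independent[where f = "\<lambda>b. lform i * [:b:]", OF subspace_V B'(1) BR(2)])
    show "lform i * [:b:] \<in> polys (R (deg_at i 1 + a))" if "b \<in> B" for b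
      using BR that by (intro linear_form_mult laurent.polys_const_subspace subspace_graded) auto
    fix p assume "(\<Sum>b\<in>B. laurent.lift (p b) * (lform i * [:b:])) \<in> polys (V (deg_at i 1 + a))"
    also have "(\<Sum>b\<in>B. laurent.lift (p b) * (lform i * [:b:])) = lform i * (\<Sum>b\<in>B. laurent.lift (p b) * [:b:])"
      by (simp only: sum_distrib_left mult.left_commute)
    finally have "(\<Sum>b\<in>B. laurent.lift (p b) * [:b:]) \<in> polys (V a)"
      by (rule linear_form_nonzerodivisor[OF poly_span_of_basis[OF BR(1)]])
    then show "\<forall>b\<in>B. p b = 0" by (rule laurent.quotient_basis_poly_independent[OF B(1)])
  qed
  then show ?thesis using B B' by simp
qed

text \<open>
  Multiplication by the generic form from degree \<open>a\<close> to degree \<open>a + e\<^sub>i\<close> is surjective over the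
  field \<open>K(t)\<close>, expressed without denominators.
\<close>

definition torsion_cokernel :: "'q \<Rightarrow> ('q \<Rightarrow> int) \<Rightarrow> bool" where
  "torsion_cokernel i a \<longleftrightarrow> (\<forall>g\<in>R (deg_at i 1 + a). \<exists>p w. p \<noteq> 0 \<and> w \<in> polys (R a) \<and>
     laurent.lift p * [:g:] - lform i * w \<in> polys (V (deg_at i 1 + a)))"

lemma torsion_cokernel_if_stationary:
  assumes eq: "H (deg_at i 1 + a) = H a"
  shows "torsion_cokernel i a"
  unfolding torsion_cokernel_def
proof
  fix g assume g: "g \<in> R (deg_at i 1 + a)"
  obtain B where B: "basis a B" "H a = int (card B)"
    by (rule hilbert_basis)
  obtain B' where B': "basis (deg_at i 1 + a) B'"
      "H (deg_at i 1 + a) = int (card B')"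
    by (rule hilbert_basis)
  have BR: "B \<subseteq> R a" "finite B" using B by (auto simp: quotient_basis_def)
  show "\<exists>p w. p \<noteq> 0 \<and> w \<in> polys (R a) \<and>
      laurent.lift p * [:g:] - lform i * w \<in> polys (V (deg_at i 1 + a))"
    using eq B(2) B'(2)
    by (intro laurent.torsion_cokernel_of_injective[OF subspace_graded subspace_graded
          subspace_V B(1) B'(1) _ linear_form_mult linear_form_nonzerodivisor g]) auto
qed

text \<open>
  If \<open>p b = lform i * w b\<close> for a basis of elements \<open>b\<close>, then a relation among the \<open>w b\<close> would be
  one among the multiples \<open>p b\<close> of the basis. So the \<open>w b\<close> are independent in degree \<open>a\<close>.
\<close>

lemma hilbert_function_le_if_torsion_cokernel:
  assumes tor: "torsion_cokernel i a"
  shows "H (deg_at i 1 + a) \<le> H a"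
proof -
  let ?a' = "deg_at i 1 + a"
  obtain B where B: "basis a B" "H a = int (card B)"
    by (rule hilbert_basis)
  obtain B' where B': "basis ?a' B'" "H ?a' = int (card B')"
    by (rule hilbert_basis)
  have BR: "B' \<subseteq> R ?a'" "finite B'" using B' by (auto simp: quotient_basis_def)
  then have "\<forall>b\<in>B'. \<exists>p w. p \<noteq> 0 \<and> w \<in> polys (R a) \<and>
      laurent.lift p * [:b:] - lform i * w \<in> polys (V ?a')"
    using tor unfolding torsion_cokernel_def by blast
  then obtain p w where pw: "\<And>b. b \<in> B' \<Longrightarrow> p b \<noteq> 0" "\<And>b. b \<in> B' \<Longrightarrow> w b \<in> polys (R a)"
      "\<And>b. b \<in> B' \<Longrightarrow> laurent.lift (p b) * [:b:] - lform i * w b \<in> polys (V ?a')"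
    by metis
  have "card B' \<le> card B"
  proof (rule laurent.card_le_if_independent[where f = w, OF subspace_V B(1) BR(2) pw(2)])
    fix q assume q: "(\<Sum>b\<in>B'. laurent.lift (q b) * w b) \<in> polys (V a)"
    have lV: "lform i * h \<in> polys (V ?a')" if "h \<in> polys (V a)" for h
      unfolding linear_form_def
      by (intro polysI, unfold laurent.coeff_generic_form_mult)
        (auto intro!: laurent.subspace_sum[OF subspace_V] laurent.subspace_zero[OF subspace_V]
          V_mult variable_form polysD[OF that])
    have "(\<Sum>b\<in>B'. laurent.lift (q b * p b) * [:b:]) =
        (\<Sum>b\<in>B'. laurent.lift (q b) * (laurent.lift (p b) * [:b:] - lform i * w b))
        + lform i * (\<Sum>b\<in>B'. laurent.lift (q b) * w b)"
      by (simp add: laurent.lift_mult right_diff_distrib sum_subtractf sum_distrib_left mult_ac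
          del: mult_pCons_right mult_pCons_left)
    also have "\<dots> \<in> polys (V ?a')"
      by (intro laurent.polys_add laurent.polys_sum laurent.polys_lift_mult
          subspace_V pw(3) lV q)
    finally have "\<forall>b\<in>B'. q b * p b = 0" by (rule laurent.quotient_basis_poly_independent[OF B'(1)])
    then show "\<forall>b\<in>B'. q b = 0" using pw(1) by simp
  qed
  then show ?thesis using B B' by simp
qed

text \<open>
  A form of degree \<open>a + e\<^sub>i + e\<^sub>k\<close> is a combination of products of a variable of degree \<open>e\<^sub>k\<close> with
  monomials of degree \<open>a + e\<^sub>i\<close>, and the preimages of the latter can be multiplied by the same variable.
  The degree \<open>a + e\<^sub>i\<close> has to be nonnegative, since otherwise such variables need not exist.
\<close>

lemma torsion_cokernel_step:
  assumes tor: "torsion_cokernel i a" and a: "0 \<le> deg_at i 1 + a"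
  shows "torsion_cokernel i (deg_at k 1 + a)"
proof -
  let ?b = "deg_at i 1 + (deg_at k 1 + a)"
  define T where "T = {g \<in> R ?b. \<exists>p w. p \<noteq> 0 \<and> w \<in> polys (R (deg_at k 1 + a)) \<and>
      laurent.lift p * [:g:] - lform i * w \<in> polys (V ?b)}"
  have deg: "?b = deg_at k 1 + (deg_at i 1 + a)" by (simp add: algebra_simps)
  have T: "laurent.subspace T"
    unfolding laurent.subspace_def
  proof (intro conjI ballI allI)
    show "0 \<in> T"
      using laurent.subspace_zero[OF subspace_graded] laurent.subspace_zero[OF subspace_V]
      unfolding T_def by (intro CollectI conjI exI[of _ 1] exI[of _ 0]) (auto simp: polys_def)
  next
    fix g h assume "g \<in> T" "h \<in> T"
    then obtain p w q v where g: "g \<in> R ?b" "p \<noteq> 0" "w \<in> polys (R (deg_at k 1 + a))"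
        "laurent.lift p * [:g:] - lform i * w \<in> polys (V ?b)"
      and h: "h \<in> R ?b" "q \<noteq> 0" "v \<in> polys (R (deg_at k 1 + a))"
        "laurent.lift q * [:h:] - lform i * v \<in> polys (V ?b)"
      unfolding T_def by blast
    have "laurent.lift (p * q) * [:g + h:] - lform i * (laurent.lift q * w + laurent.lift p * v) =
        laurent.lift q * (laurent.lift p * [:g:] - lform i * w) + laurent.lift p * (laurent.lift q * [:h:] - lform i * v)"
    proof -
      have "[:g + h:] = [:g:] + [:h:]" by simp
      then show ?thesis
        by (simp only: laurent.lift_mult algebra_simps)
    qed
    also have "\<dots> \<in> polys (V ?b)"
      by (intro laurent.polys_add laurent.polys_lift_mult subspace_V g h)
    finally show "g + h \<in> T"
      unfolding T_def using g h
      by (intro CollectI conjI exI[of _ "p * q"] exI[of _ "laurent.lift q * w + laurent.lift p * v"]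
          graded_add laurent.polys_add laurent.polys_lift_mult subspace_graded) auto
  next
    fix c g assume "g \<in> T"
    then obtain p w where g: "g \<in> R ?b" "p \<noteq> 0" "w \<in> polys (R (deg_at k 1 + a))"
        "laurent.lift p * [:g:] - lform i * w \<in> polys (V ?b)"
      unfolding T_def by blast
    have "laurent.lift p * [:const c * g:] - lform i * (laurent.lift [:c:] * w) =
        laurent.lift [:c:] * (laurent.lift p * [:g:] - lform i * w)"
    proof -
      have "[:const c * g:] = laurent.lift [:c:] * [:g:]" by (simp add: map_poly_pCons)
      then show ?thesis by (simp only: algebra_simps)
    qed
    also have "\<dots> \<in> polys (V ?b)"
      by (intro laurent.polys_lift_mult subspace_V g)
    finally show "const c * g \<in> T"
      unfolding T_def using g
      by (intro CollectI conjI exI[of _ p] exI[of _ "laurent.lift [:c:] * w"]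
          graded_scale laurent.polys_lift_mult subspace_graded) auto
  qed
  have mono: "single m 1 \<in> T" if m: "admissible UNIV n {} m" "multidegree n m = ?b" for m
  proof -
    have nn: "0 \<le> lookup m v" for v using m(1) admissible_nonneg by blast
    \<comment> \<open>The monomial contains a variable of degree \<open>e\<^sub>k\<close>.\<close>
    have "1 \<le> ?b k" using a by (simp add: deg le_fun_def deg_at_def)
    then have "0 < (\<Sum>j\<le>n k. lookup m (k, j))"
      using fun_cong[OF m(2), of k] by (simp add: multidegree_def)
    moreover have "(\<Sum>j\<le>n k. lookup m (k, j)) \<le> 0"
      if "\<And>j. j \<le> n k \<Longrightarrow> lookup m (k, j) \<le> 0" using that by (intro sum_nonpos) auto
    ultimately obtain j where j: "j \<le> n k" "0 < lookup m (k, j)"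
      by (meson not_less)
    define l where "l = m + single (k, j) (- 1)"
    have "keys l \<subseteq> vars UNIV n"
      using m(1) j(1) keys_add[of m "single (k, j) (- 1)"]
      unfolding admissible_def l_def by (auto simp: vars_def)
    moreover have "0 \<le> lookup l v" for v
      using nn[of v] j(2) by (auto simp: l_def lookup_add lookup_single when_def)
    ultimately have "admissible UNIV n {} l" by (simp add: admissible_def)
    moreover have "multidegree n l = deg_at i 1 + a"
      using j(1) by (simp add: l_def multidegree_add m(2) multidegree_single deg_at_def fun_eq_iff)
    ultimately have l: "single l 1 \<in> R (deg_at i 1 + a)" by (rule graded_single)
    then obtain p w where pw: "p \<noteq> 0" "w \<in> polys (R a)"
        "laurent.lift p * [:single l 1:] - lform i * w \<in> polys (V (deg_at i 1 + a))"
      using tor unfolding torsion_cokernel_def by blast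
    have x: "xpow (k, j) 1 \<in> R (deg_at k 1)" using j(1) by (rule variable_form)
    have xl: "single m 1 = xpow (k, j) 1 * single l 1"
      by (simp add: xpow_def mult_single l_def algebra_simps flip: single_add)
    have "laurent.lift p * [:single m 1:] - lform i * smult (xpow (k, j) 1) w =
        smult (xpow (k, j) 1) (laurent.lift p * [:single l 1:] - lform i * w)"
      by (simp add: xl smult_diff_right mult.commute)
    also have "\<dots> \<in> polys (V ?b)"
      unfolding deg using pw(3) by (intro polysI) (auto simp del: coeff_diff intro!: V_mult[OF _ x] polysD)
    finally show ?thesis
      unfolding T_def using pw(1,2) graded_mult[OF x l, of UNIV "{}" ?b] polys_smult_forms[OF pw(2) x]
      by (intro CollectI conjI exI[of _ p] exI[of _ "smult (xpow (k, j) 1) w"]) (auto simp: xl deg)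
  qed
  have "g \<in> T" if "g \<in> R ?b" for g
    by (rule subspace_contains_if_monomials[OF T], rule mono) (use that in \<open>auto simp: graded_iff\<close>)
  then show ?thesis unfolding torsion_cokernel_def T_def by blast
qed

lemma torsion_cokernel_above:
  assumes tor: "torsion_cokernel i a" and a: "0 \<le> deg_at i 1 + a" and b: "a \<le> b"
  shows "torsion_cokernel i b"
  using b
proof (induction "nat (\<Sum>k\<in>UNIV. b k - a k)" arbitrary: b)
  case 0
  then have "(\<Sum>k\<in>UNIV. b k - a k) = 0" by (intro antisym sum_nonneg) (auto simp: le_fun_def)
  then have "\<forall>k\<in>UNIV. b k - a k = 0"
    using 0 by (subst (asm) sum_nonneg_eq_0_iff) (auto simp: le_fun_def)
  then have "b = a" by (auto simp: fun_eq_iff)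
  then show ?case using tor by simp
next
  case (Suc m)
  have "(\<Sum>k\<in>UNIV. b k - a k) > 0" using Suc.hyps(2) by linarith
  moreover have "(\<Sum>k\<in>UNIV. b k - a k) \<le> 0" if "\<And>k. b k - a k \<le> 0" using that by (intro sum_nonpos)
  ultimately obtain k where k: "b k - a k > 0" by (meson not_less)
  define b' where "b' = b - deg_at k 1"
  have le: "a \<le> b'" using Suc.prems k by (auto simp: b'_def le_fun_def deg_at_def)
  have "(\<Sum>l\<in>UNIV. deg_at k 1 l) = (1::int)" by (simp add: deg_at_def)
  then have "(\<Sum>l\<in>UNIV. b' l - a l) = (\<Sum>l\<in>UNIV. b l - a l) - 1"
    by (simp add: b'_def sum_subtractf)
  then have "m = nat (\<Sum>k\<in>UNIV. b' k - a k)" using Suc.hyps(2) by simp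
  then have "torsion_cokernel i b'" using le by (rule Suc.hyps(1))
  moreover have "0 \<le> deg_at i 1 + b'" using a le by (auto simp: le_fun_def) (meson add_left_mono order_trans)
  ultimately have "torsion_cokernel i (deg_at k 1 + b')" by (rule torsion_cokernel_step)
  then show ?case by (simp add: b'_def)
qed

text \<open>
  One coincidence of neighbouring values in direction \<open>i\<close> propagates to all larger degrees. It is
  essential that the larger degree may differ from \<open>a\<close> in every coordinate: this carries a
  statement about one factor over to the product.
\<close>

lemma hilbert_function_stationary_above:
  assumes "H (deg_at i 1 + a) = H a" "0 \<le> deg_at i 1 + a" "a \<le> b"
  shows "H (deg_at i 1 + b) = H b"
  using hilbert_function_mono[of b i]
    hilbert_function_le_if_torsion_cokernel[OF torsion_cokernel_above[OF
      torsion_cokernel_if_stationary[OF assms(1)] assms(2,3)]]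
  by simp

end

section \<open>The projection to one factor\<close>

lemma chart_vars_singleton: "chart_vars {i} c = {(i, c i)}"
  by (auto simp: chart_vars_def)

lemma chart_monom_singleton: "chart_monom {i} c a = xpow (i, c i) (a i)"
  by (simp add: chart_monom_def xpow_def)

lemma polys_ideal:
  assumes C: "subring_set C" and P: "ideal_set C P"
  shows "ideal_set (polys C) (polys P)"
  unfolding ideal_set_def
proof (intro conjI ballI)
  note I = P C
  show "polys P \<subseteq> polys C" using ideal_carrier[OF I] by (auto simp: polys_def)
  show "0 \<in> polys P" using ideal_zero[OF I] by (simp add: polys_def)
  fix f g assume "f \<in> polys P" "g \<in> polys P"
  then show "f + g \<in> polys P" using ideal_add[OF I] by (simp add: polys_def)
next
  fix f g assume fg: "f \<in> polys C" "g \<in> polys P"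
  show "f * g \<in> polys P"
    by (intro polysI, unfold coeff_mult)
      (intro ideal_sum[OF P C] ideal_mult_left[OF P C] polysD[OF fg(1)] polysD[OF fg(2)])
qed

lemma finite_charts: "finite Q \<Longrightarrow> finite (charts Q n)"
  unfolding charts_def by (intro finite_PiE) auto

lemma forms_in_chart:
  assumes "f \<in> graded_piece {i} n {(i, c i)} (deg_at i k)" "c i \<le> n i"
  shows "xpow (i, c i) (- k) * f \<in> chart_functions {i} n c"
  unfolding chart_vars_singleton
  by (rule graded_mult[OF xpow_graded assms(1)]) (use assms(2) in \<open>auto simp: deg_at_add\<close>)

text \<open>
  A family of polynomials of bounded degree is a polynomial whose coefficients are families.
\<close>

lemma family_of_polys:
  fixes S :: "'c \<Rightarrow> 'v::comm_ring_1 poly"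
  assumes A: "finite A"
  shows "\<exists>F :: ('c \<Rightarrow> 'v) poly. \<forall>k c. coeff F k c = (if c \<in> A then coeff (S c) k else 0)"
proof -
  define N where "N = (\<Sum>c\<in>A. degree (S c))"
  define F where "F = (\<Sum>k\<le>N. monom (\<lambda>c. if c \<in> A then coeff (S c) k else 0) k)"
  have "coeff F k c = (if c \<in> A then coeff (S c) k else 0)" for k c
  proof -
    have "coeff F k = (if k \<le> N then (\<lambda>c. if c \<in> A then coeff (S c) k else 0) else 0)"
      by (simp add: F_def coeff_sum)
    moreover have "coeff (S c) k = 0" if "c \<in> A" "\<not> k \<le> N"
    proof -
      have "degree (S c) \<le> N" unfolding N_def using A that(1) by (intro member_le_sum) auto
      then show ?thesis using that(2) by (intro coeff_eq_0) simp
    qed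
    ultimately show ?thesis by auto
  qed
  then show ?thesis by blast
qed

interpretation fam: field_algebra "\<lambda>k (c :: 'c). const k :: ('q, 'k::field) laurent"
  by standard (auto simp: fun_eq_iff single_add mult_single)

context subscheme
begin

abbreviation D :: "'q \<Rightarrow> ('q \<Rightarrow> nat) \<Rightarrow> ('q, 'k) laurent set" where
  "D i c \<equiv> chart_functions {i} n c"
abbreviation Z :: "'q \<Rightarrow> ('q \<Rightarrow> nat) \<Rightarrow> ('q, 'k) laurent set" where
  "Z i c \<equiv> projection n X i c"

text \<open>
  The ideal of the projection consists of the functions that become forms vanishing on \<open>X\<close> after
  multiplication by a power of the chart variable.
\<close>

lemma projection_iff:
  assumes c: "c i \<le> n i"
  shows "f \<in> Z i c \<longleftrightarrow> f \<in> D i c \<and> (\<exists>k::nat. xpow (i, c i) (int k) * f \<in> V (deg_at i (int k)))"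
proof -
  have "xpow (i, c i) (int k) * f \<in> ideal_of UNIV n X \<inter> localization {i} n {} \<longleftrightarrow>
      xpow (i, c i) (int k) * f \<in> V (deg_at i (int k))" if f: "f \<in> D i c" for k
  proof
    let ?g = "xpow (i, c i) (int k) * f"
    have g: "?g \<in> graded_piece {i} n {(i, c i)} (deg_at i (int k))"
      using f c unfolding chart_vars_singleton by (intro graded_mult[OF xpow_graded]) auto
    {
      assume *: "?g \<in> ideal_of UNIV n X \<inter> localization {i} n {}"
      then have "?g \<in> forms {i} n (deg_at i (int k))" using g by (auto simp: graded_piece_def)
      then have "?g \<in> R (deg_at i (int k))" by (rule graded_mono) auto
      then show "?g \<in> V (deg_at i (int k))" using * forms_inter_ideal_of by blast
    next
      assume *: "?g \<in> V (deg_at i (int k))"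
      then have "?g \<in> R (deg_at i (int k))" "?g \<in> ideal_of UNIV n X"
        using forms_inter_ideal_of by blast+
      then show "?g \<in> ideal_of UNIV n X \<inter> localization {i} n {}"
        using forms_single_factor[of ?g n i "int k"] by (simp add: graded_piece_def)
    }
  qed
  then show ?thesis
    unfolding projection_def subscheme_of_def coordinate_ring_def chart_ring_def
    by (auto simp: subring_of_def chart_monom_singleton)
qed

lemma V_xpow_mono:
  assumes f: "xpow (i, j) (int k) * f \<in> V (deg_at i (int k))" and "k \<le> l" "j \<le> n i"
  shows "xpow (i, j) (int l) * f \<in> V (deg_at i (int l))"
proof -
  have "xpow (i, j) (int (l - k)) \<in> R (deg_at i (int (l - k)))"
    using assms by (intro xpow_graded) auto
  from V_mult[OF f this] show ?thesis
    using assms(2) by (simp add: mult.assoc[symmetric] deg_at_add flip: xpow_add)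
qed

lemma projection_ideal:
  assumes c: "c i \<le> n i"
  shows "ideal_set (D i c) (Z i c)"
  unfolding ideal_set_def
proof (intro conjI ballI)
  show "Z i c \<subseteq> D i c" using projection_iff[of c, OF c] by blast
  show "0 \<in> Z i c"
    unfolding projection_iff[of c, OF c]
    using laurent.subspace_zero[OF subspace_graded] laurent.subspace_zero[OF subspace_V] by simp
  fix f g assume "f \<in> Z i c" "g \<in> Z i c"
  then obtain k l where fg: "f \<in> D i c" "g \<in> D i c"
      "xpow (i, c i) (int k) * f \<in> V (deg_at i (int k))" "xpow (i, c i) (int l) * g \<in> V (deg_at i (int l))"
    using projection_iff[of c, OF c] by blast
  have "xpow (i, c i) (int (max k l)) * f + xpow (i, c i) (int (max k l)) * g \<in> V (deg_at i (int (max k l)))"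
    using fg c by (intro laurent.subspace_add[OF subspace_V] V_xpow_mono[OF fg(3)] V_xpow_mono[OF fg(4)]) auto
  then show "f + g \<in> Z i c"
    unfolding projection_iff[of c, OF c] distrib_left[symmetric] using fg by (blast intro: graded_add)
next
  fix r f assume r: "r \<in> D i c" and "f \<in> Z i c"
  then obtain k where f: "f \<in> D i c" "xpow (i, c i) (int k) * f \<in> V (deg_at i (int k))"
    using projection_iff[of c, OF c] by blast
  obtain m where "xpow (i, c i) (int m) * r \<in> graded_piece {i} n {} (deg_at i (int m) + 0)"
    using clear_denominators[of r "{i}" n i "c i" "{}" 0] r c by (auto simp: chart_vars_singleton)
  then have "xpow (i, c i) (int m) * r \<in> R (deg_at i (int m))"
    by (auto intro: graded_mono)
  from V_mult[OF f(2) this] have "xpow (i, c i) (int (m + k)) * (r * f) \<in> V (deg_at i (int (m + k)))"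
    by (simp add: deg_at_add xpow_add mult_ac)
  then show "r * f \<in> Z i c"
    unfolding projection_iff[of c, OF c] using r f(1) subring_mult[OF subring_graded] by blast
qed

lemma subspace_projection: "c i \<le> n i \<Longrightarrow> laurent.subspace (Z i c)"
  by (rule laurent.subspace_if_ideal[OF projection_ideal range_const_subset])

text \<open>
  The two charts differ only in the factor \<open>i\<close>, so their overlap is obtained from the chart \<open>e\<close> by
  inverting \<open>x\<^sub>i\<^sub>j / x\<^sub>i\<^sub>,\<^sub>e\<^sub>(\<^sub>i\<^sub>)\<close>. The ideals of \<open>X\<close> on both charts generate the same ideal there, hence \<open>f\<close>
  lies in \<open>X e\<close> up to a power of this element.
\<close>

lemma charts_agree_after_clearing:
  assumes d: "d \<in> charts UNIV n" and e: "e \<in> charts UNIV n" and de: "d = e(i := j)" and f: "f \<in> X d"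
  shows "\<exists>k0. \<forall>k\<ge>k0. xpow (i, j) (int k) * xpow (i, e i) (- int k) * f \<in> X e"
proof -
  define t where "t k = (xpow (i, j) (int k) * xpow (i, e i) (- int k) :: ('q, 'k) laurent)" for k
  have t_add: "t (k + l) = t k * t l" for k l
  proof -
    have "- int (k + l) = - int k + - int l" by simp
    then show ?thesis unfolding t_def by (simp only: xpow_add of_nat_add mult_ac)
  qed
  have j: "j \<le> n i" using chartsD[OF d, of i] de by simp
  have ei: "e i \<le> n i" using chartsD[OF e] by simp
  let ?C = "chart_functions UNIV n e"
  let ?O = "graded_piece UNIV n (chart_vars UNIV d \<union> chart_vars UNIV e) 0 :: ('q, 'k) laurent set"
  have vars: "chart_vars UNIV d \<union> chart_vars UNIV e \<subseteq> insert (i, j) (chart_vars UNIV e)"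
    by (auto simp: chart_vars_def de)
  have C_sub: "?C \<subseteq> ?O" by (auto intro: graded_mono)
  have I: "ideal_set ?C (X e)" by (rule ideal_chart[OF e])
  note IC = I subring_graded
  \<comment> \<open>The functions on the overlap that come into \<open>X e\<close> form an ideal containing \<open>X e\<close>.\<close>
  define Y where "Y = {g \<in> ?O. \<exists>k0. \<forall>k\<ge>k0. t k * g \<in> X e}"
  have tC: "t k \<in> ?C" for k
    unfolding t_def using j ei
    by (intro graded_mult[OF xpow_graded xpow_graded]) (auto simp: chart_vars_def deg_at_add)
  have "ideal_set ?O Y"
    unfolding ideal_set_def
  proof (intro conjI ballI)
    show "Y \<subseteq> ?O" "0 \<in> Y"
      using laurent.subspace_zero[OF subspace_graded] ideal_zero[OF IC] by (auto simp: Y_def)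
    fix g h assume "g \<in> Y" "h \<in> Y"
    then obtain a b where gh: "g \<in> ?O" "h \<in> ?O" "\<And>k. a \<le> k \<Longrightarrow> t k * g \<in> X e" "\<And>k. b \<le> k \<Longrightarrow> t k * h \<in> X e"
      by (auto simp: Y_def)
    then have "t k * (g + h) \<in> X e" if "max a b \<le> k" for k
      unfolding distrib_left using that by (intro ideal_add[OF IC]) auto
    then show "g + h \<in> Y" unfolding Y_def using gh graded_add by blast
  next
    fix r g assume r: "r \<in> ?O" and "g \<in> Y"
    then obtain a where g: "g \<in> ?O" "\<And>k. a \<le> k \<Longrightarrow> t k * g \<in> X e" by (auto simp: Y_def)
    have "r \<in> graded_piece UNIV n (insert (i, j) (chart_vars UNIV e)) 0"
      using r vars by (auto intro: graded_mono)
    from clear_denominators[OF this UNIV_I j]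
    obtain m where m: "xpow (i, j) (int m) * r \<in> graded_piece UNIV n (chart_vars UNIV e) (deg_at i (int m) + 0)"
      by blast
    have "xpow (i, e i) (- int m) * (xpow (i, j) (int m) * r) \<in> ?C"
      using ei by (intro graded_mult[OF xpow_graded m]) (auto simp: chart_vars_def deg_at_add)
    then have tr: "t m * r \<in> ?C" by (simp add: t_def mult_ac)
    have "t k * (r * g) \<in> X e" if "m + a \<le> k" for k
    proof -
      have "(t m * r) * (t (k - m) * g) \<in> X e"
        using that by (intro ideal_mult_left[OF IC tr] g) auto
      moreover have "t k = t m * t (k - m)" using that by (simp flip: t_add)
      ultimately show ?thesis by (simp add: mult_ac)
    qed
    then show "r * g \<in> Y" unfolding Y_def using r g(1) subring_mult[OF subring_graded] by blast
  qed
  moreover have "X e \<subseteq> Y"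
    using ideal_mult_left[OF IC tC] ideal_carrier[OF IC] C_sub by (auto simp: Y_def)
  ultimately have "genideal (subring_of ?O) (X e) \<subseteq> Y"
    using ideal_carrier[OF IC] C_sub by (intro genideal_subring_of(3)[OF subring_graded]) auto
  moreover have "X d \<subseteq> genideal (subring_of ?O) (X d)"
  proof (rule genideal_subring_of(2)[OF subring_graded])
    have "X d \<subseteq> chart_functions UNIV n d"
      using ideal_carrier[OF ideal_chart[OF d] subring_graded] by blast
    also have "\<dots> \<subseteq> ?O" by (auto intro: graded_mono)
    finally show "X d \<subseteq> ?O" .
  qed
  moreover have "genideal (subring_of ?O) (X d) = genideal (subring_of ?O) (X e)"
    using closed d e unfolding closed_subscheme_def overlap_ring_def by blast
  ultimately show ?thesis using f unfolding Y_def t_def by blast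
qed

text \<open>
  The projection is the scheme-theoretic image: a function on a chart of the factor vanishes on it
  as soon as its pullback vanishes on those charts of \<open>X\<close> that lie above.
\<close>

lemma projection_if_in_charts:
  assumes c: "c i \<le> n i" and f: "f \<in> D i c" "\<And>d. d \<in> charts UNIV n \<Longrightarrow> d i = c i \<Longrightarrow> f \<in> X d"
  shows "f \<in> Z i c"
proof -
  have "\<forall>e\<in>charts UNIV n. \<exists>k0. \<forall>k\<ge>k0. xpow (i, c i) (int k) * xpow (i, e i) (- int k) * f \<in> X e"
  proof
    fix e assume e: "e \<in> charts UNIV n"
    have d: "e(i := c i) \<in> charts UNIV n" using e c by (auto simp: charts_def PiE_def)
    show "\<exists>k0. \<forall>k\<ge>k0. xpow (i, c i) (int k) * xpow (i, e i) (- int k) * f \<in> X e"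
      by (rule charts_agree_after_clearing[OF d e refl f(2)[OF d]]) simp
  qed
  then obtain K where K: "\<And>e k. e \<in> charts UNIV n \<Longrightarrow> K e \<le> k \<Longrightarrow>
      xpow (i, c i) (int k) * xpow (i, e i) (- int k) * f \<in> X e" by metis
  obtain m where m: "\<And>k. m \<le> k \<Longrightarrow> xpow (i, c i) (int k) * f \<in> graded_piece {i} n {} (deg_at i (int k) + 0)"
    using clear_denominators[of f "{i}" n i "c i" "{}" 0] f(1) c by (auto simp: chart_vars_singleton)
  define k where "k = m + (\<Sum>e\<in>charts UNIV n. K e)"
  have Kk: "K e \<le> k" if "e \<in> charts UNIV n" for e
    using member_le_sum[OF that, of K] finite_charts[of UNIV n] by (simp add: k_def)
  have "xpow (i, c i) (int k) * f \<in> V (deg_at i (int k))"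
    unfolding V_iff
  proof (intro conjI ballI)
    show "xpow (i, c i) (int k) * f \<in> R (deg_at i (int k))"
      using m[of k] by (auto simp: k_def intro: graded_mono)
    fix e assume e: "e \<in> charts UNIV n"
    have "- deg_at i (int k) = deg_at i (- int k)" by (auto simp: deg_at_def)
    then show "xpow (i, c i) (int k) * f * chart_monom UNIV e (- deg_at i (int k)) \<in> X e"
      using K[OF e Kk[OF e]] by (simp add: chart_monom_deg_at mult_ac)
  qed
  then show ?thesis using f(1) projection_iff[of c, OF c] by blast
qed

text \<open>
  The coordinate functions are algebraic modulo the ideal of \<open>X\<close> on each chart above \<open>c\<close>; the
  product of the relations is a relation modulo the ideal of the projection.
\<close>

lemma projection_spanned:
  assumes zd: "zero_dimensional UNIV n X" and c: "c \<in> charts {i} n"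
  shows "\<exists>G. laurent.spans_mod G (Z i c) (D i c)"
proof -
  have ci: "c i \<le> n i" using chartsD[OF c] by simp
  obtain vs where vs: "set vs = vars {i} n" using finite_list[OF finite_vars[of "{i}" n]] by auto
  let ?ys = "map (chart_coord c) vs :: ('q, 'k) laurent list"
  have "y \<in> D i c \<and> (\<exists>p. p \<noteq> 0 \<and> poly (laurent.lift p) y \<in> Z i c)" if "y \<in> set ?ys" for y
  proof
    show y: "y \<in> D i c" using chart_coords_in_chart[OF c vs] that by auto
    define A where "A = {d \<in> charts UNIV n. d i = c i}"
    have A: "finite A" unfolding A_def using finite_charts[of UNIV n] by simp
    have yd: "y \<in> chart_functions UNIV n d" if "d \<in> A" for d
      using that by (intro graded_mono[OF y]) (auto simp: A_def chart_vars_def)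
    have "\<forall>d\<in>A. \<exists>p. p \<noteq> 0 \<and> poly (laurent.lift p) y \<in> X d"
      using zero_dimensional_algebraic[OF closed zd _ yd] by (auto simp: A_def)
    then obtain P where P: "\<And>d. d \<in> A \<Longrightarrow> P d \<noteq> 0" "\<And>d. d \<in> A \<Longrightarrow> poly (laurent.lift (P d)) y \<in> X d"
      by metis
    have lift_in: "poly (laurent.lift p) y \<in> graded_piece Q n W 0" if "y \<in> graded_piece Q n W 0" for p Q W
      by (intro poly_in_subring subring_graded polysI that) (simp add: graded_const)
    have "poly (laurent.lift (prod P A)) y \<in> Z i c"
    proof (rule projection_if_in_charts[where f = "poly (laurent.lift (prod P A)) y", OF ci lift_in[OF y]])
      fix d assume "d \<in> charts UNIV n" "d i = c i"
      then have d: "d \<in> A" "d \<in> charts UNIV n" by (auto simp: A_def)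
      have "prod P A = prod P (A - {d}) * P d"
        using A d(1) by (subst prod.remove[of _ d]) (auto simp: mult.commute)
      then have "poly (laurent.lift (prod P A)) y =
          poly (laurent.lift (prod P (A - {d}))) y * poly (laurent.lift (P d)) y"
        by (simp add: laurent.lift_mult)
      then show "poly (laurent.lift (prod P A)) y \<in> X d"
        using ideal_mult_left[OF ideal_chart[OF d(2)] subring_graded lift_in[OF yd[OF d(1)]] P(2)[OF d(1)]]
        by metis
    qed
    moreover have "prod P A \<noteq> 0" using P(1) A by simp
    ultimately show "\<exists>p. p \<noteq> 0 \<and> poly (laurent.lift p) y \<in> Z i c" by blast
  qed
  then obtain G where "laurent.spans_mod G (Z i c) (adjoin_list (range const) ?ys)"
    using laurent.adjoin_list_spanned_mod[OF subring_graded range_const_subset projection_ideal[of c, OF ci],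
        where ys = ?ys] by blast
  moreover have "D i c \<subseteq> adjoin_list (range const) ?ys"
    by (rule chart_ring_generated[OF c _ vs]) simp
  ultimately show ?thesis unfolding laurent.spans_mod_def by blast
qed

text \<open>
  Half of the compatibility of the ideals of the projection on overlaps: a form vanishing on \<open>X\<close>
  may be divided by the variable of either chart.
\<close>

lemma projection_overlap:
  assumes c: "c i \<le> n i" and d: "d i \<le> n i"
  defines "Ov \<equiv> graded_piece {i} n (chart_vars {i} c \<union> chart_vars {i} d) 0 :: ('q, 'k) laurent set"
  shows "Z i d \<subseteq> genideal (subring_of Ov) (Z i c)"
proof
  fix g assume "g \<in> Z i d"
  then obtain k where g: "g \<in> D i d" "xpow (i, d i) (int k) * g \<in> V (deg_at i (int k))"
    using projection_iff[of d, OF d] by blast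
  define h where "h = xpow (i, c i) (- int k) * (xpow (i, d i) (int k) * g)"
  have "xpow (i, d i) (int k) * g \<in> forms {i} n (deg_at i (int k))"
    using g(2) V_subset by (intro forms_single_factor) blast
  then have hD: "h \<in> D i c"
    unfolding h_def using c by (intro forms_in_chart) (auto intro: graded_mono)
  moreover have "xpow (i, c i) (int k) * h = xpow (i, d i) (int k) * g"
    by (simp add: h_def mult.assoc[symmetric])
  ultimately have h: "h \<in> Z i c" using g(2) projection_iff[of c, OF c] by metis
  have Ov: "subring_set Ov" unfolding Ov_def by (rule subring_graded)
  have ZO: "Z i c \<subseteq> Ov"
    using ideal_carrier[OF projection_ideal[of c, OF c] subring_graded]
    by (auto simp: Ov_def intro: graded_mono)
  have u: "xpow (i, c i) (int k) * xpow (i, d i) (- int k) \<in> Ov"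
    unfolding Ov_def using c d
    by (intro graded_mult[OF xpow_graded xpow_graded])
      (auto simp: deg_at_add chart_vars_singleton)
  have "xpow (i, c i) (int k) * xpow (i, d i) (- int k) * h \<in> genideal (subring_of Ov) (Z i c)"
    using genideal_subring_of(2)[OF Ov ZO] h
    by (intro ideal_mult_left[OF genideal_subring_of(1)[OF Ov ZO] Ov u]) auto
  also have "xpow (i, c i) (int k) * xpow (i, d i) (- int k) * h =
      (xpow (i, c i) (int k) * xpow (i, c i) (- int k)) * (xpow (i, d i) (int k) * xpow (i, d i) (- int k)) * g"
    unfolding h_def by (simp only: mult_ac)
  also have "\<dots> = g" by simp
  finally show "g \<in> genideal (subring_of Ov) (Z i c)" .
qed

lemma vanishing_if_in_projection:
  assumes f: "f \<in> R (deg_at i k)" and Z: "\<And>c. c \<in> charts {i} n \<Longrightarrow> xpow (i, c i) (- k) * f \<in> Z i c"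
  shows "f \<in> V (deg_at i k)"
  unfolding V_iff
proof (intro conjI ballI f)
  fix e assume e: "e \<in> charts UNIV n"
  \<comment> \<open>The chart of the factor below \<open>e\<close>.\<close>
  define c where "c = restrict e {i}"
  have c: "c \<in> charts {i} n" "c i = e i" using chartsD[OF e] by (auto simp: c_def charts_def)
  have "c i \<le> n i" using chartsD[OF e] c by simp
  then obtain l where "xpow (i, e i) (int l) * (xpow (i, e i) (- k) * f) \<in> V (deg_at i (int l))"
    using Z[OF c(1)] projection_iff[of c] c(2) by auto
  then have "xpow (i, e i) (int l) * (xpow (i, e i) (- k) * f) * chart_monom UNIV e (- deg_at i (int l)) \<in> X e"
    using e by (simp add: V_iff)
  moreover have "- deg_at i m = deg_at i (- m)" for m :: int by (auto simp: deg_at_def)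
  moreover have "xpow (i, e i) (int l) * (xpow (i, e i) (- k) * f) * xpow (i, e i) (- int l) =
      f * xpow (i, e i) (- k)"
  proof -
    have "xpow (i, e i) (int l) * (xpow (i, e i) (- k) * f) * xpow (i, e i) (- int l) =
        (xpow (i, e i) (int l) * xpow (i, e i) (- int l)) * (f * xpow (i, e i) (- k))"
      by (simp only: mult_ac)
    then show ?thesis by simp
  qed
  ultimately show "f * chart_monom UNIV e (- deg_at i k) \<in> X e"
    by (simp add: chart_monom_deg_at)
qed

lemma linear_form_dehomogenized:
  "smult (xpow (i, c i) (- 1)) (lform i) = laurent.generic_form (n i) (\<lambda>j. chart_coord c (i, j))"
  unfolding linear_form_def laurent.generic_form_def
  by (intro poly_eqI) (simp add: coeff_sum sum_distrib_left chart_coord_def mult.commute if_distrib cong: if_cong)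

lemma linear_form_on_chart:
  assumes c: "c \<in> charts {i} n"
  shows "smult (xpow (i, c i) (- 1)) (lform i) \<in> polys (D i c)"
  unfolding linear_form_dehomogenized laurent.generic_form_def
  using chart_coord_in_chart[OF c]
  by (intro subring_sum subring_polys polys_monom subring_graded) (auto simp: vars_def)

text \<open>
  On a chart the generic form, divided by the chart variable, is \<open>\<Sum>j. t^j x\<^sub>j / x\<^sub>c\<close>, in which one
  coefficient is \<open>1\<close>. So it is a nonzerodivisor on the finite-dimensional algebra \<open>D i c / Z i c\<close>,
  and it divides a nonzero polynomial \<open>p\<close> in \<open>K[t]\<close>, for which the norm would be the usual choice.
\<close>

lemma linear_form_invertible_on_chart:
  assumes zd: "zero_dimensional UNIV n X" and c: "c \<in> charts {i} n"
  shows "\<exists>p m. p \<noteq> 0 \<and> m \<in> polys (D i c) \<and>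
    smult (xpow (i, c i) (- 1)) (lform i) * m - laurent.lift p \<in> polys (Z i c)"
proof -
  have ci: "c i \<le> n i" using chartsD[OF c] by simp
  let ?l = "smult (xpow (i, c i) (- 1)) (lform i) :: ('q, 'k) laurent poly"
  let ?x = "\<lambda>j. chart_coord c (i, j) :: ('q, 'k) laurent"
  note l = linear_form_dehomogenized[of i c]
  have x: "?x j \<in> D i c" if "j \<le> n i" for j
    using chart_coord_in_chart[OF c, of "(i, j)"] that by (simp add: vars_def)
  have one: "?x (c i) = 1" by (simp add: chart_coord_def)
  note ZI = projection_ideal[of c, OF ci] subring_graded
  obtain G where G: "laurent.spans_mod G (Z i c) (D i c)" using projection_spanned[OF zd c] by blast
  obtain B where B: "quotient_basis laurent.scale (D i c) (Z i c) B"
    using laurent.quotient_basis_exists[OF subspace_projection[of c, OF ci] G subspace_graded] by blast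
  have "\<exists>p w. p \<noteq> 0 \<and> w \<in> polys (D i c) \<and> laurent.lift p * [:1:] - ?l * w \<in> polys (Z i c)"
  proof (rule laurent.torsion_cokernel_of_injective[OF subspace_graded subspace_graded
        subspace_projection[of c, OF ci] B B order_refl])
    show "?l * f \<in> polys (D i c)" if "f \<in> polys (D i c)" for f
      by (intro subring_mult[OF subring_polys[OF subring_graded]]
          linear_form_on_chart[OF c] that)
    show "1 \<in> D i c" by (rule subring_one[OF subring_graded])
    show "f \<in> polys (Z i c)" if "f \<in> polys (D i c)" "?l * f \<in> polys (Z i c)" for f
    proof (rule laurent.generic_form_nonzerodivisor[where F = "\<lambda>_. D i c" and V = "\<lambda>_. Z i c" and x = ?x and n = "n i"])
      show "laurent.subspace (Z i c)" by (rule subspace_projection[of c, OF ci])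
      show "?x j * f \<in> D i c" if "j \<le> n i" "f \<in> D i c" for j f
        using that by (intro subring_mult[OF subring_graded] x)
      show "?x j * f \<in> Z i c" if "j \<le> n i" "f \<in> Z i c" for j f
        using that by (intro ideal_mult_left[OF ZI] x)
      show "f \<in> Z i c" if "f \<in> D i c" "\<And>j. j \<le> n i \<Longrightarrow> ?x j * f \<in> Z i c" for f
        using that(2)[OF ci] one by simp
    qed (use that l in auto)
  qed
  then obtain p w where pw: "p \<noteq> 0" "w \<in> polys (D i c)" "laurent.lift p * [:1:] - ?l * w \<in> polys (Z i c)"
    by blast
  have "- (laurent.lift p * [:1:] - ?l * w) \<in> polys (Z i c)"
    by (rule laurent.polys_uminus[OF subspace_projection[of c, OF ci] pw(3)])
  then show ?thesis using pw(1,2) by (intro exI[of _ p] exI[of _ w]) simp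
qed

text \<open>
  Multiplying by the polynomials of the other charts gives the same \<open>p\<close> for all charts; only then
  the local inverses fit together.
\<close>

lemma linear_form_inverse:
  assumes zd: "zero_dimensional UNIV n X"
  obtains p m where "p \<noteq> 0" "\<And>c. c \<in> charts {i} n \<Longrightarrow> m c \<in> polys (D i c)"
    "\<And>c. c \<in> charts {i} n \<Longrightarrow>
      smult (xpow (i, c i) (- 1)) (lform i) * m c - laurent.lift p \<in> polys (Z i c)"
proof -
  let ?A = "charts {i} n"
  have A: "finite ?A" by (rule finite_charts) simp
  have "\<forall>c\<in>?A. \<exists>p m. p \<noteq> 0 \<and> m \<in> polys (D i c) \<and>
      smult (xpow (i, c i) (- 1)) (lform i) * m - laurent.lift p \<in> polys (Z i c)"
    using linear_form_invertible_on_chart[OF zd] by blast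
  then obtain p m where pm: "\<And>c. c \<in> ?A \<Longrightarrow> p c \<noteq> 0" "\<And>c. c \<in> ?A \<Longrightarrow> m c \<in> polys (D i c)"
      "\<And>c. c \<in> ?A \<Longrightarrow> smult (xpow (i, c i) (- 1)) (lform i) * m c - laurent.lift (p c) \<in> polys (Z i c)"
    by metis
  let ?q = "\<lambda>c. laurent.lift (prod p (?A - {c}))"
  show ?thesis
  proof (rule that[of "prod p ?A" "\<lambda>c. ?q c * m c"])
    show "prod p ?A \<noteq> 0" using pm(1) A by simp
    fix c assume c: "c \<in> ?A"
    have ci: "c i \<le> n i" using chartsD[OF c] by simp
    show "?q c * m c \<in> polys (D i c)"
      by (intro laurent.polys_lift_mult subspace_graded pm c)
    have eq: "laurent.lift (prod p ?A) = ?q c * laurent.lift (p c)"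
      using A c by (subst prod.remove[of _ c]) (auto simp: laurent.lift_mult mult.commute)
    have "smult (xpow (i, c i) (- 1)) (lform i) * (?q c * m c) - laurent.lift (prod p ?A) =
        ?q c * (smult (xpow (i, c i) (- 1)) (lform i) * m c - laurent.lift (p c))"
      unfolding eq by (simp only: right_diff_distrib mult.left_commute)
    then show "smult (xpow (i, c i) (- 1)) (lform i) * (?q c * m c) - laurent.lift (prod p ?A)
        \<in> polys (Z i c)"
      using laurent.polys_lift_mult[OF subspace_projection[of c, OF ci] pm(3)[OF c]] by simp
  qed
qed

section \<open>Global sections of the projection\<close>

abbreviation len :: "'q \<Rightarrow> nat" where "len i \<equiv> scheme_length {i} n (projection n X i)"
abbreviation sections :: "'q \<Rightarrow> (('q \<Rightarrow> nat) \<Rightarrow> ('q, 'k) laurent) set" where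
  "sections i \<equiv> section_families {i} n (projection n X i)"
abbreviation nulls :: "'q \<Rightarrow> (('q \<Rightarrow> nat) \<Rightarrow> ('q, 'k) laurent) set" where
  "nulls i \<equiv> null_families {i} n (projection n X i)"
abbreviation overlap :: "'q \<Rightarrow> ('q \<Rightarrow> nat) \<Rightarrow> ('q \<Rightarrow> nat) \<Rightarrow> ('q, 'k) laurent set" where
  "overlap i c d \<equiv> graded_piece {i} n (chart_vars {i} c \<union> chart_vars {i} d) 0"
abbreviation overlap_ideal :: "'q \<Rightarrow> ('q \<Rightarrow> nat) \<Rightarrow> ('q \<Rightarrow> nat) \<Rightarrow> ('q, 'k) laurent set" where
  "overlap_ideal i c d \<equiv> genideal (subring_of (overlap i c d)) (Z i c)"

lemma overlap_ideal:
  assumes "c i \<le> n i"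
  shows "ideal_set (overlap i c d) (overlap_ideal i c d)" "Z i c \<subseteq> overlap_ideal i c d"
proof -
  have "Z i c \<subseteq> overlap i c d"
    using ideal_carrier[OF projection_ideal[of c, OF assms] subring_graded]
    by (auto intro: graded_mono)
  then show "ideal_set (overlap i c d) (overlap_ideal i c d)" "Z i c \<subseteq> overlap_ideal i c d"
    using genideal_subring_of[OF subring_graded] by blast+
qed

lemma sections_iff:
  "s \<in> sections i \<longleftrightarrow> (\<forall>c. c \<notin> charts {i} n \<longrightarrow> s c = 0) \<and> (\<forall>c\<in>charts {i} n. s c \<in> D i c) \<and>
    (\<forall>c\<in>charts {i} n. \<forall>d\<in>charts {i} n. s c - s d \<in> overlap_ideal i c d)"
  by (simp add: section_families_def chart_ring_def overlap_ring_def) (simp add: subring_of_def)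

lemma nulls_iff:
  "s \<in> nulls i \<longleftrightarrow> (\<forall>c. c \<notin> charts {i} n \<longrightarrow> s c = 0) \<and> (\<forall>c\<in>charts {i} n. s c \<in> Z i c)"
  by (simp add: null_families_def)

lemma subspace_nulls: "fam.subspace (nulls i)"
proof -
  have "laurent.subspace (Z i c)" if "c \<in> charts {i} n" for c
    using chartsD[OF that, of i] by (intro subspace_projection) simp
  note Z = laurent.subspaceD(1-3)[OF this]
  show ?thesis
    unfolding fam.subspace_def by (simp add: nulls_iff Z)
qed

lemma subspace_sections: "fam.subspace (sections i)"
proof -
  have O: "laurent.subspace (overlap_ideal i c d)" if "c \<in> charts {i} n" for c d
    using chartsD[OF that, of i]
    by (intro laurent.subspace_if_ideal[OF overlap_ideal(1) range_const_subset]) simp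
  note O = laurent.subspaceD(1-3)[OF this] and D = laurent.subspaceD(1-3)[OF subspace_graded]
  show ?thesis
    unfolding fam.subspace_def
  proof (intro conjI ballI allI)
    show "0 \<in> sections i" by (simp add: sections_iff O D)
  next
    fix s t assume "s \<in> sections i" "t \<in> sections i"
    then show "s + t \<in> sections i" by (simp add: sections_iff O D add_diff_add)
  next
    fix s k assume "s \<in> sections i"
    then show "(\<lambda>c. const k) * s \<in> sections i"
      by (simp add: sections_iff O D right_diff_distrib[symmetric])
  qed
qed

text \<open>
  The global sections of the projection are finite-dimensional, being families of elements of the
  finite-dimensional algebras of the charts.
\<close>

lemma sections_basis:
  assumes zd: "zero_dimensional UNIV n X"
  obtains B where "quotient_basis fam.scale (sections i) (nulls i) B"
    "len i = card B"
proof -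
  let ?A = "charts {i} n"
  have A: "finite ?A" by (rule finite_charts) simp
  have "\<forall>c\<in>?A. \<exists>G. laurent.spans_mod G (Z i c) (D i c)"
    using projection_spanned[OF zd] by blast
  then obtain G where G: "\<And>c. c \<in> ?A \<Longrightarrow> laurent.spans_mod (G c) (Z i c) (D i c)" by metis
  define \<delta> where "\<delta> c g = (\<lambda>d. if d = c then g else 0)" for c :: "'q \<Rightarrow> nat" and g :: "('q, 'k) laurent"
  define F where "F = (\<Union>c\<in>?A. \<delta> c ` G c)"
  have F: "finite F" unfolding F_def using A G by (auto simp: laurent.spans_mod_def)
  let ?U = "fam.span_mod F (nulls i)"
  have U: "fam.subspace ?U" by (rule fam.subspace_span_mod[OF subspace_nulls])
  have "sections i \<subseteq> ?U"
  proof
    fix s assume s: "s \<in> sections i"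
    have "\<delta> c (s c) \<in> ?U" if c: "c \<in> ?A" for c
    proof -
      let ?T = "{v. \<delta> c v \<in> ?U}"
      have 0: "\<delta> c 0 = 0" and add: "\<delta> c (v + w) = \<delta> c v + \<delta> c w"
        and sc: "\<delta> c (const k * v) = (\<lambda>_. const k) * \<delta> c v" for v w k
        by (auto simp: \<delta>_def fun_eq_iff)
      have "laurent.subspace ?T"
        unfolding laurent.subspace_def
        using fam.subspaceD(1-3)[OF U] by (auto simp: 0 add sc)
      moreover have "Z i c \<subseteq> ?T"
      proof
        fix z assume "z \<in> Z i c"
        then have "\<delta> c z \<in> nulls i"
          using c laurent.subspace_zero[OF subspace_projection] chartsD[of _ "{i}" n i]
          by (auto simp: nulls_iff \<delta>_def)
        then show "z \<in> ?T" using fam.span_mod_base by blast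
      qed
      moreover have "G c \<subseteq> ?T"
        using fam.span_mod_generators[OF subspace_nulls F] c by (auto simp: F_def)
      ultimately have "laurent.span_mod (G c) (Z i c) \<subseteq> ?T" by (rule laurent.span_mod_minimal)
      moreover have "s c \<in> D i c" using s c by (simp add: sections_iff)
      ultimately show ?thesis using G[OF c] by (auto simp: laurent.spans_mod_def)
    qed
    then have "(\<Sum>c\<in>?A. \<delta> c (s c)) \<in> ?U" by (intro fam.subspace_sum[OF U])
    moreover have "(\<Sum>c\<in>?A. \<delta> c (s c)) = s"
    proof
      fix d
      have "(\<Sum>c\<in>?A. \<delta> c (s c)) d = (\<Sum>c\<in>?A. \<delta> c (s c) d)"
        by (induction rule: infinite_finite_induct) auto
      also have "\<dots> = (\<Sum>c\<in>?A. if c = d then s c else 0)"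
        by (intro sum.cong) (auto simp: \<delta>_def)
      also have "\<dots> = s d" using A s by (auto simp: sections_iff)
      finally show "(\<Sum>c\<in>?A. \<delta> c (s c)) d = s d" .
    qed
    ultimately show "s \<in> ?U" by simp
  qed
  then have "fam.spans_mod F (nulls i) (sections i)" using F by (simp add: fam.spans_mod_def)
  from fam.quotient_basis_exists[OF subspace_nulls this subspace_sections]
  obtain B where B: "quotient_basis fam.scale (sections i) (nulls i) B"
      "quotient_dim fam.scale (sections i) (nulls i) = card B"
    by (rule fam.quotient_dim_eq_card)
  moreover have "(\<lambda>k s c. scalar k (s c)) = (\<lambda>k s. (\<lambda>c :: 'q \<Rightarrow> nat. const k :: ('q, 'k) laurent) * s)"
    by (auto simp: scalar_def fun_eq_iff)
  ultimately show ?thesis using that by (simp add: scheme_length_def)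
qed

end

context subscheme
begin

text \<open>
  The generic form trivializes the twisting sheaf on the zero-dimensional projection: with
  \<open>\<mu>\<^sub>c\<close> such that \<open>(lform i / x\<^sub>c) \<mu>\<^sub>c = p\<close>, a form \<open>b\<close> of degree \<open>d\<close> is sent to the global section
  \<open>b x\<^sub>c^(-d) \<mu>\<^sub>c^d\<close>, which is \<open>p^d b / lform^d\<close> on every chart. Since \<open>p\<close> is not a zero divisor,
  this map is injective on forms modulo vanishing forms.
\<close>

lemma hilbert_function_le_length:
  assumes zd: "zero_dimensional UNIV n X"
  shows "H (deg_at i (int d)) \<le> int (len i)"
proof -
  let ?A = "charts {i} n"
  have A: "finite ?A" by (rule finite_charts) simp
  have ci: "c i \<le> n i" if "c \<in> ?A" for c using chartsD[OF that] by simp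
  obtain p m where p: "p \<noteq> 0" and m: "\<And>c. c \<in> ?A \<Longrightarrow> m c \<in> polys (D i c)"
    and inv: "\<And>c. c \<in> ?A \<Longrightarrow>
      smult (xpow (i, c i) (- 1)) (lform i) * m c - laurent.lift p \<in> polys (Z i c)"
    using linear_form_inverse[OF zd] by metis
  define l where "l c = (smult (xpow (i, c i) (- 1)) (lform i) :: ('q, 'k) laurent poly)" for c
  have l_D: "l c \<in> polys (D i c)" if "c \<in> ?A" for c
    unfolding l_def by (rule linear_form_on_chart[OF that])
  define \<psi> where "\<psi> c b = xpow (i, c i) (- int d) * b" for c :: "'q \<Rightarrow> nat" and b :: "('q, 'k) laurent"
  have \<psi>: "\<psi> c b \<in> D i c" if "c \<in> ?A" "b \<in> R (deg_at i (int d))" for b c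
    unfolding \<psi>_def using ci[OF that(1)] forms_single_factor[OF that(2)]
    by (intro forms_in_chart) (auto intro: graded_mono)
  \<comment> \<open>The local expressions of the section that belongs to the form \<open>b\<close>.\<close>
  define S where "S c b = smult (\<psi> c b) (m c ^ d)" for c b
  have S: "S c b \<in> polys (D i c)" if "c \<in> ?A" "b \<in> R (deg_at i (int d))" for b c
    unfolding S_def using that
    by (intro polys_smult subring_power subring_polys subring_graded m \<psi>)
  have S_glue: "S c b - S e b \<in> polys (overlap_ideal i c e)"
    if c: "c \<in> ?A" and e: "e \<in> ?A" and b: "b \<in> R (deg_at i (int d))" for b c e
  proof -
    let ?O = "overlap i c e" and ?G = "overlap_ideal i c e"
    let ?u = "xpow (i, c i) 1 * xpow (i, e i) (- 1) :: ('q, 'k) laurent"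
    note G = overlap_ideal[of c, OF ci[OF c], of e]
    note O = subring_polys[OF subring_graded]
    note PG = polys_ideal[OF subring_graded G(1)]
    have into: "f \<in> polys ?O" if "f \<in> polys (D i c) \<or> f \<in> polys (D i e)" for f
      using that by (auto simp: polys_def intro: graded_mono)
    have u: "?u \<in> ?O"
      using ci[OF c] ci[OF e]
      by (intro graded_mult[OF xpow_graded xpow_graded])
        (auto simp: deg_at_add chart_vars_singleton)
    have a: "smult ?u (m e) \<in> polys ?O"
      by (intro polys_smult subring_graded u into disjI2 m e)
    have 1: "l c * m c - laurent.lift p \<in> polys ?G"
      using inv[OF c] G(2) by (auto simp: polys_def l_def)
    have "l e * m e - laurent.lift p \<in> polys ?G"
      using inv[OF e] projection_overlap[of c i e, OF ci[OF c] ci[OF e]] by (auto simp: polys_def l_def)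
    moreover have "l c * smult ?u (m e) = l e * m e"
    proof -
      have "xpow (i, c i) 1 * xpow (i, e i) (- 1) * xpow (i, c i) (- 1) =
          ((xpow (i, c i) 1 * xpow (i, c i) (- 1)) * xpow (i, e i) (- 1) :: ('q, 'k) laurent)" by (simp only: mult_ac)
      then show ?thesis by (simp add: l_def)
    qed
    ultimately have 2: "l c * smult ?u (m e) - laurent.lift p \<in> polys ?G" by simp
    have "laurent.lift p * (m c - smult ?u (m e)) =
        smult ?u (m e) * (l c * m c - laurent.lift p) - m c * (l c * smult ?u (m e) - laurent.lift p)"
      by (simp only: algebra_simps)
    also have "\<dots> \<in> polys ?G"
      by (intro ideal_diff[OF PG O] ideal_mult_left[OF PG O a 1]
          ideal_mult_left[OF PG O into[OF disjI1[OF m[OF c]]] 2])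
    \<comment> \<open>On overlaps \<open>m c / x\<^sub>c = m e / x\<^sub>e\<close>, since both are inverse to \<open>lform i\<close> up to the factor \<open>p\<close>.\<close>
    finally have glue: "m c - smult ?u (m e) \<in> polys ?G"
      by (rule laurent.polys_torsion_free[OF laurent.subspace_if_ideal[OF G(1) range_const_subset] p])
    have "m c ^ d - smult ?u (m e) ^ d \<in> polys ?G"
      by (rule ideal_power_diff[OF PG O into[OF disjI1[OF m[OF c]]] a glue])
    moreover have "[:\<psi> c b:] \<in> polys ?O"
      by (intro into disjI1 polys_const subring_graded \<psi> c b)
    ultimately have "[:\<psi> c b:] * (m c ^ d - smult ?u (m e) ^ d) \<in> polys ?G"
      by (intro ideal_mult_left[OF PG O])
    also have "[:\<psi> c b:] * (m c ^ d - smult ?u (m e) ^ d) = S c b - smult (\<psi> c b * ?u ^ d) (m e ^ d)"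
      by (simp add: S_def smult_diff_right smult_power)
    also have "\<psi> c b * ?u ^ d = \<psi> e b"
    proof -
      have u_pow: "?u ^ d = xpow (i, c i) (int d) * xpow (i, e i) (- int d)"
        by (simp add: power_mult_distrib xpow_power)
      have "\<psi> c b * ?u ^ d = (xpow (i, c i) (- int d) * xpow (i, c i) (int d)) * (xpow (i, e i) (- int d) * b)"
        unfolding \<psi>_def u_pow by (simp only: mult_ac)
      then show ?thesis by (simp add: \<psi>_def)
    qed
    finally show ?thesis by (simp only: S_def)
  qed
  have "\<forall>b. \<exists>F. \<forall>k c. coeff F k c = (if c \<in> ?A then coeff (S c b) k else 0)"
    by (rule allI, rule family_of_polys[OF A])
  then obtain F where F: "\<And>b k c. coeff (F b) k c = (if c \<in> ?A then coeff (S c b) k else 0)" by metis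
  have F_sec: "F b \<in> polys (sections i)" if b: "b \<in> R (deg_at i (int d))" for b
  proof (rule polysI)
    show "coeff (F b) k \<in> sections i" for k
      using polysD[OF S[OF _ b]] polysD[OF S_glue[OF _ _ b], of _ _ k]
      by (simp add: sections_iff F)
  qed
  obtain B where B: "basis (deg_at i (int d)) B"
      "H (deg_at i (int d)) = int (card B)"
    by (rule hilbert_basis)
  obtain E where E: "quotient_basis fam.scale (sections i) (nulls i) E"
      "len i = card E"
    by (rule sections_basis[OF zd])
  have BR: "B \<subseteq> R (deg_at i (int d))" "finite B" using B by (auto simp: quotient_basis_def)
  have "card B \<le> card E"
  proof (rule fam.card_le_if_independent[where f = F, OF subspace_nulls E(1) BR(2)])
    show "F b \<in> polys (sections i)" if "b \<in> B" for b using F_sec that BR by blast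
    fix q assume q: "(\<Sum>b\<in>B. fam.lift (q b) * F b) \<in> polys (nulls i)"
    let ?f = "\<Sum>b\<in>B. laurent.lift (q b) * [:b:]"
    have fR: "?f \<in> polys (R (deg_at i (int d)))" by (rule poly_span_of_basis[OF BR(1)])
    have on_chart: "smult (xpow (i, c i) (- int d)) ?f \<in> polys (Z i c)" if c: "c \<in> ?A" for c
    proof -
      note ZI = polys_ideal[OF subring_graded projection_ideal[of c, OF ci[OF c]]]
      note PD = subring_polys[OF subring_graded]
      let ?g = "smult (xpow (i, c i) (- int d)) ?f"
      have g: "?g \<in> polys (D i c)"
        using \<psi>[OF c polysD[OF fR]] by (intro polysI) (simp add: \<psi>_def)
      have eq: "?g * m c ^ d = (\<Sum>b\<in>B. laurent.lift (q b) * S c b)"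
      proof -
        have S_eq: "S c b = [:xpow (i, c i) (- int d):] * ([:b:] * m c ^ d)" for b
          by (simp add: S_def \<psi>_def mult.commute)
        have g_eq: "?g = [:xpow (i, c i) (- int d):] * ?f" by simp
        show ?thesis unfolding S_eq g_eq by (simp only: sum_distrib_left sum_distrib_right mult_ac)
      qed
      have "coeff (\<Sum>b\<in>B. laurent.lift (q b) * S c b) k = coeff (\<Sum>b\<in>B. fam.lift (q b) * F b) k c" for k
      proof -
        have sum_app: "(\<Sum>x\<in>I. h x) c = (\<Sum>x\<in>I. h x c)" for I :: "'i set" and h :: "'i \<Rightarrow> ('q \<Rightarrow> nat) \<Rightarrow> ('q, 'k) laurent"
          by (induction I rule: infinite_finite_induct) auto
        show ?thesis
          using c by (simp add: coeff_sum coeff_mult sum_app F)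
      qed
      then have "?g * m c ^ d \<in> polys (Z i c)"
        unfolding eq using polysD[OF q] c by (intro polysI) (simp add: nulls_iff)
      \<comment> \<open>Multiplication by \<open>l c ^ d\<close> undoes the division, up to \<open>p ^ d\<close>.\<close>
      then have 1: "l c ^ d * (?g * m c ^ d) \<in> polys (Z i c)"
        by (rule ideal_mult_left[OF ZI PD subring_power[OF PD l_D[OF c]]])
      have p_D: "laurent.lift p \<in> polys (D i c)"
        by (intro polysI) (simp add: graded_const)
      have "(l c * m c) ^ d - laurent.lift p ^ d \<in> polys (Z i c)"
        using inv[OF c]
        by (intro ideal_power_diff[OF ZI PD] subring_mult[OF PD l_D[OF c] m[OF c]] p_D) (simp add: l_def)
      then have "?g * ((l c * m c) ^ d - laurent.lift p ^ d) \<in> polys (Z i c)"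
        by (rule ideal_mult_left[OF ZI PD g])
      from ideal_diff[OF ZI PD 1 this]
      have "l c ^ d * (?g * m c ^ d) - ?g * (l c ^ d * m c ^ d - laurent.lift (p ^ d)) \<in> polys (Z i c)"
        by (simp only: laurent.lift_power power_mult_distrib)
      moreover have "u * (g * v) - g * (u * v - w) = w * g" for u v w g :: "('q, 'k) laurent poly"
        by (simp add: algebra_simps)
      ultimately have "laurent.lift (p ^ d) * ?g \<in> polys (Z i c)" by metis
      then show ?thesis
        by (rule laurent.polys_torsion_free[OF subspace_projection[of c, OF ci[OF c]], rotated]) (use p in simp)
    qed
    have "?f \<in> polys (V (deg_at i (int d)))"
    proof (rule polysI, rule vanishing_if_in_projection)
      show "coeff ?f k \<in> R (deg_at i (int d))" for k by (rule polysD[OF fR])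
      show "xpow (i, c i) (- int d) * coeff ?f k \<in> Z i c" if "c \<in> ?A" for c k
        using polysD[OF on_chart[OF that], of k] by simp
    qed
    then show "\<forall>b\<in>B. q b = 0" by (rule laurent.quotient_basis_poly_independent[OF B(1)])
  qed
  then show ?thesis using B E by simp
qed

lemma hilbert_function_zero_degree:
  assumes zd: "zero_dimensional UNIV n X"
  shows "1 \<le> H 0"
proof (rule ccontr)
  obtain B where B: "basis 0 B" "H 0 = int (card B)"
    by (rule hilbert_basis)
  assume "\<not> 1 \<le> H 0"
  then have "card B = 0" using B(2) by linarith
  then have "B = {}" using B(1) by (simp add: quotient_basis_def)
  moreover have "1 \<in> R 0" by (rule subring_one[OF subring_graded])
  ultimately have "1 \<in> V 0" using B(1) by (auto simp: quotient_basis_def)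
  then have one: "1 \<in> X c" if "c \<in> charts UNIV n" for c
    using that by (simp add: V_iff)
  obtain c where c: "c \<in> charts UNIV n" "X c \<noteq> carrier (chart_ring UNIV n c)"
    using zd unfolding zero_dimensional_def by blast
  have "X c = chart_functions UNIV n c"
    using ideal_mult_left[OF ideal_chart[OF c(1)] subring_graded _ one[OF c(1)]]
      ideal_carrier[OF ideal_chart[OF c(1)] subring_graded] by auto
  then show False using c(2) by (simp add: chart_ring_def subring_of_def)
qed

text \<open>
  Along the \<open>i\<close>-th axis the Hilbert function starts at a value of at least \<open>1\<close>. If it increased strictly
  up to degree \<open>s\<close>, it would exceed the length \<open>s\<close>, which bounds it.
\<close>

lemma hilbert_function_stationary_before_length:
  assumes zd: "zero_dimensional UNIV n X"
  shows "\<exists>d. d < len i \<and>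
    H (deg_at i (int (Suc d))) = H (deg_at i (int d))"
proof (rule ccontr)
  assume no: "\<not> ?thesis"
  define s where "s = len i"
  have mono: "H (deg_at i (int d)) \<le> H (deg_at i (int (Suc d)))" for d
    using hilbert_function_mono[of "deg_at i (int d)" i] by (simp add: deg_at_add)
  have "int (Suc d) \<le> H (deg_at i (int d))" if "d \<le> s" for d
    using that
  proof (induction d)
    case 0
    show ?case using hilbert_function_zero_degree[OF zd] unfolding of_nat_0 deg_at_0 of_nat_Suc by linarith
  next
    case (Suc d)
    then have "H (deg_at i (int (Suc d))) \<noteq> H (deg_at i (int d))" using no by (auto simp: s_def)
    then show ?case using Suc mono[of d] by simp
  qed
  from this[of s] show False using hilbert_function_le_length[OF zd, of i s] by (simp add: s_def)
qed

lemma hilbert_function_stationary: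
  assumes zd: "zero_dimensional UNIV n X" and b: "0 \<le> b"
    "int (len i) \<le> b i"
  shows "H b = H (b - deg_at i 1)"
proof -
  obtain d where d: "d < len i"
      "H (deg_at i (int (Suc d))) = H (deg_at i (int d))"
    using hilbert_function_stationary_before_length[OF zd] by blast
  have "H (deg_at i 1 + (b - deg_at i 1)) = H (b - deg_at i 1)"
  proof (rule hilbert_function_stationary_above)
    show "H (deg_at i 1 + deg_at i (int d)) = H (deg_at i (int d))" using d(2) by (simp add: deg_at_add)
    show "0 \<le> deg_at i 1 + deg_at i (int d)" by (auto simp: le_fun_def deg_at_def)
    show "deg_at i (int d) \<le> b - deg_at i 1" using b d(1) by (auto simp: le_fun_def deg_at_def)
  qed
  then show ?thesis by simp
qed

lemma hilbert_function_outside: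
  assumes "\<not> 0 \<le> a"
  shows "H a = 0"
proof -
  obtain i where i: "a i < 0" using assms by (auto simp: le_fun_def not_le)
  have R0: "f = 0" if "f \<in> R a" for f
  proof -
    have False if "m \<in> keys f" for m
    proof -
      have "admissible UNIV n {} m" "multidegree n m = a"
        using \<open>f \<in> R a\<close> that by (auto simp: graded_iff)
      then have "0 \<le> a i"
        unfolding multidegree_def by (auto intro!: sum_nonneg admissible_nonneg)
      then show False using i by simp
    qed
    then show ?thesis by (intro poly_mapping_eqI) (auto simp: in_keys_iff)
  qed
  obtain B where B: "basis a B" "H a = int (card B)"
    by (rule hilbert_basis)
  have "b \<notin> B" for b
  proof
    assume b: "b \<in> B"
    have "(\<Sum>b\<in>B. const 1 * b) = 0"
      using B(1) R0 by (intro sum.neutral) (auto simp: quotient_basis_def)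
    then have "\<forall>b\<in>B. (1 :: 'k) = 0"
      using laurent.subspace_zero[OF subspace_V]
      by (intro laurent.quotient_basis_independent[OF B(1)]) simp
    then show False using b by simp
  qed
  then have "B = {}" by blast
  then show ?thesis using B(2) by simp
qed

end

section \<open>The difference function\<close>

lemma difference_function_alt:
  fixes F :: "('q::finite \<Rightarrow> int) \<Rightarrow> int"
  shows "difference_function F a = (\<Sum>T\<in>UNIV. (- 1) ^ card T * F (a - (\<Sum>i\<in>T. unit_degree i)))"
proof -
  let ?g = "\<lambda>T :: 'q set. (- 1) ^ card T * F (a - (\<Sum>i\<in>T. unit_degree i))"
  have "(\<Sum>T\<in>UNIV. ?g T) = (\<Sum>p\<in>{0..card (UNIV :: 'q set)}. \<Sum>T | T \<in> UNIV \<and> card T = p. ?g T)"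
    by (rule sum.group[symmetric]) (use card_mono[of "UNIV :: 'q set"] in auto)
  also have "\<dots> = (\<Sum>T | card T = 0. ?g T) + (\<Sum>p = 1..card (UNIV :: 'q set). \<Sum>T | card T = p. ?g T)"
    by (simp add: sum.atLeast_Suc_atMost)
  also have "(\<Sum>T | card T = 0. ?g T) = F a"
  proof -
    have "{T :: 'q set. card T = 0} = {{}}" by auto
    then show ?thesis by simp
  qed
  also have "(\<Sum>p = 1..card (UNIV :: 'q set). \<Sum>T | card T = p. ?g T) =
      (\<Sum>p = 1..card (UNIV :: 'q set). (- 1) ^ p * (\<Sum>T | card T = p. F (a - (\<Sum>i\<in>T. unit_degree i))))"
    by (intro sum.cong refl) (simp add: sum_distrib_left)
  finally show ?thesis unfolding difference_function_def by (rule sym)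
qed

text \<open>
  The sets \<open>T\<close> and \<open>insert i T\<close>, with \<open>i \<notin> T\<close>, have opposite signs, and their terms cancel.
\<close>

lemma difference_function_zero_if_stationary:
  fixes F :: "('q::finite \<Rightarrow> int) \<Rightarrow> int"
  assumes "\<And>b. b i = a i \<Longrightarrow> F b = F (b - unit_degree i)"
  shows "difference_function F a = 0"
proof -
  let ?g = "\<lambda>T :: 'q set. (- 1) ^ card T * F (a - (\<Sum>i\<in>T. unit_degree i))"
  let ?N = "{T. i \<notin> T}"
  have split: "(UNIV :: 'q set set) = ?N \<union> insert i ` ?N"
  proof -
    have "T \<in> insert i ` ?N" if "i \<in> T" for T :: "'q set"
      using that by (intro image_eqI[of _ _ "T - {i}"]) auto
    then show ?thesis by blast
  qed
  have "(\<Sum>T\<in>UNIV. ?g T) = (\<Sum>T\<in>?N. ?g T) + (\<Sum>T\<in>insert i ` ?N. ?g T)"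
    by (subst split, rule sum.union_disjoint) auto
  also have "(\<Sum>T\<in>insert i ` ?N. ?g T) = (\<Sum>T\<in>?N. ?g (insert i T))"
    by (subst sum.reindex) (auto intro!: inj_onI simp: o_def)
  also have "\<dots> = (\<Sum>T\<in>?N. - ?g T)"
  proof (rule sum.cong[OF refl])
    fix T assume T: "T \<in> ?N"
    let ?b = "a - (\<Sum>i\<in>T. unit_degree i)"
    have "(\<Sum>j\<in>T. unit_degree j i) = (0 :: int)"
      using T by (intro sum.neutral) (auto simp: unit_degree_def)
    moreover have "(\<Sum>j\<in>T. unit_degree j) i = (\<Sum>j\<in>T. (unit_degree j i :: int))"
      by (induction T rule: infinite_finite_induct) auto
    ultimately have "F ?b = F (?b - unit_degree i)" by (intro assms) simp
    moreover have eq: "a - (\<Sum>j\<in>insert i T. unit_degree j) = ?b - unit_degree i"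
      using T by (simp add: algebra_simps)
    moreover have "card (insert i T) = Suc (card T)" using T by simp
    ultimately show "?g (insert i T) = - ?g T" unfolding eq by simp
  qed
  also have "(\<Sum>T\<in>?N. ?g T) + (\<Sum>T\<in>?N. - ?g T) = 0" by (simp add: sum_negf)
  finally show ?thesis unfolding difference_function_alt .
qed

theorem corollary4p6:
  fixes n :: "'q::finite \<Rightarrow> nat"
    and X :: "('q, 'k::field) ideal_sheaf"
    and s :: "'q \<Rightarrow> nat"
  assumes "\<And>i. 1 \<le> n i"
    and "closed_subscheme UNIV n X"
    and "zero_dimensional UNIV n X"
    and "\<And>i. s i = scheme_length {i} n (projection n X i)"
  shows "relevant {a. \<forall>i. a i \<in> {0..int (s i) - 1}} (hilbert_function n X)"
proof -
  interpret subscheme n X by standard (rule assms(2))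
  have s_pos: "0 < s i" for i
  proof -
    have "H (deg_at i (int 0)) \<le> int (s i)"
      unfolding assms(4) by (rule hilbert_function_le_length[OF assms(3)])
    then have "H 0 \<le> int (s i)" unfolding of_nat_0 deg_at_0 .
    then show ?thesis using hilbert_function_zero_degree[OF assms(3)] by linarith
  qed
  let ?D = "{a. \<forall>i. a i \<in> {0..int (s i) - 1}}"
  have "rectangular_domain ?D"
    unfolding rectangular_domain_def using s_pos
    by (intro exI[of _ "\<lambda>i. int (s i) - 1"]) (auto simp: le_fun_def)
  moreover have "difference_function H a = 0" if a: "a \<notin> ?D" for a
  proof -
    obtain i where "\<not> (0 \<le> a i \<and> a i \<le> int (s i) - 1)" using a by auto
    then have i: "a i < 0 \<or> int (s i) \<le> a i" by linarith
    show ?thesis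
    proof (rule difference_function_zero_if_stationary)
      fix b assume b: "b i = a i"
      have unit: "unit_degree i = deg_at i 1" by (auto simp: unit_degree_def deg_at_def)
      show "H b = H (b - unit_degree i)"
      proof (cases "0 \<le> b")
        case True
        then have "0 \<le> b i" by (simp add: le_fun_def)
        then have "int (s i) \<le> b i" using i b by simp
        then show ?thesis unfolding unit assms(4) by (intro hilbert_function_stationary[OF assms(3) True])
      next
        case False
        then obtain k where "b k < 0" by (auto simp: le_fun_def not_le)
        then have "(b - unit_degree i) k < 0" by (auto simp: unit_degree_def)
        then have "\<not> 0 \<le> b - unit_degree i" by (metis le_fun_def not_le zero_fun_apply)
        then show ?thesis using False hilbert_function_outside by simp
      qed
    qed
  qed
  ultimately show ?thesis unfolding relevant_def using hilbert_function_outside by blast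
qed

end
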